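(* Let $f(Z)=\sum_{i=1}^d \alpha_i Z^i\in\mathbb{R}[Z]$ be any polynomial of degree $d\ge 3$, and let $a,q$ be integers with $q\ge 1$, $\gcd(a,q)=1$ and $$\left|\alpha_d-\frac aq\right|<\frac1{q^2}.$$ Let $\ell$ be a positive integer. Then the Weyl sum twisted by the Rudin--Shapiro sequence, $$\mathsf{RS}_f(r,\ell)=\sum_{0\le n<2^r}\rho_n\,\mathbf{e}(\ell f(n)),$$ satisfies $$|\mathsf{RS}_f(r,\ell)|\le 2^{(1+o(1))r}\left(\ell^{\eta_1(d)}q^{-\eta_1(d)}+\ell^{\vartheta(d)}2^{-\zeta_1(d)r}+2^{-\zeta_2(d)r}+2^{-\zeta_3(d)r}q^{\eta_2(d)}\right)^{1/2}$$ as $r\to\infty$, where $$\eta_1(d)=\frac1{d^2-2d+2},\qquad \eta_2(d)=\frac1{(d-1)^2},\qquad \vartheta(d)=\frac1{d(d-1)},$$ $$\zeta_1(d)=\frac{d-2}{d(d-1)},\qquad \zeta_2(d)=\frac1{d^2-3d+3},\qquad \zeta_3(d)=\frac1{d-1}.$$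
   Context: $\mathbf{e}(z)=\exp(2\pi i z)$. The Rudin--Shapiro sequence is $\rho_n=(-1)^{\chi_{11}(n)}$, where $\chi_{11}(n)$ is the number of (possibly overlapping) occurrences of the block $11$ in the binary expansion of $n$. The notation $o(1)$ means: for every $\varepsilon>0$ there is $r_0$, depending only on $\varepsilon$ and $d$ (and not on $f,a,q,\ell$), such that for all $r\ge r_0$ the bound holds with $o(1)$ replaced by $\varepsilon$. *)

theory Defs
  imports "HOL-Analysis.Analysis" "HOL-Computational_Algebra.Polynomial"
begin

definition unit_exp :: "real \<Rightarrow> complex" where
  "unit_exp x = exp (2 * of_real pi * \<i> * of_real x)"

(* Position i is an occurrence of the block 11 when the digits at places i and i + 1 are both 1;
   distinct positions may overlap.  Only finitely many digits of a natural number are nonzero, so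
   the set below is finite. *)
definition chi11 :: "nat \<Rightarrow> nat" where
  "chi11 n = card {i. bit n i \<and> bit n (Suc i)}"

definition rudin_shapiro :: "nat \<Rightarrow> int" where
  "rudin_shapiro n = (- 1) ^ chi11 n"

definition RS :: "real poly \<Rightarrow> nat \<Rightarrow> nat \<Rightarrow> complex" where
  "RS f r l = (\<Sum>n<2 ^ r. of_int (rudin_shapiro n) * unit_exp (real l * poly f (real n)))"

definition eta1 :: "nat \<Rightarrow> real" where
  "eta1 d = 1 / (real d ^ 2 - 2 * real d + 2)"

definition eta2 :: "nat \<Rightarrow> real" where
  "eta2 d = 1 / (real d - 1) ^ 2"

definition vartheta :: "nat \<Rightarrow> real" where
  "vartheta d = 1 / (real d * (real d - 1))"

definition zeta1 :: "nat \<Rightarrow> real" where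
  "zeta1 d = (real d - 2) / (real d * (real d - 1))"

definition zeta2 :: "nat \<Rightarrow> real" where
  "zeta2 d = 1 / (real d ^ 2 - 3 * real d + 3)"

definition zeta3 :: "nat \<Rightarrow> real" where
  "zeta3 d = 1 / (real d - 1)"

end

theory Submission
  imports Defs
begin

text \<open>
  Splitting the binary digits of \<open>n = 2 ^ k * m + b\<close> makes \<open>\<rho>\<close> a product of functions of \<open>m\<close> and
  of \<open>b\<close>, up to a dependence on the parity of \<open>m\<close>.  Cauchy-Schwarz therefore removes the weights
  and leaves, for \<open>b \<noteq> b'\<close>, Weyl sums over \<open>m\<close> of degree \<open>d - 1\<close> with leading coefficient
  \<open>l * d * 2 ^ (k * (d - 1)) * (b - b') * \<alpha>\<close>.  Vinogradov's shifting argument bounds these by the mean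
  value of degree \<open>d - 2\<close> at the critical exponent \<open>(d - 1) * (d - 2)\<close> and by the spacing of the
  multiples of \<open>\<alpha>\<close>; the diagonal \<open>b = b'\<close> contributes \<open>2 ^ (-k)\<close>, and \<open>k\<close> is chosen to balance it.

  The critical mean value (the theorem of Bourgain, Demeter and Guth) follows from \<open>p\<close>-adic
  \<open>l\<^sup>2\<close> decoupling for the moment curve, along the lines of the short bilinear argument of Guo, Li, Yung
  and Zorin-Kranich.  If two residue classes are distinct modulo \<open>p\<close>, then translating the phase by
  polynomials that vanish to high order on one of them leaves its exponential sum unchanged, while
  the other class still sees a nondegenerate curve of lower degree, to which induction on the degree
  applies.  Exchanging the roles of the two classes by Hoelder's inequality and iterating gains an
  unbounded number of scales, which no positive exponent of the decoupling constant survives.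
\<close>

section \<open>Averages and exponential sums\<close>

text \<open>The real torus is replaced by the finite group of coefficient vectors modulo
  \<open>p ^ c\<close>: averages are finite sums, residue classes play the part of intervals, and a
  phase divisible by \<open>p ^ c\<close> is exactly trivial, so no tails or smooth cutoffs arise. A
  single prime \<open>p > k\<close> is enough: constants may depend on \<open>p\<close> because the
  mean value concerns integers only, and \<open>p > k\<close> turns the factorials of Hermite
  interpolation into units. The obstacle is that transversality at degree \<open>l\<close> refines a
  class only up to the scale \<open>a'\<close> with \<open>l * a' <= (k - l + 1) * b\<close>. The
  exchange is arranged so that savings move between degrees without loss, while degree 0, which is
  pure rescaling, injects \<open>(k - 1) / k\<close> into their sum in every round. The exponents of
  the theorem come from the final optimisation. With \<open>n = (d - 1) * (d - 2)\<close> and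
  \<open>B = 2 ^ k\<close>, the \<open>n\<close>-th power of the normalised Weyl sum has four terms
  \<open>y * B ^ j\<close> with \<open>j\<close> equal to \<open>d\<close>,
  \<open>2 * d - 2\<close>, \<open>1\<close>, \<open>d - 1\<close>; balancing against the diagonal
  \<open>1 / B\<close> produces the roots of order \<open>n + j\<close>.\<close>

lemma holder_two:
  fixes w u v :: "'a \<Rightarrow> real"
  assumes "\<And>x. x \<in> X \<Longrightarrow> 0 \<le> u x" "\<And>x. x \<in> X \<Longrightarrow> 0 \<le> v x"
    and ab: "0 < \<alpha>" "0 < \<beta>" "\<alpha> + \<beta> = 1"
  shows "(\<Sum>x\<in>X. u x powr \<alpha> * v x powr \<beta>) \<le> (\<Sum>x\<in>X. u x) powr \<alpha> * (\<Sum>x\<in>X. v x) powr \<beta>"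
proof (cases "finite X \<and> (\<Sum>x\<in>X. u x) \<noteq> 0 \<and> (\<Sum>x\<in>X. v x) \<noteq> 0")
  case False
  \<comment> \<open>A vanishing sum of nonnegative terms forces every term to vanish, and
    \<open>0 powr _ = 0\<close>; an infinite \<open>X\<close> makes all sums 0.\<close>
  have "u x powr \<alpha> * v x powr \<beta> = 0" if "x \<in> X" "finite X" for x
    using that False assms by (auto simp: sum_nonneg_eq_0_iff)
  then have "(\<Sum>x\<in>X. u x powr \<alpha> * v x powr \<beta>) = 0"
    by (cases "finite X") (auto intro: sum.neutral)
  then show ?thesis by simp
next
  case True
  define A where "A = (\<Sum>x\<in>X. u x)"
  define B where "B = (\<Sum>x\<in>X. v x)"
  have A: "A > 0" and B: "B > 0"
    using True assms sum_nonneg[of X u] sum_nonneg[of X v] unfolding A_def B_def by force+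
  have "u x powr \<alpha> * v x powr \<beta> \<le> A powr \<alpha> * B powr \<beta> * (\<alpha> * (u x / A) + \<beta> * (v x / B))"
    if x: "x \<in> X" for x
  proof (cases "u x = 0 \<or> v x = 0")
    case True
    then show ?thesis using assms x A B by auto
  next
    case False
    then have pos: "u x > 0" "v x > 0" using assms x by (force simp: less_le)+
    have "u x powr \<alpha> * v x powr \<beta> = A powr \<alpha> * B powr \<beta> * ((u x / A) powr \<alpha> * (v x / B) powr \<beta>)"
      using A B pos by (simp add: powr_divide)
    also have "\<dots> \<le> A powr \<alpha> * B powr \<beta> * (\<alpha> * (u x / A) + \<beta> * (v x / B))"
      using Youngs_inequality_0[of \<alpha> \<beta> "u x / A" "v x / B"] ab A B pos
      by (intro mult_left_mono) auto
    finally show ?thesis .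
  qed
  then have "(\<Sum>x\<in>X. u x powr \<alpha> * v x powr \<beta>)
      \<le> (\<Sum>x\<in>X. A powr \<alpha> * B powr \<beta> * (\<alpha> * (u x / A) + \<beta> * (v x / B)))"
    by (rule sum_mono)
  also have "\<dots> = A powr \<alpha> * B powr \<beta> * (\<alpha> * (A / A) + \<beta> * (B / B))"
    by (simp add: sum.distrib A_def B_def flip: sum_distrib_left sum_divide_distrib)
  also have "\<dots> = A powr \<alpha> * B powr \<beta>" using A B ab by simp
  finally show ?thesis by (simp add: A_def B_def)
qed

text \<open>The triangle inequality of weighted \<open>L^s\<close>, raised to the power
  \<open>s\<close>. One factor is peeled off the \<open>s\<close>-th power of the sum, Hoelder with
  exponents \<open>1 / s\<close> and \<open>1 - 1 / s\<close> is applied to each summand, and the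
  common power of the left side is cancelled.\<close>

lemma weighted_minkowski:
  fixes w :: "'a \<Rightarrow> real" and u :: "'i \<Rightarrow> 'a \<Rightarrow> real"
  assumes w: "\<And>x. x \<in> X \<Longrightarrow> 0 \<le> w x" and u: "\<And>i x. i \<in> I \<Longrightarrow> x \<in> X \<Longrightarrow> 0 \<le> u i x" and s: "s \<ge> 1"
  shows "(\<Sum>x\<in>X. w x * (\<Sum>i\<in>I. u i x) ^ s) \<le> (\<Sum>i\<in>I. (\<Sum>x\<in>X. w x * u i x ^ s) powr (1 / real s)) ^ s"
proof (cases "s = 1")
  case True
  then show ?thesis
    using w u by (simp add: sum_distrib_left sum_nonneg sum.swap[of _ X I])
next
  case False
  then have s2: "s \<ge> 2" using s by simp
  define U where "U x = (\<Sum>i\<in>I. u i x)" for x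
  define T where "T = (\<Sum>x\<in>X. w x * U x ^ s)"
  define R where "R = (\<Sum>i\<in>I. (\<Sum>x\<in>X. w x * u i x ^ s) powr (1 / real s))"
  have U0: "U x \<ge> 0" if "x \<in> X" for x unfolding U_def using u that by (simp add: sum_nonneg)
  have T0: "T \<ge> 0" unfolding T_def using w U0 by (simp add: sum_nonneg)
  have R0: "R \<ge> 0" unfolding R_def by (simp add: sum_nonneg)
  have pw: "(x ^ s) powr (1 / real s) = x" "(x ^ s) powr (1 - 1 / real s) = x ^ (s - 1)" if "x \<ge> 0" for x :: real
  proof -
    show "(x ^ s) powr (1 / real s) = x"
      using that s by (cases "x = 0") (simp_all add: powr_powr flip: powr_realpow)
    have "real s * (1 - 1 / real s) = real (s - 1)" using s by (simp add: field_simps of_nat_diff)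
    then show "(x ^ s) powr (1 - 1 / real s) = x ^ (s - 1)"
      using that s s2 by (cases "x = 0") (simp_all add: powr_powr zero_power flip: powr_realpow)
  qed
  have "T = (\<Sum>x\<in>X. \<Sum>i\<in>I. w x * (u i x * U x ^ (s - 1)))"
    unfolding T_def
    using s by (intro sum.cong refl) (simp add: U_def sum_distrib_left sum_distrib_right power_eq_if[of _ s])
  also have "\<dots> = (\<Sum>i\<in>I. \<Sum>x\<in>X. w x * (u i x * U x ^ (s - 1)))" by (rule sum.swap)
  also have "\<dots> \<le> (\<Sum>i\<in>I. (\<Sum>x\<in>X. w x * u i x ^ s) powr (1 / real s) * T powr (1 - 1 / real s))"
  proof (rule sum_mono)
    fix i assume i: "i \<in> I"
    have "(\<Sum>x\<in>X. w x * (u i x * U x ^ (s - 1)))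
        = (\<Sum>x\<in>X. (w x * u i x ^ s) powr (1 / real s) * (w x * U x ^ s) powr (1 - 1 / real s))"
    proof (intro sum.cong refl)
      fix x assume x: "x \<in> X"
      have "w x powr (1 / real s) * w x powr (1 - 1 / real s) = w x"
        using w[OF x] by (simp flip: powr_add)
      moreover have "(w x * u i x ^ s) powr (1 / real s) * (w x * U x ^ s) powr (1 - 1 / real s)
          = (w x powr (1 / real s) * w x powr (1 - 1 / real s))
            * ((u i x ^ s) powr (1 / real s) * (U x ^ s) powr (1 - 1 / real s))"
        unfolding powr_mult by (rule mult.assoc[THEN trans]) (simp only: mult.left_commute mult.assoc)
      ultimately show "w x * (u i x * U x ^ (s - 1))
          = (w x * u i x ^ s) powr (1 / real s) * (w x * U x ^ s) powr (1 - 1 / real s)"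
        by (simp only: pw(1)[OF u[OF i x]] pw(2)[OF U0[OF x]])
    qed
    also have "\<dots> \<le> (\<Sum>x\<in>X. w x * u i x ^ s) powr (1 / real s) * T powr (1 - 1 / real s)"
      unfolding T_def using w u[OF i] U0 s2 by (intro holder_two) auto
    finally show "(\<Sum>x\<in>X. w x * (u i x * U x ^ (s - 1))) \<le> \<dots>" .
  qed
  also have "\<dots> = R * T powr (1 - 1 / real s)" by (simp add: R_def sum_distrib_right)
  finally have TR: "T \<le> R * T powr (1 - 1 / real s)" .
  have "T \<le> R ^ s"
  proof (cases "T = 0")
    case True then show ?thesis using R0 by simp
  next
    case False
    with T0 have T: "T > 0" by simp
    have "T powr (1 / real s) * T powr (1 - 1 / real s) = T"
      using T by (simp flip: powr_add)
    with TR have "T powr (1 / real s) \<le> R"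
      using T by (metis mult_le_cancel_right powr_gt_zero not_less_iff_gr_or_eq)
    then have "(T powr (1 / real s)) ^ s \<le> R ^ s" by (intro power_mono) auto
    moreover have "(T powr (1 / real s)) ^ s = T"
      using T s by (simp add: powr_powr flip: powr_realpow)
    ultimately show ?thesis by simp
  qed
  then show ?thesis by (simp add: T_def R_def U_def)
qed

lemma power_powr_inverse: "x \<ge> 0 \<Longrightarrow> s \<ge> 1 \<Longrightarrow> (x ^ s) powr (1 / real s) = x"
  by (cases "x = 0") (simp_all add: powr_powr flip: powr_realpow)

lemma powr_inverse_power: "x \<ge> 0 \<Longrightarrow> s \<ge> 1 \<Longrightarrow> (x powr (1 / real s)) ^ s = x"
  by (cases "x = 0") (simp_all add: powr_powr flip: powr_realpow)

definition avg :: "'a set \<Rightarrow> ('a \<Rightarrow> real) \<Rightarrow> real" where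
  "avg X F = (\<Sum>x\<in>X. F x) / real (card X)"

lemma avg_nonneg: "(\<And>x. x \<in> X \<Longrightarrow> 0 \<le> F x) \<Longrightarrow> 0 \<le> avg X F"
  by (simp add: avg_def sum_nonneg)

lemma avg_mono: "(\<And>x. x \<in> X \<Longrightarrow> F x \<le> G x) \<Longrightarrow> avg X F \<le> avg X G"
  by (simp add: avg_def divide_right_mono sum_mono)

lemma avg_cong: "X = Y \<Longrightarrow> (\<And>x. x \<in> Y \<Longrightarrow> F x = G x) \<Longrightarrow> avg X F = avg Y G"
  by (simp add: avg_def)

lemma avg_cmult: "avg X (\<lambda>x. c * F x) = c * avg X F"
  by (simp add: avg_def flip: sum_distrib_left)

lemma avg_add: "avg X (\<lambda>x. F x + G x) = avg X F + avg X G"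
  by (simp add: avg_def sum.distrib add_divide_distrib)

lemma avg_sum: "avg X (\<lambda>x. \<Sum>i\<in>I. F i x) = (\<Sum>i\<in>I. avg X (F i))"
  by (simp add: avg_def sum.swap[of _ X I] sum_divide_distrib)

lemma avg_const: "finite X \<Longrightarrow> X \<noteq> {} \<Longrightarrow> avg X (\<lambda>x. c) = c"
  by (simp add: avg_def)

lemma avg_swap: "avg X (\<lambda>x. avg Y (F x)) = avg Y (\<lambda>y. avg X (\<lambda>x. F x y))"
  unfolding avg_def sum_divide_distrib[symmetric]
  by (subst sum.swap) (simp add: mult.commute)

lemma avg_minkowski:
  fixes w :: "'a \<Rightarrow> real" and u :: "'i \<Rightarrow> 'a \<Rightarrow> real"
  assumes "\<And>x. x \<in> X \<Longrightarrow> 0 \<le> w x" and "\<And>i x. i \<in> I \<Longrightarrow> x \<in> X \<Longrightarrow> 0 \<le> u i x" and "s \<ge> 1"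
  shows "avg X (\<lambda>x. w x * (\<Sum>i\<in>I. u i x) ^ s) \<le> (\<Sum>i\<in>I. avg X (\<lambda>x. w x * u i x ^ s) powr (1 / real s)) ^ s"
  using weighted_minkowski[of X "\<lambda>x. w x / card X" I u s] assms
  by (simp add: avg_def sum_divide_distrib)

lemma avg_holder:
  fixes u v :: "'a \<Rightarrow> real"
  assumes "\<And>x. x \<in> X \<Longrightarrow> 0 \<le> u x" "\<And>x. x \<in> X \<Longrightarrow> 0 \<le> v x"
    and "0 < \<alpha>" "0 < \<beta>" "\<alpha> + \<beta> = 1"
  shows "avg X (\<lambda>x. u x powr \<alpha> * v x powr \<beta>) \<le> avg X u powr \<alpha> * avg X v powr \<beta>"
proof -
  have "(\<Sum>x\<in>X. (u x / card X) powr \<alpha> * (v x / card X) powr \<beta>) \<le> avg X u powr \<alpha> * avg X v powr \<beta>"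
    using holder_two[of X "\<lambda>x. u x / card X" "\<lambda>x. v x / card X" \<alpha> \<beta>] assms
    by (simp add: avg_def sum_divide_distrib)
  moreover have "(u x / card X) powr \<alpha> * (v x / card X) powr \<beta> = u x powr \<alpha> * v x powr \<beta> / card X" for x
  proof -
    have "real (card X) powr \<alpha> * real (card X) powr \<beta> = card X"
      using assms by (simp flip: powr_add)
    then show ?thesis by (simp add: powr_divide)
  qed
  ultimately show ?thesis by (simp add: avg_def sum_divide_distrib)
qed

section \<open>Additive characters and the finite torus of coefficients\<close>

lemma unit_exp_cis: "unit_exp x = cis (2 * pi * x)"
  by (simp add: unit_exp_def cis_conv_exp mult_ac)

lemma norm_unit_exp [simp]: "norm (unit_exp x) = 1"
  by (simp add: unit_exp_cis)

lemma unit_exp_add: "unit_exp (x + y) = unit_exp x * unit_exp y"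
  by (simp add: unit_exp_cis cis_mult ring_distribs)

lemma unit_exp_0 [simp]: "unit_exp 0 = 1"
  by (simp add: unit_exp_cis)

lemma unit_exp_minus: "unit_exp (- x) = cnj (unit_exp x)"
  by (simp add: unit_exp_cis cis_cnj)

lemma unit_exp_diff: "unit_exp (x - y) = unit_exp x * cnj (unit_exp y)"
  using unit_exp_add[of x "- y"] by (simp add: unit_exp_minus)

lemma unit_exp_of_int [simp]: "unit_exp (real_of_int n) = 1"
  using cis_multiple_2pi[of "real_of_int n"] by (simp add: unit_exp_cis)

lemma unit_exp_cong_mod:
  assumes "Q > 0" "x mod Q = y mod (Q::int)"
  shows "unit_exp (real_of_int x / real_of_int Q) = unit_exp (real_of_int y / real_of_int Q)"
proof -
  obtain k where "x = y + Q * k" using assms(2) by (metis add.commute mod_eqE)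
  then have "real_of_int x / real_of_int Q = real_of_int y / real_of_int Q + real_of_int k"
    using assms(1) by (simp add: field_simps)
  then show ?thesis by (simp add: unit_exp_add)
qed

lemma unit_exp_eq_1_iff: "unit_exp x = 1 \<longleftrightarrow> x \<in> \<int>"
proof
  assume "unit_exp x = 1"
  then have "cos (2 * pi * x) = 1" by (simp add: unit_exp_cis complex_eq_iff)
  then obtain n :: int where "2 * pi * x = real_of_int n * 2 * pi"
    by (auto simp: cos_one_2pi_int)
  then show "x \<in> \<int>" by simp
qed (auto elim: Ints_cases)

text \<open>The finite torus of phases of degree at most \<open>k\<close> modulo \<open>Q\<close>.
  The constant coefficient is included so that every integer polynomial of degree at most
  \<open>k\<close> acts by translation.\<close>

definition coeff_box :: "nat \<Rightarrow> int \<Rightarrow> (nat \<Rightarrow> int) set" where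
  "coeff_box k Q = PiE {..k} (\<lambda>_. {0..<Q})"

definition coeff_eval :: "nat \<Rightarrow> (nat \<Rightarrow> int) \<Rightarrow> int \<Rightarrow> int" where
  "coeff_eval k g n = (\<Sum>j\<le>k. g j * n ^ j)"

definition shift_coeffs :: "nat \<Rightarrow> int \<Rightarrow> int poly \<Rightarrow> (nat \<Rightarrow> int) \<Rightarrow> nat \<Rightarrow> int" where
  "shift_coeffs k Q H g = (\<lambda>j\<in>{..k}. (g j + coeff H j) mod Q)"

lemma finite_coeff_box [simp]: "finite (coeff_box k Q)"
  by (simp add: coeff_box_def finite_PiE)

lemma coeff_box_nonempty [simp]: "Q > 0 \<Longrightarrow> coeff_box k Q \<noteq> {}"
  by (auto simp: coeff_box_def PiE_eq_empty_iff)

lemma shift_coeffs_in: "Q > 0 \<Longrightarrow> shift_coeffs k Q H g \<in> coeff_box k Q"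
  by (auto simp: coeff_box_def shift_coeffs_def)

lemma shift_coeffs_inverse:
  assumes "g \<in> coeff_box k Q" shows "shift_coeffs k Q (- H) (shift_coeffs k Q H g) = g"
proof
  fix j
  show "shift_coeffs k Q (- H) (shift_coeffs k Q H g) j = g j"
  proof (cases "j \<le> k")
    case True
    then have "g j \<in> {0..<Q}" using assms by (auto simp: coeff_box_def)
    then show ?thesis using True by (simp add: shift_coeffs_def mod_diff_left_eq)
  next
    case False
    then show ?thesis using assms by (simp add: shift_coeffs_def coeff_box_def PiE_def extensional_def)
  qed
qed

lemma bij_shift_coeffs:
  assumes "Q > 0" shows "bij_betw (shift_coeffs k Q H) (coeff_box k Q) (coeff_box k Q)"
  by (rule bij_betw_byWitness[where f' = "shift_coeffs k Q (- H)"])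
    (use assms shift_coeffs_in shift_coeffs_inverse[where H = H] shift_coeffs_inverse[where H = "- H"] in auto)

text \<open>Haar invariance of the finite torus, since adding a polynomial permutes the coefficient
  vectors. Averaging over translates rests on it.\<close>

lemma avg_shift_coeffs:
  "Q > 0 \<Longrightarrow> avg (coeff_box k Q) (\<lambda>g. F (shift_coeffs k Q H g)) = avg (coeff_box k Q) F"
  unfolding avg_def using sum.reindex_bij_betw[OF bij_shift_coeffs[of Q k H], of F] by simp

lemma poly_eq_sum_le:
  "degree H \<le> k \<Longrightarrow> poly H x = (\<Sum>j\<le>k. coeff H j * x ^ j)" for H :: "'a::comm_semiring_1 poly"
  unfolding poly_altdef
  by (rule sum.mono_neutral_left) (auto simp: coeff_eq_0)

lemma coeff_eval_shift:
  assumes "Q > 0" "degree H \<le> k"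
  shows "coeff_eval k (shift_coeffs k Q H g) n mod Q = (coeff_eval k g n + poly H n) mod Q"
proof -
  have "coeff_eval k g n + poly H n = (\<Sum>j\<le>k. (g j + coeff H j) * n ^ j)"
    by (simp add: coeff_eval_def poly_eq_sum_le[OF assms(2)] sum.distrib ring_distribs)
  moreover have "(\<Sum>j\<le>k. shift_coeffs k Q H g j * n ^ j) mod Q = (\<Sum>j\<le>k. (shift_coeffs k Q H g j * n ^ j) mod Q) mod Q"
    by (rule mod_sum_eq[symmetric])
  moreover have "\<dots> = (\<Sum>j\<le>k. ((g j + coeff H j) * n ^ j) mod Q) mod Q"
    by (rule arg_cong[where f = "\<lambda>x. x mod Q"], rule sum.cong)
      (simp_all only: shift_coeffs_def restrict_apply' mod_mult_left_eq)
  moreover have "\<dots> = (\<Sum>j\<le>k. (g j + coeff H j) * n ^ j) mod Q"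
    by (rule mod_sum_eq)
  ultimately show ?thesis by (simp add: coeff_eval_def)
qed

definition exp_sum :: "nat \<Rightarrow> int \<Rightarrow> (int \<Rightarrow> complex) \<Rightarrow> int set \<Rightarrow> (nat \<Rightarrow> int) \<Rightarrow> complex" where
  "exp_sum k Q a A g = (\<Sum>n\<in>A. a n * unit_exp (real_of_int (coeff_eval k g n) / real_of_int Q))"

text \<open>Translating the phase amounts to a unimodular twist of the weights. Hence a translation
  by a polynomial that is \<open>0\<close> modulo \<open>Q\<close> on \<open>A\<close> changes
  nothing, and one that is constant modulo \<open>Q\<close> changes only the argument.\<close>

lemma exp_sum_shift:
  assumes "Q > 0" "degree H \<le> k"
  shows "exp_sum k Q a A (shift_coeffs k Q H g)
    = exp_sum k Q (\<lambda>n. a n * unit_exp (real_of_int (poly H n) / real_of_int Q)) A g"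
proof -
  have "unit_exp (real_of_int (coeff_eval k (shift_coeffs k Q H g) n) / real_of_int Q)
      = unit_exp (real_of_int (poly H n) / real_of_int Q) * unit_exp (real_of_int (coeff_eval k g n) / real_of_int Q)" for n
    using unit_exp_cong_mod[OF assms(1) coeff_eval_shift[OF assms]]
    by (simp add: add_divide_distrib unit_exp_add mult.commute)
  then show ?thesis by (simp add: exp_sum_def mult.assoc)
qed

section \<open>Decoupling constants\<close>

definition critical :: "nat \<Rightarrow> nat" where
  "critical k = k * (k + 1) div 2"

lemma critical_pos: "k \<ge> 1 \<Longrightarrow> critical k \<ge> 1"
  using mult_le_mono[of 1 k 2 "k + 1"] by (simp add: critical_def)

lemma real_critical: "real (critical k) = real k * (real k + 1) / 2"
  by (simp add: critical_def real_of_nat_div algebra_simps)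

text \<open>A class modulo \<open>p ^ m\<close> is the p-adic interval of length
  \<open>p ^ (-m)\<close>.\<close>

definition residue_part :: "int \<Rightarrow> nat \<Rightarrow> int set \<Rightarrow> int \<Rightarrow> int set" where
  "residue_part p m A \<theta> = {n \<in> A. n mod p ^ m = \<theta>}"

definition moment :: "nat \<Rightarrow> int \<Rightarrow> nat \<Rightarrow> (int \<Rightarrow> complex) \<Rightarrow> int set \<Rightarrow> real" where
  "moment k Q s a A = avg (coeff_box k Q) (\<lambda>g. norm (exp_sum k Q a A g) ^ (2 * s))"

text \<open>The \<open>1 / s\<close>-th power of a moment of order \<open>2 * s\<close> is the
  square of an \<open>L^(2 s)\<close> norm, so this is the square of the \<open>l2\<close> sum of
  norms in a decoupling inequality.\<close>

definition norm_sum_parts :: "int \<Rightarrow> nat \<Rightarrow> nat \<Rightarrow> int \<Rightarrow> (int \<Rightarrow> complex) \<Rightarrow> int set \<Rightarrow> real" where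
  "norm_sum_parts p m k Q a A = (\<Sum>\<theta>\<in>{0..<p ^ m}. moment k Q (critical k) a (residue_part p m A \<theta>) powr (1 / real (critical k)))"

text \<open>\<open>C\<close> is the usual \<open>l\<^sup>2\<close> decoupling constant raised to the critical power
  \<open>2 * critical k = k * (k + 1)\<close>.\<close>

definition decoupled :: "int \<Rightarrow> nat \<Rightarrow> nat \<Rightarrow> real \<Rightarrow> bool" where
  "decoupled p k m C \<longleftrightarrow> (\<forall>c a A. c \<ge> k * m \<longrightarrow> finite A \<longrightarrow>
     moment k (p ^ c) (critical k) a A \<le> C * norm_sum_parts p m k (p ^ c) a A ^ critical k)"

text \<open>The factor \<open>K\<close> may depend on \<open>p\<close>, \<open>k\<close> and
  \<open>e\<close> but not on the number \<open>m\<close> of scales.\<close>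

abbreviation decoupling_exponent :: "int \<Rightarrow> nat \<Rightarrow> real \<Rightarrow> bool" where
  "decoupling_exponent p k e \<equiv> \<exists>K>0. \<forall>m. decoupled p k m (K * real_of_int p powr (e * real m))"

lemma finite_residue_part [simp]: "finite A \<Longrightarrow> finite (residue_part p m A \<theta>)"
  by (simp add: residue_part_def)

lemma exp_sum_empty [simp]: "exp_sum k Q a {} g = 0"
  by (simp add: exp_sum_def)

lemma norm_sum_parts_nonneg: "norm_sum_parts p m k Q a A \<ge> 0"
  unfolding norm_sum_parts_def by (simp add: sum_nonneg)

lemma moment_empty: "s \<ge> 1 \<Longrightarrow> moment k Q s a {} = 0"
  by (simp add: moment_def avg_def)

lemma exp_sum_partition:
  assumes "finite A" "p > 0"
  shows "exp_sum k Q a A g = (\<Sum>\<theta>\<in>{0..<p ^ m}. exp_sum k Q a (residue_part p m A \<theta>) g)"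
  unfolding exp_sum_def residue_part_def
  by (rule sum.group[symmetric]) (use assms in auto)

lemma residue_part_cls:
  assumes "m' \<le> m"
  shows "residue_part p m (residue_part p m' A I) \<theta> = (if \<theta> mod p ^ m' = I then residue_part p m A \<theta> else {})"
proof -
  have "n mod p ^ m mod p ^ m' = n mod p ^ m'" for n
    using assms by (simp add: mod_mod_cancel le_imp_power_dvd)
  then show ?thesis by (auto simp: residue_part_def)
qed

text \<open>Each class modulo \<open>p ^ m\<close> lies in exactly one class modulo
  \<open>p ^ m'\<close>, and empty pieces contribute 0. This additivity of squared norms is what
  lets decoupling inequalities at successive scales be composed.\<close>

lemma norm_sum_parts_split:
  assumes "m' \<le> m" "p > 0" "k \<ge> 1"
  shows "(\<Sum>I\<in>{0..<p ^ m'}. norm_sum_parts p m k Q a (residue_part p m' A I)) = norm_sum_parts p m k Q a A"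
proof -
  let ?f = "\<lambda>B. moment k Q (critical k) a B powr (1 / real (critical k))"
  have "(\<Sum>I\<in>{0..<p ^ m'}. norm_sum_parts p m k Q a (residue_part p m' A I))
      = (\<Sum>\<theta>\<in>{0..<p ^ m}. \<Sum>I\<in>{0..<p ^ m'}. ?f (residue_part p m (residue_part p m' A I) \<theta>))"
    unfolding norm_sum_parts_def by (rule sum.swap)
  also have "\<dots> = (\<Sum>\<theta>\<in>{0..<p ^ m}. \<Sum>I\<in>{0..<p ^ m'}. if \<theta> mod p ^ m' = I then ?f (residue_part p m A \<theta>) else 0)"
    using assms moment_empty[OF critical_pos[OF assms(3)]] by (intro sum.cong refl) (simp add: residue_part_cls)
  also have "\<dots> = (\<Sum>\<theta>\<in>{0..<p ^ m}. ?f (residue_part p m A \<theta>))"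
    using assms(2) by (intro sum.cong refl) (simp add: sum.delta')
  finally show ?thesis by (simp add: norm_sum_parts_def)
qed

lemma norm_sum_parts_cls_le:
  assumes "m' \<le> m" "p > 0" "k \<ge> 1" "I \<in> {0..<p ^ m'}"
  shows "norm_sum_parts p m k Q a (residue_part p m' A I) \<le> norm_sum_parts p m k Q a A"
  using member_le_sum[of I "{0..<p ^ m'}" "\<lambda>I. norm_sum_parts p m k Q a (residue_part p m' A I)"] assms norm_sum_parts_nonneg
  by (simp add: norm_sum_parts_split)

text \<open>By translation invariance an average over the torus may be taken first over the
  translates by \<open>H y\<close>. The weight is constant along them and comes out, the hypothesis
  is applied pointwise in \<open>g\<close>, and Minkowski moves the outer average inside the
  sum.\<close>

lemma subaverage:
  fixes w U :: "(nat \<Rightarrow> int) \<Rightarrow> real" and H :: "'y \<Rightarrow> int poly"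
  assumes Q: "Q > 0" and Y: "finite Y" "Y \<noteq> {}" and s: "s \<ge> 1" and C: "C \<ge> 0"
    and w0: "\<And>g. w g \<ge> 0"
    and w: "\<And>g y. g \<in> coeff_box k Q \<Longrightarrow> y \<in> Y \<Longrightarrow> w (shift_coeffs k Q (H y) g) = w g"
    and V0: "\<And>i g. V i g \<ge> 0"
    and pt: "\<And>g. g \<in> coeff_box k Q \<Longrightarrow> avg Y (\<lambda>y. U (shift_coeffs k Q (H y) g))
        \<le> C * (\<Sum>i\<in>I. avg Y (\<lambda>y. V i (shift_coeffs k Q (H y) g)) powr (1 / real s)) ^ s"
  shows "avg (coeff_box k Q) (\<lambda>g. w g * U g)
    \<le> C * (\<Sum>i\<in>I. avg (coeff_box k Q) (\<lambda>g. w g * V i g) powr (1 / real s)) ^ s"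
proof -
  have av: "avg (coeff_box k Q) (\<lambda>g. w g * avg Y (\<lambda>y. F (shift_coeffs k Q (H y) g)))
      = avg (coeff_box k Q) (\<lambda>g. w g * F g)" for F :: "(nat \<Rightarrow> int) \<Rightarrow> real"
  proof -
    have "avg (coeff_box k Q) (\<lambda>g. w g * avg Y (\<lambda>y. F (shift_coeffs k Q (H y) g)))
        = avg (coeff_box k Q) (\<lambda>g. avg Y (\<lambda>y. w (shift_coeffs k Q (H y) g) * F (shift_coeffs k Q (H y) g)))"
      by (intro avg_cong refl) (simp add: w flip: avg_cmult cong: avg_cong)
    also have "\<dots> = avg Y (\<lambda>y. avg (coeff_box k Q) (\<lambda>g. w (shift_coeffs k Q (H y) g) * F (shift_coeffs k Q (H y) g)))"
      by (rule avg_swap)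
    also have "\<dots> = avg Y (\<lambda>y. avg (coeff_box k Q) (\<lambda>g. w g * F g))"
      using avg_shift_coeffs[OF Q, where F = "\<lambda>g. w g * F g"] by simp
    finally show ?thesis by (simp add: avg_const[OF Y])
  qed
  let ?v = "\<lambda>i g. avg Y (\<lambda>y. V i (shift_coeffs k Q (H y) g))"
  have v0: "?v i g \<ge> 0" for i g by (rule avg_nonneg) (rule V0)
  have "avg (coeff_box k Q) (\<lambda>g. w g * U g) = avg (coeff_box k Q) (\<lambda>g. w g * avg Y (\<lambda>y. U (shift_coeffs k Q (H y) g)))"
    by (rule av[symmetric])
  also have "\<dots> \<le> avg (coeff_box k Q) (\<lambda>g. w g * (C * (\<Sum>i\<in>I. ?v i g powr (1 / real s)) ^ s))"
    by (intro avg_mono mult_left_mono pt w0)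
  also have "\<dots> = C * avg (coeff_box k Q) (\<lambda>g. w g * (\<Sum>i\<in>I. ?v i g powr (1 / real s)) ^ s)"
    by (simp add: mult.left_commute flip: avg_cmult)
  \<comment> \<open>Minkowski in \<open>L^s\<close> with weight \<open>w\<close>; its
    \<open>s\<close>-th powers then undo the roots of the inner averages.\<close>
  also have "\<dots> \<le> C * (\<Sum>i\<in>I. avg (coeff_box k Q) (\<lambda>g. w g * (?v i g powr (1 / real s)) ^ s) powr (1 / real s)) ^ s"
    using s w0 C by (intro mult_left_mono avg_minkowski) auto
  also have "\<dots> = C * (\<Sum>i\<in>I. avg (coeff_box k Q) (\<lambda>g. w g * V i g) powr (1 / real s)) ^ s"
    using v0 s by (simp add: powr_inverse_power av)
  finally show ?thesis .
qed

text \<open>The substitution \<open>u \<mapsto> \<xi> + p ^ a * u\<close> maps distinct classes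
  modulo \<open>p ^ \<mu>\<close> into distinct classes modulo \<open>p ^ (a + \<mu>)\<close>. The
  classes missed by it can only enlarge the right side.\<close>

lemma norm_sum_parts_affine_le:
  fixes p \<xi> :: int
  assumes p: "p > 0" and \<Phi>: "\<And>B. \<Phi> B \<ge> 0"
  shows "(\<Sum>\<nu>\<in>{0..<p ^ \<mu>}. \<Phi> ((\<lambda>u. \<xi> + p ^ a * u) ` residue_part p \<mu> A' \<nu>))
    \<le> (\<Sum>\<theta>\<in>{0..<p ^ (a + \<mu>)}. \<Phi> (residue_part p (a + \<mu>) ((\<lambda>u. \<xi> + p ^ a * u) ` A') \<theta>) :: real)"
proof -
  let ?t = "\<lambda>u. \<xi> + p ^ a * u"
  let ?r = "\<lambda>\<nu>. ?t \<nu> mod p ^ (a + \<mu>)"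
  have pp: "p ^ a \<noteq> 0" "p ^ (a + \<mu>) > 0" "p ^ \<mu> > 0" using p by auto
  have key: "?t u mod p ^ (a + \<mu>) = ?t v mod p ^ (a + \<mu>) \<longleftrightarrow> u mod p ^ \<mu> = v mod p ^ \<mu>" for u v
  proof -
    have "?t u mod p ^ (a + \<mu>) = ?t v mod p ^ (a + \<mu>) \<longleftrightarrow> p ^ (a + \<mu>) dvd p ^ a * (u - v)"
      by (simp add: mod_eq_dvd_iff algebra_simps)
    also have "\<dots> \<longleftrightarrow> p ^ \<mu> dvd u - v" using p by (simp add: power_add)
    finally show ?thesis by (simp add: mod_eq_dvd_iff)
  qed
  have inj: "inj_on ?r {0..<p ^ \<mu>}"
    by (rule inj_onI) (use key in auto)
  have im: "?r ` {0..<p ^ \<mu>} \<subseteq> {0..<p ^ (a + \<mu>)}" using pp by auto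
  have c: "residue_part p (a + \<mu>) (?t ` A') (?r \<nu>) = ?t ` residue_part p \<mu> A' \<nu>" if "\<nu> \<in> {0..<p ^ \<mu>}" for \<nu>
    using that key[of _ \<nu>] by (auto simp: residue_part_def)
  have "(\<Sum>\<nu>\<in>{0..<p ^ \<mu>}. \<Phi> (?t ` residue_part p \<mu> A' \<nu>))
      = (\<Sum>\<theta>\<in>?r ` {0..<p ^ \<mu>}. \<Phi> (residue_part p (a + \<mu>) (?t ` A') \<theta>))"
    by (simp add: sum.reindex[OF inj] c)
  also have "\<dots> \<le> (\<Sum>\<theta>\<in>{0..<p ^ (a + \<mu>)}. \<Phi> (residue_part p (a + \<mu>) (?t ` A') \<theta>))"
    using im \<Phi> by (intro sum_mono2) auto
  finally show ?thesis .
qed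

text \<open>The polynomials \<open>H h\<close> embed a lower degree phase into the full torus after the affine
  substitution \<open>n = \<xi> + p ^ a * u\<close>; averaging over these translates makes the lower degree
  decoupling inequality available pointwise.\<close>

lemma decoupled_along_translates:
  fixes p \<xi> :: int
  assumes p: "p > 1" and D: "decoupled p l \<mu> C" and C: "C \<ge> 0" and l: "l \<ge> 1"
    and c'': "c'' \<ge> l * \<mu>" "c'' \<le> c"
    and A: "finite A" "\<And>n. n \<in> A \<Longrightarrow> p ^ a dvd n - \<xi>"
    and degH: "\<And>h. h \<in> coeff_box l (p ^ c'') \<Longrightarrow> degree (H h) \<le> k"
    and H: "\<And>h. h \<in> coeff_box l (p ^ c'') \<Longrightarrow> \<exists>\<kappa>. \<forall>u.
        p ^ c dvd poly (H h) (\<xi> + p ^ a * u) - \<kappa> - p ^ (c - c'') * coeff_eval l h u"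
    and w0: "\<And>g. w g \<ge> 0"
    and w: "\<And>g h. g \<in> coeff_box k (p ^ c) \<Longrightarrow> h \<in> coeff_box l (p ^ c'') \<Longrightarrow> w (shift_coeffs k (p ^ c) (H h) g) = w g"
  shows "avg (coeff_box k (p ^ c)) (\<lambda>g. w g * norm (exp_sum k (p ^ c) b A g) ^ (2 * critical l))
    \<le> C * (\<Sum>\<theta>\<in>{0..<p ^ (a + \<mu>)}. avg (coeff_box k (p ^ c)) (\<lambda>g. w g *
          norm (exp_sum k (p ^ c) b (residue_part p (a + \<mu>) A \<theta>) g) ^ (2 * critical l)) powr (1 / real (critical l))) ^ critical l"
proof (rule subaverage[where Y = "coeff_box l (p ^ c'')" and H = H])
  let ?Q = "p ^ c" and ?Q' = "p ^ c''"
  let ?t = "\<lambda>u. \<xi> + p ^ a * u"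
  have Q: "?Q > 0" "?Q' > 0" using p by auto
  then show "?Q > 0" "finite (coeff_box l ?Q')" "coeff_box l ?Q' \<noteq> {}" by auto
  show "critical l \<ge> 1" by (rule critical_pos[OF l])
  define A' where "A' = (\<lambda>n. (n - \<xi>) div p ^ a) ` A"
  have A': "finite A'" "A = ?t ` A'"
    using A unfolding A'_def by (force simp: image_image intro!: image_cong[of A A id, simplified])+
  have inj: "inj_on ?t B" for B using p by (auto simp: inj_on_def)
  fix g assume g: "g \<in> coeff_box k ?Q"
  \<comment> \<open>With \<open>g\<close> frozen, its phase is absorbed into the weights. Decoupling
    allows arbitrary weights, so only the variable \<open>h\<close> of the lower degree torus
    matters.\<close>
  define a' where "a' u = b (?t u) * unit_exp (real_of_int (coeff_eval k g (?t u)) / real_of_int ?Q)" for u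
  have nrm: "norm (exp_sum k ?Q b (?t ` B) (shift_coeffs k ?Q (H h) g)) = norm (exp_sum l ?Q' a' B h)"
    if h: "h \<in> coeff_box l ?Q'" for h B
  proof -
    from H[OF h] obtain \<kappa> where \<kappa>: "\<And>u. ?Q dvd poly (H h) (?t u) - \<kappa> - p ^ (c - c'') * coeff_eval l h u" by blast
    \<comment> \<open>Dividing \<open>p ^ (c - c'')\<close> by \<open>p ^ c\<close> leaves the
      modulus \<open>p ^ c''\<close>, and \<open>\<kappa>\<close> yields a constant of modulus
      1.\<close>
    have e: "unit_exp (real_of_int (poly (H h) (?t u)) / real_of_int ?Q)
        = unit_exp (real_of_int \<kappa> / real_of_int ?Q) * unit_exp (real_of_int (coeff_eval l h u) / real_of_int ?Q')" for u
    proof -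
      have "poly (H h) (?t u) mod ?Q = (\<kappa> + p ^ (c - c'') * coeff_eval l h u) mod ?Q"
        using \<kappa>[of u] by (simp add: mod_eq_dvd_iff algebra_simps)
      note unit_exp_cong_mod[OF Q(1) this]
      moreover have "real_of_int ?Q = real_of_int ?Q' * real_of_int (p ^ (c - c''))"
        using c'' by (simp flip: power_add of_int_mult)
      then have "real_of_int (\<kappa> + p ^ (c - c'') * coeff_eval l h u) / real_of_int ?Q
          = real_of_int \<kappa> / real_of_int ?Q + real_of_int (coeff_eval l h u) / real_of_int ?Q'"
        using p by (simp add: add_divide_distrib)
      ultimately show ?thesis by (simp add: unit_exp_add)
    qed
    have "exp_sum k ?Q b (?t ` B) (shift_coeffs k ?Q (H h) g)
        = unit_exp (real_of_int \<kappa> / real_of_int ?Q) * exp_sum l ?Q' a' B h"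
      unfolding exp_sum_shift[OF Q(1) degH[OF h]] unfolding exp_sum_def sum.reindex[OF inj] o_def a'_def e
      by (simp add: sum_distrib_left mult_ac)
    then show ?thesis by (simp add: norm_mult)
  qed
  have av: "avg (coeff_box l ?Q') (\<lambda>h. norm (exp_sum k ?Q b (?t ` B) (shift_coeffs k ?Q (H h) g)) ^ (2 * critical l))
      = moment l ?Q' (critical l) a' B" for B
    unfolding moment_def by (intro avg_cong refl) (simp add: nrm)
  have "avg (coeff_box l ?Q') (\<lambda>h. norm (exp_sum k ?Q b A (shift_coeffs k ?Q (H h) g)) ^ (2 * critical l)) = moment l ?Q' (critical l) a' A'"
    unfolding A'(2) by (rule av)
  also have "\<dots> \<le> C * norm_sum_parts p \<mu> l ?Q' a' A' ^ critical l"
    using D c'' A'(1) by (simp add: decoupled_def)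
  also have "norm_sum_parts p \<mu> l ?Q' a' A'
      = (\<Sum>\<nu>\<in>{0..<p ^ \<mu>}. avg (coeff_box l ?Q') (\<lambda>h. norm (exp_sum k ?Q b (?t ` residue_part p \<mu> A' \<nu>) (shift_coeffs k ?Q (H h) g)) ^ (2 * critical l)) powr (1 / real (critical l)))"
    unfolding norm_sum_parts_def av ..
  also have "C * \<dots> ^ critical l \<le> C * (\<Sum>\<theta>\<in>{0..<p ^ (a + \<mu>)}. avg (coeff_box l ?Q') (\<lambda>h. norm (exp_sum k ?Q b (residue_part p (a + \<mu>) A \<theta>) (shift_coeffs k ?Q (H h) g)) ^ (2 * critical l)) powr (1 / real (critical l))) ^ critical l"
    unfolding A'(2) using p C
    by (intro mult_left_mono power_mono sum_nonneg
        norm_sum_parts_affine_le[where \<Phi> = "\<lambda>B. avg (coeff_box l ?Q') (\<lambda>h. norm (exp_sum k ?Q b B (shift_coeffs k ?Q (H h) g)) ^ (2 * critical l)) powr (1 / real (critical l))"]) auto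
  finally show "avg (coeff_box l ?Q') (\<lambda>h. norm (exp_sum k ?Q b A (shift_coeffs k ?Q (H h) g)) ^ (2 * critical l)) \<le> \<dots>" .
qed (use C w0 w in auto)

text \<open>The p-adic form of affine rescaling: a class modulo \<open>p ^ a\<close>, seen in the
  variable \<open>u = (n - \<xi>) / p ^ a\<close>, is again a full moment curve of degree
  \<open>k\<close>, and only \<open>m - a\<close> scales remain to be decoupled.\<close>

lemma decoupled_rescale:
  fixes p \<xi> :: int
  assumes p: "p > 1" and D: "decoupled p k (m - a) C" and C: "C \<ge> 0" and k: "k \<ge> 1" and am: "a \<le> m"
    and c: "c \<ge> k * m" and A: "finite A" "\<And>n. n \<in> A \<Longrightarrow> p ^ a dvd n - \<xi>"
  shows "moment k (p ^ c) (critical k) b A \<le> C * norm_sum_parts p m k (p ^ c) b A ^ critical k"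
proof -
  \<comment> \<open>The factor \<open>p ^ (a * (k - j))\<close> equalises the weights: every
    monomial in \<open>n - \<xi> = p ^ a * u\<close> acquires the same power
    \<open>p ^ (k * a)\<close>, so the modulus exponent drops from \<open>c\<close> to
    \<open>c - k * a\<close>.\<close>
  define H where "H h = (\<Sum>j\<le>k. smult (h j * p ^ (a * (k - j))) ([:-\<xi>, 1:] ^ j))" for h :: "nat \<Rightarrow> int"
  have kac: "k * a \<le> c" using c am mult_le_mono2[OF am, of k] by linarith
  have "avg (coeff_box k (p ^ c)) (\<lambda>g. 1 * norm (exp_sum k (p ^ c) b A g) ^ (2 * critical k))
    \<le> C * (\<Sum>\<theta>\<in>{0..<p ^ (a + (m - a))}. avg (coeff_box k (p ^ c)) (\<lambda>g. 1 *
          norm (exp_sum k (p ^ c) b (residue_part p (a + (m - a)) A \<theta>) g) ^ (2 * critical k)) powr (1 / real (critical k))) ^ critical k"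
  proof (rule decoupled_along_translates[where c'' = "c - k * a" and H = H and \<xi> = \<xi>])
    show "k * (m - a) \<le> c - k * a" using c by (simp add: diff_mult_distrib2)
    show "degree (H h) \<le> k" for h
      unfolding H_def
      by (intro degree_sum_le) (auto intro!: order.trans[OF degree_smult_le] order.trans[OF degree_power_le])
    show "\<exists>\<kappa>. \<forall>u. p ^ c dvd poly (H h) (\<xi> + p ^ a * u) - \<kappa> - p ^ (c - (c - k * a)) * coeff_eval k h u" for h
    proof (intro exI[of _ 0] allI)
      fix u
      have "poly (H h) (\<xi> + p ^ a * u) = (\<Sum>j\<le>k. h j * p ^ (a * (k - j)) * (p ^ a * u) ^ j)"
        by (simp add: H_def poly_sum poly_power)
      also have "\<dots> = (\<Sum>j\<le>k. p ^ (k * a) * (h j * u ^ j))"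
      proof (intro sum.cong refl)
        fix j assume "j \<in> {..k}"
        then have "a * (k - j) + a * j = k * a" by (simp flip: add_mult_distrib2)
        then have "p ^ (a * (k - j)) * p ^ (a * j) = p ^ (k * a)" by (metis power_add)
        then show "h j * p ^ (a * (k - j)) * (p ^ a * u) ^ j = p ^ (k * a) * (h j * u ^ j)"
          by (simp add: power_mult_distrib power_mult mult_ac)
      qed
      also have "\<dots> = p ^ (c - (c - k * a)) * coeff_eval k h u"
        using kac by (simp add: coeff_eval_def sum_distrib_left)
      finally show "p ^ c dvd poly (H h) (\<xi> + p ^ a * u) - 0 - p ^ (c - (c - k * a)) * coeff_eval k h u"
        by simp
    qed
  qed (use assms in auto)
  then show ?thesis using am by (simp add: moment_def norm_sum_parts_def)
qed

section \<open>Hermite interpolation modulo prime powers\<close>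

lemma pderiv_sum_poly: "pderiv (\<Sum>i\<in>I. f i) = (\<Sum>i\<in>I. pderiv (f i))"
  by (induction I rule: infinite_finite_induct) (simp_all add: pderiv_add)

lemma smult_sum_poly: "smult c (\<Sum>i\<in>I. f i) = (\<Sum>i\<in>I. smult c (f i))"
  by (induction I rule: infinite_finite_induct) (simp_all add: smult_add_right)

lemma pcompose_power_poly: "pcompose (P ^ n) Q = pcompose P Q ^ n" for P :: "'a::comm_semiring_1 poly"
  by (induction n) (simp_all add: pcompose_mult pcompose_1)

text \<open>The factorial clears the denominators of the antiderivative.\<close>

lemma pderiv_preimage:
  fixes W :: "int poly"
  shows "\<exists>B. degree B \<le> e + Suc (degree W) \<and> [:0, 1:] ^ (e + 1) dvd B \<and>
    pderiv B = smult (fact (e + Suc (degree W))) ([:0, 1:] ^ e * W)"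
proof -
  let ?N = "e + Suc (degree W)"
  have dv: "(int (e + i + 1)) dvd fact ?N" if "i \<le> degree W" for i
    using that dvd_fact[of "e + i + 1" ?N] by (metis Suc_leI add.commute add_le_cancel_left add_Suc_right le_imp_less_Suc less_eq_Suc_le of_nat_dvd_iff of_nat_fact plus_1_eq_Suc zero_less_Suc)
  define q where "q i = (fact ?N :: int) div int (e + i + 1)" for i
  have q: "q i * int (e + i + 1) = fact ?N" if "i \<le> degree W" for i
    using dv[OF that] by (simp add: q_def)
  define B where "B = (\<Sum>i\<le>degree W. monom (q i * coeff W i) (e + i + 1))"
  have "degree B \<le> ?N" unfolding B_def
    by (intro degree_sum_le) (auto intro: order.trans[OF degree_monom_le])
  moreover have "[:0, 1:] ^ (e + 1) dvd B" unfolding B_def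
    by (intro dvd_sum) (metis (no_types, lifting) add.commute add.left_commute dvd_def monom_altdef mult_smult_right power_add)
  moreover have "pderiv B = smult (fact ?N) ([:0, 1:] ^ e * W)"
  proof -
    have "pderiv B = (\<Sum>i\<le>degree W. monom (int (e + i + 1) * (q i * coeff W i)) (e + i))"
      by (simp add: B_def pderiv_sum_poly pderiv_monom)
    also have "\<dots> = (\<Sum>i\<le>degree W. smult (fact ?N) ([:0, 1:] ^ e * monom (coeff W i) i))"
    proof (intro sum.cong refl)
      fix i assume "i \<in> {..degree W}"
      then have "int (e + i + 1) * (q i * coeff W i) = fact ?N * coeff W i"
        using q[of i] by (metis atMost_iff mult.assoc mult.commute)
      then show "monom (int (e + i + 1) * (q i * coeff W i)) (e + i)
          = smult (fact ?N) ([:0, 1:] ^ e * monom (coeff W i) i)"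
        by (simp add: smult_monom mult_monom flip: monom_altdef[of 1, simplified])
    qed
    also have "\<dots> = smult (fact ?N) ([:0, 1:] ^ e * (\<Sum>i\<le>degree W. monom (coeff W i) i))"
      by (simp add: sum_distrib_left smult_sum_poly)
    finally show ?thesis by (simp add: poly_as_sum_of_monoms)
  qed
  ultimately show ?thesis by blast
qed

text \<open>A scaled antiderivative of \<open>x ^ (k - l) * (x - \<delta>) ^ n\<close> vanishes to
  order \<open>k - l + 1\<close> at 0, and its expansion at \<open>\<delta>\<close> has no terms of
  degree 1 to \<open>n\<close>. The next coefficient times \<open>n + 1\<close> is
  \<open>fact (k - l + n + 1) * \<delta> ^ (k - l)\<close>, which is prime to \<open>p\<close> since
  \<open>k - l + n + 1 <= k < p\<close>.\<close>

lemma hermite_basis: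
  fixes \<delta> p :: int
  assumes p: "prime p" and k: "int k < p" and l: "n < l" "l \<le> k" and \<delta>: "\<not> p dvd \<delta>"
  shows "\<exists>B. degree B \<le> k \<and> [:0, 1:] ^ (k - l + 1) dvd B \<and>
    (\<forall>i. 1 \<le> i \<longrightarrow> i \<le> n \<longrightarrow> coeff (pcompose B [:\<delta>, 1:]) i = 0) \<and>
    \<not> p dvd coeff (pcompose B [:\<delta>, 1:]) (Suc n)"
proof -
  let ?e = "k - l" and ?W = "[:-\<delta>, 1:] ^ n"
  have dW: "degree ?W = n" by (simp add: degree_power_eq)
  obtain B where B: "degree B \<le> ?e + Suc n" "[:0, 1:] ^ (?e + 1) dvd B"
    "pderiv B = smult (fact (?e + Suc n)) ([:0, 1:] ^ ?e * ?W)"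
    using pderiv_preimage[of ?e ?W] dW by auto
  let ?T = "pcompose B [:\<delta>, 1:]"
  have "pderiv ?T = smult (fact (?e + Suc n)) ([:\<delta>, 1:] ^ ?e * [:0, 1:] ^ n)"
    using B(3) by (simp add: pderiv_pcompose pcompose_smult pcompose_mult pcompose_power_poly pderiv_pCons pcompose_pCons)
  then have "coeff (pderiv ?T) i = coeff (smult (fact (?e + Suc n)) ([:0, 1:] ^ n * [:\<delta>, 1:] ^ ?e)) i" for i
    by (simp only: mult.commute)
  then have co: "int (Suc i) * coeff ?T (Suc i) = fact (?e + Suc n) * coeff ([:0, 1:] ^ n * [:\<delta>, 1:] ^ ?e) i" for i
    by (simp only: coeff_pderiv coeff_smult of_nat_id)
  have X: "[:0, 1:] ^ n * P = monom 1 n * P" for P :: "int poly"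
    by (simp add: monom_altdef)
  have z: "coeff ?T i = 0" if "1 \<le> i" "i \<le> n" for i
  proof -
    have "i - 1 < n" "Suc (i - 1) = i" using that by auto
    then show ?thesis using co[of "i - 1"] that unfolding X coeff_monom_mult by simp
  qed
  have "\<not> p dvd coeff ?T (Suc n)"
  proof
    assume "p dvd coeff ?T (Suc n)"
    then have "p dvd fact (?e + Suc n) * \<delta> ^ ?e"
      using co[of n] dvd_mult[of p "coeff ?T (Suc n)" "int (Suc n)"]
      by (simp only: X coeff_monom_mult coeff_0_power less_irrefl if_False diff_self_eq_0 coeff_pCons_0 mult_1)
    then have "p dvd fact (?e + Suc n)"
      using p \<delta> prime_dvd_mult_iff prime_dvd_power by blast
    then have "nat p dvd fact (?e + Suc n)"
      using p by (metis int_dvd_int_iff int_nat_eq of_nat_fact prime_ge_0_int)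
    then have "nat p \<le> ?e + Suc n"
      using p prime_dvd_fact_iff by (metis prime_nat_iff_prime)
    then show False using k l p by linarith
  qed
  moreover have "degree B \<le> k" using B(1) l by linarith
  ultimately show ?thesis using B(2) z by auto
qed

text \<open>The basis polynomials form a triangular system whose diagonal entries are units modulo
  \<open>p ^ N\<close>, so the prescribed Taylor coefficients are reached one degree at a time. The
  constant term at \<open>\<delta>\<close> is left free; it contributes only a constant
  phase.\<close>

lemma hermite_interpolation:
  fixes \<delta> p :: int
  assumes p: "prime p" and k: "int k < p" and l: "l \<le> k" and \<delta>: "\<not> p dvd \<delta>"
  shows "n \<le> l \<Longrightarrow> \<exists>H. degree H \<le> k \<and> [:0, 1:] ^ (k - l + 1) dvd H \<and>
    (\<forall>i. 1 \<le> i \<longrightarrow> i \<le> n \<longrightarrow> p ^ N dvd coeff (pcompose H [:\<delta>, 1:]) i - G i)"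
proof (induction n)
  case 0
  then show ?case by (intro exI[of _ 0]) auto
next
  case (Suc n)
  then obtain H where H: "degree H \<le> k" "[:0, 1:] ^ (k - l + 1) dvd H"
    "\<And>i. 1 \<le> i \<Longrightarrow> i \<le> n \<Longrightarrow> p ^ N dvd coeff (pcompose H [:\<delta>, 1:]) i - G i" by auto
  obtain B where B: "degree B \<le> k" "[:0, 1:] ^ (k - l + 1) dvd B"
    "\<And>i. 1 \<le> i \<Longrightarrow> i \<le> n \<Longrightarrow> coeff (pcompose B [:\<delta>, 1:]) i = 0"
    "\<not> p dvd coeff (pcompose B [:\<delta>, 1:]) (Suc n)"
    using hermite_basis[OF p k _ l \<delta>, of n] Suc.prems by (metis Suc_le_eq)
  let ?u = "coeff (pcompose B [:\<delta>, 1:]) (Suc n)"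
  \<comment> \<open>Bezout gives an inverse \<open>v\<close> of the diagonal entry modulo
    \<open>p ^ N\<close>; the correction by \<open>?x\<close> repairs degree \<open>Suc n\<close>
    and leaves the lower degrees as they are.\<close>
  have "coprime ?u (p ^ N)"
    using B(4) p by (metis coprime_commute coprime_power_right_iff prime_imp_coprime)
  then obtain v w where "v * ?u + w * p ^ N = 1"
    using bezout_int[of ?u "p ^ N"] by auto
  then have "?u * v - 1 = p ^ N * (- w)" by (simp add: algebra_simps)
  then have v: "p ^ N dvd ?u * v - 1" by (rule dvdI)
  let ?x = "(G (Suc n) - coeff (pcompose H [:\<delta>, 1:]) (Suc n)) * v"
  show ?case
  proof (intro exI[of _ "H + smult ?x B"] conjI allI impI)
    show "degree (H + smult ?x B) \<le> k"
      using H B by (intro degree_add_le) (auto intro: order.trans[OF degree_smult_le])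
    show "[:0, 1:] ^ (k - l + 1) dvd H + smult ?x B"
      using H B by (intro dvd_add dvd_smult) auto
    fix i assume i: "1 \<le> i" "i \<le> Suc n"
    show "p ^ N dvd coeff (pcompose (H + smult ?x B) [:\<delta>, 1:]) i - G i"
    proof (cases "i = Suc n")
      case False
      then show ?thesis using i H(3)[of i] B(3)[of i] by (simp add: pcompose_add pcompose_smult)
    next
      case True
      have "p ^ N dvd (G (Suc n) - coeff (pcompose H [:\<delta>, 1:]) (Suc n)) * (?u * v - 1)"
        using v by (rule dvd_mult)
      then show ?thesis using True by (simp add: pcompose_add pcompose_smult algebra_simps)
    qed
  qed
qed

section \<open>Bilinear decoupling constants\<close>

text \<open>On the right both factors use norms at the critical exponent of degree \<open>k\<close>,
  whatever \<open>s1\<close> and \<open>s2\<close> are. Constants for different exponent pairs can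
  therefore be interpolated directly.\<close>

definition bil_decoupled :: "int \<Rightarrow> nat \<Rightarrow> nat \<Rightarrow> nat \<Rightarrow> nat \<Rightarrow> nat \<Rightarrow> nat \<Rightarrow> real \<Rightarrow> bool" where
  "bil_decoupled p k s1 s2 a b m C \<longleftrightarrow> (\<forall>c f A1 A2. c \<ge> k * m \<longrightarrow> finite A1 \<longrightarrow> finite A2 \<longrightarrow>
     (\<exists>\<xi>. \<forall>n\<in>A1. p ^ a dvd n - \<xi>) \<longrightarrow> (\<exists>\<eta>. \<forall>n\<in>A2. p ^ b dvd n - \<eta>) \<longrightarrow>
     (\<forall>n1\<in>A1. \<forall>n2\<in>A2. \<not> p dvd n1 - n2) \<longrightarrow>
     avg (coeff_box k (p ^ c)) (\<lambda>g. norm (exp_sum k (p ^ c) f A1 g) ^ (2 * s1) * norm (exp_sum k (p ^ c) f A2 g) ^ (2 * s2))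
       \<le> C * norm_sum_parts p m k (p ^ c) f A1 ^ s1 * norm_sum_parts p m k (p ^ c) f A2 ^ s2)"

lemma bil_decoupledI:
  assumes "\<And>c f A1 A2 \<xi> \<eta>. \<lbrakk>c \<ge> k * m; finite A1; finite A2; \<And>n. n \<in> A1 \<Longrightarrow> p ^ a dvd n - \<xi>;
    \<And>n. n \<in> A2 \<Longrightarrow> p ^ b dvd n - \<eta>; \<And>n1 n2. n1 \<in> A1 \<Longrightarrow> n2 \<in> A2 \<Longrightarrow> \<not> p dvd n1 - n2\<rbrakk> \<Longrightarrow>
     avg (coeff_box k (p ^ c)) (\<lambda>g. norm (exp_sum k (p ^ c) f A1 g) ^ (2 * s1) * norm (exp_sum k (p ^ c) f A2 g) ^ (2 * s2))
       \<le> C * norm_sum_parts p m k (p ^ c) f A1 ^ s1 * norm_sum_parts p m k (p ^ c) f A2 ^ s2"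
  shows "bil_decoupled p k s1 s2 a b m C"
  unfolding bil_decoupled_def by (intro allI impI, elim exE, rule assms) auto

lemma bil_decoupledD:
  assumes "bil_decoupled p k s1 s2 a b m C" "c \<ge> k * m" "finite A1" "finite A2" "\<And>n. n \<in> A1 \<Longrightarrow> p ^ a dvd n - \<xi>"
    "\<And>n. n \<in> A2 \<Longrightarrow> p ^ b dvd n - \<eta>" "\<And>n1 n2. n1 \<in> A1 \<Longrightarrow> n2 \<in> A2 \<Longrightarrow> \<not> p dvd n1 - n2"
  shows "avg (coeff_box k (p ^ c)) (\<lambda>g. norm (exp_sum k (p ^ c) f A1 g) ^ (2 * s1) * norm (exp_sum k (p ^ c) f A2 g) ^ (2 * s2))
       \<le> C * norm_sum_parts p m k (p ^ c) f A1 ^ s1 * norm_sum_parts p m k (p ^ c) f A2 ^ s2"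
proof -
  have "\<exists>\<xi>. \<forall>n\<in>A1. p ^ a dvd n - \<xi>" "\<exists>\<eta>. \<forall>n\<in>A2. p ^ b dvd n - \<eta>"
    "\<forall>n1\<in>A1. \<forall>n2\<in>A2. \<not> p dvd n1 - n2"
    using assms by auto
  then show ?thesis using assms(1-4) by (simp only: bil_decoupled_def)
qed

lemma bil_decoupled_mono:
  assumes "bil_decoupled p k s1 s2 a b m C" "C \<le> C'" shows "bil_decoupled p k s1 s2 a b m C'"
proof (rule bil_decoupledI, goal_cases)
  case (1 c f A1 A2 \<xi> \<eta>)
  note bil_decoupledD[OF assms(1) 1]
  also have "C * norm_sum_parts p m k (p ^ c) f A1 ^ s1 * norm_sum_parts p m k (p ^ c) f A2 ^ s2
      \<le> C' * norm_sum_parts p m k (p ^ c) f A1 ^ s1 * norm_sum_parts p m k (p ^ c) f A2 ^ s2"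
    using assms(2) by (intro mult_right_mono) (simp_all add: norm_sum_parts_nonneg)
  finally show ?case .
qed

lemma decoupled_mono: "decoupled p k m C \<Longrightarrow> C \<le> C' \<Longrightarrow> decoupled p k m C'"
  unfolding decoupled_def by (meson norm_sum_parts_nonneg mult_right_mono order_trans zero_le_power)

lemma bil_decoupled_sym:
  assumes "bil_decoupled p k s1 s2 a b m C" shows "bil_decoupled p k s2 s1 b a m C"
proof (rule bil_decoupledI, goal_cases)
  case (1 c f A1 A2 \<xi> \<eta>)
  have "\<not> p dvd n1 - n2" if "n1 \<in> A2" "n2 \<in> A1" for n1 n2
    using 1(6)[OF that(2,1)] by (metis dvd_minus_iff minus_diff_eq)
  note bil_decoupledD[OF assms 1(1,3,2) 1(5,4) this]
  then show ?case by (simp add: mult_ac)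
qed

text \<open>After the first set has been cut into classes modulo \<open>p ^ a'\<close>, the bilinear
  inequality is applied to each class. The \<open>1 / s1\<close>-th power makes the bounds linear in
  the norm sums, so they add up to that of the whole set.\<close>

lemma bil_decoupled_sum:
  assumes B: "bil_decoupled p k s1 s2 a' b m C" and C: "C \<ge> 0" "Cl \<ge> 0" and s1: "s1 \<ge> 1" and am: "a' \<le> m" and p: "p > 0" and k: "k \<ge> 1"
    and c: "c \<ge> k * m" "finite A1" "finite A2"
    and A2: "\<And>n. n \<in> A2 \<Longrightarrow> p ^ b dvd n - \<eta>" and sep: "\<And>n1 n2. n1 \<in> A1 \<Longrightarrow> n2 \<in> A2 \<Longrightarrow> \<not> p dvd n1 - n2"
    and le: "X \<le> Cl * (\<Sum>\<theta>\<in>{0..<p ^ a'}. avg (coeff_box k (p ^ c)) (\<lambda>g. norm (exp_sum k (p ^ c) f A2 g) ^ (2 * s2)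
          * norm (exp_sum k (p ^ c) f (residue_part p a' A1 \<theta>) g) ^ (2 * s1)) powr (1 / real s1)) ^ s1"
  shows "X \<le> Cl * C * norm_sum_parts p m k (p ^ c) f A1 ^ s1 * norm_sum_parts p m k (p ^ c) f A2 ^ s2"
proof -
  let ?N = "norm_sum_parts p m k (p ^ c) f"
  let ?D = "C * ?N A2 ^ s2"
  have D0: "?D \<ge> 0" using C by (simp add: norm_sum_parts_nonneg)
  have "avg (coeff_box k (p ^ c)) (\<lambda>g. norm (exp_sum k (p ^ c) f A2 g) ^ (2 * s2) * norm (exp_sum k (p ^ c) f (residue_part p a' A1 \<theta>) g) ^ (2 * s1)) powr (1 / real s1)
      \<le> ?D powr (1 / real s1) * ?N (residue_part p a' A1 \<theta>)" for \<theta>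
  proof -
    have d: "p ^ a' dvd n - \<theta>" if "n \<in> residue_part p a' A1 \<theta>" for n
      using that by (auto simp: residue_part_def mod_eq_dvd_iff)
    have "avg (coeff_box k (p ^ c)) (\<lambda>g. norm (exp_sum k (p ^ c) f (residue_part p a' A1 \<theta>) g) ^ (2 * s1) * norm (exp_sum k (p ^ c) f A2 g) ^ (2 * s2))
       \<le> C * ?N (residue_part p a' A1 \<theta>) ^ s1 * ?N A2 ^ s2"
      by (rule bil_decoupledD[OF B c(1) _ c(3) d A2]) (use c sep in \<open>auto simp: residue_part_def\<close>)
    then have "avg (coeff_box k (p ^ c)) (\<lambda>g. norm (exp_sum k (p ^ c) f A2 g) ^ (2 * s2) * norm (exp_sum k (p ^ c) f (residue_part p a' A1 \<theta>) g) ^ (2 * s1))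
       \<le> ?D * ?N (residue_part p a' A1 \<theta>) ^ s1"
      by (simp add: mult_ac)
    then have "avg (coeff_box k (p ^ c)) (\<lambda>g. norm (exp_sum k (p ^ c) f A2 g) ^ (2 * s2) * norm (exp_sum k (p ^ c) f (residue_part p a' A1 \<theta>) g) ^ (2 * s1)) powr (1 / real s1)
       \<le> (?D * ?N (residue_part p a' A1 \<theta>) ^ s1) powr (1 / real s1)"
      by (intro powr_mono2 avg_nonneg) auto
    also have "\<dots> = ?D powr (1 / real s1) * ?N (residue_part p a' A1 \<theta>)"
      using s1 by (simp only: powr_mult power_powr_inverse norm_sum_parts_nonneg)
    finally show ?thesis .
  qed
  then have "(\<Sum>\<theta>\<in>{0..<p ^ a'}. avg (coeff_box k (p ^ c)) (\<lambda>g. norm (exp_sum k (p ^ c) f A2 g) ^ (2 * s2)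
          * norm (exp_sum k (p ^ c) f (residue_part p a' A1 \<theta>) g) ^ (2 * s1)) powr (1 / real s1))
      \<le> (\<Sum>\<theta>\<in>{0..<p ^ a'}. ?D powr (1 / real s1) * ?N (residue_part p a' A1 \<theta>))"
    by (intro sum_mono)
  also have "\<dots> = ?D powr (1 / real s1) * ?N A1"
    using am p k by (simp add: norm_sum_parts_split flip: sum_distrib_left)
  finally have "X \<le> Cl * (?D powr (1 / real s1) * ?N A1) ^ s1"
    using C by (intro order.trans[OF le] mult_left_mono power_mono sum_nonneg) auto
  also have "\<dots> = Cl * (?D * ?N A1 ^ s1)"
    using D0 s1 by (simp only: power_mult_distrib powr_inverse_power)
  finally show ?thesis by (simp add: mult_ac)
qed

lemma exp_sum_norm_square_le:
  assumes "finite A" "p > 0"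
  shows "norm (exp_sum k Q f A g) ^ 2 \<le> (\<Sum>\<theta>\<in>{0..<p ^ a}. real_of_int p ^ a * norm (exp_sum k Q f (residue_part p a A \<theta>) g) ^ 2)"
proof -
  let ?u = "\<lambda>\<theta>. norm (exp_sum k Q f (residue_part p a A \<theta>) g)"
  have "norm (exp_sum k Q f A g) \<le> (\<Sum>\<theta>\<in>{0..<p ^ a}. ?u \<theta>)"
    unfolding exp_sum_partition[OF assms, of k Q f g a] by (rule norm_sum)
  then have "norm (exp_sum k Q f A g) ^ 2 \<le> (\<Sum>\<theta>\<in>{0..<p ^ a}. 1 * ?u \<theta>) ^ 2"
    by (intro power_mono) auto
  also have "\<dots> \<le> (\<Sum>\<theta>\<in>{0..<p ^ a}. 1\<^sup>2) * (\<Sum>\<theta>\<in>{0..<p ^ a}. ?u \<theta> ^ 2)"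
    by (rule Cauchy_Schwarz_ineq_sum)
  finally show ?thesis using assms by (simp add: sum_distrib_left)
qed

text \<open>Trivial decoupling: Cauchy-Schwarz over \<open>p ^ a\<close> classes loses
  \<open>p ^ a\<close> in the square of the sum, hence \<open>p ^ (a * s)\<close> in the moment;
  Minkowski does the rest.\<close>

lemma avg_square_minkowski:
  assumes A: "finite A" and p: "p > 0" and s: "s \<ge> 1" and w: "\<And>g. w g \<ge> 0"
  shows "avg (coeff_box k Q) (\<lambda>g. w g * norm (exp_sum k Q f A g) ^ (2 * s))
    \<le> real_of_int p ^ (a * s) * (\<Sum>\<theta>\<in>{0..<p ^ a}. avg (coeff_box k Q) (\<lambda>g. w g * norm (exp_sum k Q f (residue_part p a A \<theta>) g) ^ (2 * s)) powr (1 / real s)) ^ s"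
proof -
  let ?P = "real_of_int p ^ a"
  let ?u = "\<lambda>\<theta> g. ?P * norm (exp_sum k Q f (residue_part p a A \<theta>) g) ^ 2"
  have P: "?P > 0" using p by simp
  have "avg (coeff_box k Q) (\<lambda>g. w g * norm (exp_sum k Q f A g) ^ (2 * s))
    \<le> avg (coeff_box k Q) (\<lambda>g. w g * (\<Sum>\<theta>\<in>{0..<p ^ a}. ?u \<theta> g) ^ s)"
    unfolding power_mult using exp_sum_norm_square_le[OF A p]
    by (intro avg_mono mult_left_mono power_mono w) auto
  also have "\<dots> \<le> (\<Sum>\<theta>\<in>{0..<p ^ a}. avg (coeff_box k Q) (\<lambda>g. w g * ?u \<theta> g ^ s) powr (1 / real s)) ^ s"
    using w s P by (intro avg_minkowski) auto
  also have "(\<lambda>\<theta>. avg (coeff_box k Q) (\<lambda>g. w g * ?u \<theta> g ^ s) powr (1 / real s))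
    = (\<lambda>\<theta>. ?P * avg (coeff_box k Q) (\<lambda>g. w g * norm (exp_sum k Q f (residue_part p a A \<theta>) g) ^ (2 * s)) powr (1 / real s))"
  proof
    fix \<theta>
    have "avg (coeff_box k Q) (\<lambda>g. w g * ?u \<theta> g ^ s)
        = ?P ^ s * avg (coeff_box k Q) (\<lambda>g. w g * norm (exp_sum k Q f (residue_part p a A \<theta>) g) ^ (2 * s))"
      unfolding avg_cmult[symmetric] by (simp add: power_mult_distrib mult_ac flip: power_mult)
    then show "avg (coeff_box k Q) (\<lambda>g. w g * ?u \<theta> g ^ s) powr (1 / real s)
        = ?P * avg (coeff_box k Q) (\<lambda>g. w g * norm (exp_sum k Q f (residue_part p a A \<theta>) g) ^ (2 * s)) powr (1 / real s)"
      using P s by (simp only: powr_mult power_powr_inverse less_imp_le)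
  qed
  finally show ?thesis
    by (simp add: power_mult_distrib power_mult flip: sum_distrib_left)
qed

text \<open>This supplies the finite exponent \<open>critical k\<close> from which the bootstrap
  descends.\<close>

lemma decoupled_trivial:
  assumes "p > 1" "k \<ge> 1" shows "decoupled p k m (real_of_int p ^ (m * critical k))"
  unfolding decoupled_def norm_sum_parts_def moment_def
  using avg_square_minkowski[where w = "\<lambda>_. 1"] critical_pos assms by force

text \<open>A crude passage to fine classes, paid for by trivial decoupling. It is affordable once
  the savings exceed any fixed multiple of the scale.\<close>

lemma bil_decoupled_coarsen:
  assumes B: "bil_decoupled p k s1 s2 a' b m C" and C: "C \<ge> 0" and s1: "s1 \<ge> 1" and am: "a' \<le> m" and p: "p > 1" and k: "k \<ge> 1"
  shows "bil_decoupled p k s1 s2 a b m (real_of_int p ^ (a' * s1) * C)"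
proof (rule bil_decoupledI, goal_cases)
  case (1 c f A1 A2 \<xi> \<eta>)
  show ?case
  proof (rule bil_decoupled_sum[OF B C _ s1 am _ k 1(1-3) 1(5,6)])
    show "avg (coeff_box k (p ^ c)) (\<lambda>g. norm (exp_sum k (p ^ c) f A1 g) ^ (2 * s1) * norm (exp_sum k (p ^ c) f A2 g) ^ (2 * s2))
      \<le> real_of_int p ^ (a' * s1) * (\<Sum>\<theta>\<in>{0..<p ^ a'}. avg (coeff_box k (p ^ c)) (\<lambda>g. norm (exp_sum k (p ^ c) f A2 g) ^ (2 * s2) * norm (exp_sum k (p ^ c) f (residue_part p a' A1 \<theta>) g) ^ (2 * s1)) powr (1 / real s1)) ^ s1"
      using avg_square_minkowski[of A1 p s1 "\<lambda>g. norm (exp_sum k (p ^ c) f A2 g) ^ (2 * s2)" k "p ^ c" f a'] 1 p s1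
      by (simp add: mult.commute)
  qed (use p in auto)
qed

lemma power_holder_eq:
  fixes x :: real
  assumes "x \<ge> 0" "0 < \<theta>" "\<theta> < 1" "real s = \<theta> * real t + (1 - \<theta>) * real r"
  shows "(x ^ t) powr \<theta> * (x ^ r) powr (1 - \<theta>) = x ^ s"
proof (cases "x = 0")
  case False
  then have "(x ^ t) powr \<theta> * (x ^ r) powr (1 - \<theta>) = x powr real s"
    using assms(1) by (simp add: assms(4) powr_powr powr_add mult.commute flip: powr_realpow)
  then show ?thesis using False assms(1) by (simp add: powr_realpow)
next
  case True
  \<comment> \<open>At \<open>x = 0\<close> the convention \<open>x ^ 0 = 1\<close> matters: the
    right side is 1 exactly when both exponents on the left are 0.\<close>
  have "s = 0 \<longleftrightarrow> t = 0 \<and> r = 0"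
  proof
    assume "s = 0"
    then have "\<theta> * real t + (1 - \<theta>) * real r = 0" using assms(4) by simp
    moreover have "\<theta> * real t \<ge> 0" "(1 - \<theta>) * real r \<ge> 0" using assms by auto
    ultimately have "\<theta> * real t = 0" "(1 - \<theta>) * real r = 0" by linarith+
    then show "t = 0 \<and> r = 0" using assms by auto
  qed (use assms in auto)
  then show ?thesis using True by (auto simp: power_0_left)
qed

text \<open>Hoelder makes the bilinear constant log-convex in the exponent pair, because the same
  interpolation of powers holds for the sums on the left and the norm sums on the right.\<close>

lemma bil_decoupled_holder:
  assumes B1: "bil_decoupled p k t1 t2 a b m C1" and B2: "bil_decoupled p k r1 r2 a b m C2" and C: "C1 \<ge> 0" "C2 \<ge> 0"
    and th: "0 < \<theta>" "\<theta> < 1"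
    and s1: "real s1 = \<theta> * real t1 + (1 - \<theta>) * real r1" and s2: "real s2 = \<theta> * real t2 + (1 - \<theta>) * real r2"
  shows "bil_decoupled p k s1 s2 a b m (C1 powr \<theta> * C2 powr (1 - \<theta>))"
proof (rule bil_decoupledI, goal_cases)
  case (1 c f A1 A2 \<xi> \<eta>)
  let ?x = "\<lambda>g. norm (exp_sum k (p ^ c) f A1 g)" and ?y = "\<lambda>g. norm (exp_sum k (p ^ c) f A2 g)"
  let ?N = "norm_sum_parts p m k (p ^ c) f"
  have eq: "(x ^ t1 * y ^ t2) powr \<theta> * (x ^ r1 * y ^ r2) powr (1 - \<theta>) = x ^ s1 * y ^ s2"
    if "x \<ge> 0" "y \<ge> 0" for x y :: real
  proof -
    have "(x ^ t1 * y ^ t2) powr \<theta> * (x ^ r1 * y ^ r2) powr (1 - \<theta>)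
        = ((x ^ t1) powr \<theta> * (x ^ r1) powr (1 - \<theta>)) * ((y ^ t2) powr \<theta> * (y ^ r2) powr (1 - \<theta>))"
      by (simp only: powr_mult mult_ac)
    then show ?thesis
      by (simp only: power_holder_eq[OF that(1) th s1] power_holder_eq[OF that(2) th s2])
  qed
  have "avg (coeff_box k (p ^ c)) (\<lambda>g. ?x g ^ (2 * s1) * ?y g ^ (2 * s2))
      = avg (coeff_box k (p ^ c)) (\<lambda>g. (?x g ^ (2 * t1) * ?y g ^ (2 * t2)) powr \<theta> * (?x g ^ (2 * r1) * ?y g ^ (2 * r2)) powr (1 - \<theta>))"
    by (simp only: power_mult eq zero_le_power norm_ge_zero)
  also have "\<dots> \<le> avg (coeff_box k (p ^ c)) (\<lambda>g. ?x g ^ (2 * t1) * ?y g ^ (2 * t2)) powr \<theta>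
      * avg (coeff_box k (p ^ c)) (\<lambda>g. ?x g ^ (2 * r1) * ?y g ^ (2 * r2)) powr (1 - \<theta>)"
    using th by (intro avg_holder) auto
  also have "\<dots> \<le> (C1 * ?N A1 ^ t1 * ?N A2 ^ t2) powr \<theta> * (C2 * ?N A1 ^ r1 * ?N A2 ^ r2) powr (1 - \<theta>)"
    using th by (intro mult_mono powr_mono2 bil_decoupledD[OF B1 1] bil_decoupledD[OF B2 1]) (auto intro!: avg_nonneg)
  also have "\<dots> = (C1 powr \<theta> * C2 powr (1 - \<theta>)) * ((?N A1 ^ t1 * ?N A2 ^ t2) powr \<theta> * (?N A1 ^ r1 * ?N A2 ^ r2) powr (1 - \<theta>))"
    by (simp add: powr_mult mult_ac)
  also have "\<dots> = (C1 powr \<theta> * C2 powr (1 - \<theta>)) * (?N A1 ^ s1 * ?N A2 ^ s2)"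
    by (simp only: eq norm_sum_parts_nonneg)
  finally show ?case by (simp add: mult.assoc)
qed

text \<open>With exponent 0 on the first factor only the second class remains, and rescaling it
  removes \<open>b\<close> scales outright. This is the source of all the savings.\<close>

lemma bil_decoupled_zero:
  assumes "p > 1" "decoupled p k (m - b) C" "C \<ge> 0" "k \<ge> 1" "b \<le> m"
  shows "bil_decoupled p k 0 (critical k) a b m C"
proof (rule bil_decoupledI, goal_cases)
  case (1 c f A1 A2 \<xi> \<eta>)
  then show ?case using decoupled_rescale[OF assms 1(1) 1(3) 1(5), of f] by (simp add: moment_def)
qed

text \<open>Interpolation between the two endpoint pairs, where one factor is absent; both endpoints
  have the constant \<open>C\<close>.\<close>

lemma bil_decoupled_of_decoupled:
  assumes p: "p > 1" and D: "decoupled p k m C" and C: "C \<ge> 0" and k: "k \<ge> 1" and s: "s1 + s2 = critical k"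
  shows "bil_decoupled p k s1 s2 a b m C"
proof -
  have 0: "bil_decoupled p k 0 (critical k) a b m C" for a b
    using D unfolding bil_decoupled_def decoupled_def moment_def by simp
  note 1 = bil_decoupled_sym[OF 0]
  consider "s1 = 0" | "s2 = 0" | "s1 > 0" "s2 > 0" by blast
  then show ?thesis
  proof cases
    case 3
    have "bil_decoupled p k s1 s2 a b m (C powr (s1 / critical k) * C powr (1 - s1 / critical k))"
      by (rule bil_decoupled_holder[OF 1 0 C C]) (use 3 s in \<open>auto simp: field_simps simp flip: s\<close>)
    moreover have "C powr (s1 / critical k) * C powr (1 - s1 / critical k) = C"
      using C by (simp flip: powr_add)
    ultimately show ?thesis by simp
  qed (use 0 1 s in auto)
qed

section \<open>Transversality\<close>

text \<open>All phases involving the class of \<open>\<eta>\<close> modulo \<open>p ^ b\<close> are constant along the translates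
  used here, while the class of \<open>\<xi>\<close> sees a nondegenerate curve of degree \<open>l\<close>.  The condition
  \<open>l * a' \<le> (l + 1) * a\<close> makes all Taylor coefficients of degree above \<open>l\<close> invisible.\<close>

lemma transverse_translates:
  fixes p \<xi> \<eta> :: int
  assumes p: "prime p" and k: "int k < p" and l: "l \<le> k" and \<delta>: "\<not> p dvd \<xi> - \<eta>"
    and aa: "a \<le> a'" and la: "l * a' \<le> (l + 1) * a" and lb: "l * a' \<le> (k - l + 1) * b" and c: "l * a' \<le> c"
  shows "\<exists>H. degree H \<le> k \<and> (\<forall>n. p ^ b dvd n - \<eta> \<longrightarrow> p ^ c dvd poly H n) \<and>
     (\<exists>\<kappa>. \<forall>u. p ^ c dvd poly H (\<xi> + p ^ a * u) - \<kappa> - p ^ (c - l * (a' - a)) * coeff_eval l h u)"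
proof -
  \<comment> \<open>The polynomial will carry a factor \<open>p ^ (c - c')\<close>, so every
    congruence needs to hold only modulo \<open>p ^ c'\<close>.\<close>
  define c' where "c' = l * a'"
  \<comment> \<open>Prescribed so that the term of degree \<open>i\<close> in
    \<open>x = p ^ a * u\<close> equals \<open>p ^ (a * l) * h i * u ^ i\<close>.\<close>
  define G where "G i = p ^ (a * l - a * i) * h i" for i
  obtain T where T: "degree T \<le> k" "[:0, 1:] ^ (k - l + 1) dvd T"
    "\<And>i. 1 \<le> i \<Longrightarrow> i \<le> l \<Longrightarrow> p ^ c' dvd coeff (pcompose T [:\<xi> - \<eta>, 1:]) i - G i"
    using hermite_interpolation[OF p k l \<delta> order.refl, of c' G] by auto
  define H where "H = smult (p ^ (c - c')) (pcompose T [:-\<eta>, 1:])"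
  define S where "S = pcompose T [:\<xi> - \<eta>, 1:]"
  have dS: "degree S \<le> k" using T(1) by (simp add: S_def degree_pcompose)
  have cc: "c - c' + c' = c" using c by (simp add: c'_def)
  have polyH: "poly H n = p ^ (c - c') * poly T (n - \<eta>)" for n
    by (simp add: H_def poly_pcompose)
  show ?thesis
  proof (intro exI[of _ H] conjI allI impI)
    show "degree H \<le> k" unfolding H_def
      by (rule order.trans[OF degree_smult_le]) (use T(1) in \<open>simp add: degree_pcompose\<close>)
    fix n assume n: "p ^ b dvd n - \<eta>"
    \<comment> \<open>On the class of \<open>\<eta>\<close> the zero of order
      \<open>k - l + 1\<close> gives \<open>b * (k - l + 1)\<close> factors \<open>p\<close>, enough
      by the assumption \<open>lb\<close>.\<close>
    have "p ^ c' dvd p ^ (b * (k - l + 1))" by (rule le_imp_power_dvd) (use lb in \<open>simp add: c'_def mult.commute\<close>)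
    also have "\<dots> dvd (n - \<eta>) ^ (k - l + 1)" unfolding power_mult by (rule dvd_power_same) (rule n)
    also have "\<dots> dvd poly T (n - \<eta>)"
    proof -
      obtain R where "T = [:0, 1:] ^ (k - l + 1) * R" using T(2) by (elim dvdE)
      then have "poly T (n - \<eta>) = (n - \<eta>) ^ (k - l + 1) * poly R (n - \<eta>)"
        by (simp add: poly_power)
      then show ?thesis by simp
    qed
    finally have "p ^ (c - c') * p ^ c' dvd poly H n" unfolding polyH by (rule mult_dvd_mono[OF dvd_refl])
    then show "p ^ c dvd poly H n" by (simp only: cc flip: power_add)
  next
    \<comment> \<open>The discrepancy of the constant terms, the one Taylor coefficient that
      interpolation does not prescribe.\<close>
    let ?\<kappa> = "p ^ (c - c') * (coeff S 0 - p ^ (a * l) * h 0)"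
    show "\<exists>\<kappa>. \<forall>u. p ^ c dvd poly H (\<xi> + p ^ a * u) - \<kappa> - p ^ (c - l * (a' - a)) * coeff_eval l h u"
    proof (intro exI[of _ ?\<kappa>] allI)
      fix u
      define x where "x = p ^ a * u"
      have e1: "p ^ (c - l * (a' - a)) = p ^ (c - c') * p ^ (a * l)"
      proof -
        have "l * a \<le> l * a'" using aa by simp
        then have "c - l * (a' - a) = (c - c') + a * l"
          using c by (simp add: c'_def diff_mult_distrib2 mult.commute)
        then show ?thesis by (simp add: power_add)
      qed
      have "poly T (\<xi> + p ^ a * u - \<eta>) = poly S x"
        by (simp add: S_def poly_pcompose x_def algebra_simps)
      also have "\<dots> = (\<Sum>i\<le>k. coeff S i * x ^ i)" by (rule poly_eq_sum_le[OF dS])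
      finally have e2: "poly H (\<xi> + p ^ a * u) = p ^ (c - c') * (\<Sum>i\<le>k. coeff S i * x ^ i)" by (simp add: polyH)
      have e3: "p ^ (a * l) * coeff_eval l h u = (\<Sum>i\<le>k. if i \<le> l then p ^ (a * l) * (h i * u ^ i) else 0)"
        using l by (simp add: coeff_eval_def sum_distrib_left sum.If_cases Int_def flip: sum.inter_filter)
          (intro sum.cong, auto)
      have e4: "coeff S 0 - p ^ (a * l) * h 0 = (\<Sum>i\<le>k. if i = 0 then coeff S 0 - p ^ (a * l) * h 0 else 0)" by simp
      have e5: "(\<Sum>i\<le>k. coeff S i * x ^ i) - (coeff S 0 - p ^ (a * l) * h 0) - p ^ (a * l) * coeff_eval l h u
         = (\<Sum>i\<le>k. coeff S i * x ^ i - (if i = 0 then coeff S 0 - p ^ (a * l) * h 0 else 0)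
                 - (if i \<le> l then p ^ (a * l) * (h i * u ^ i) else 0))"
        unfolding e3 by (subst e4) (simp only: sum_subtractf)
      have "p ^ c' dvd coeff S i * x ^ i - (if i = 0 then coeff S 0 - p ^ (a * l) * h 0 else 0)
                 - (if i \<le> l then p ^ (a * l) * (h i * u ^ i) else 0)" for i
      proof -
        consider "i = 0" | "1 \<le> i" "i \<le> l" | "i \<ge> l + 1" by linarith
        then show ?thesis
        proof cases
          case 2
          have "a * i \<le> a * l" using 2 by simp
          then have "p ^ (a * l) = p ^ (a * l - a * i) * p ^ (a * i)"
            by (simp flip: power_add)
          then have "coeff S i * x ^ i - p ^ (a * l) * (h i * u ^ i) = (coeff S i - G i) * x ^ i"
            by (simp add: G_def x_def power_mult_distrib power_mult algebra_simps)
          then show ?thesis using 2 T(3)[of i] by (simp add: S_def)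
        next
          case 3
          have "(l + 1) * a \<le> i * a" using 3 by (rule mult_le_mono1)
          then have "c' \<le> a * i" using la by (simp add: c'_def mult.commute)
          then have "p ^ c' dvd p ^ (a * i)" by (rule le_imp_power_dvd)
          then have "p ^ c' dvd x ^ i" by (simp add: x_def power_mult_distrib power_mult)
          then show ?thesis using 3 by simp
        qed simp
      qed
      then have "p ^ c' dvd (\<Sum>i\<le>k. coeff S i * x ^ i) - (coeff S 0 - p ^ (a * l) * h 0) - p ^ (a * l) * coeff_eval l h u"
        unfolding e5 by (intro dvd_sum)
      then have "p ^ (c - c') * p ^ c' dvd p ^ (c - c') * ((\<Sum>i\<le>k. coeff S i * x ^ i) - (coeff S 0 - p ^ (a * l) * h 0) - p ^ (a * l) * coeff_eval l h u)"
        by (rule mult_dvd_mono[OF dvd_refl])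
      then have "p ^ c dvd p ^ (c - c') * ((\<Sum>i\<le>k. coeff S i * x ^ i) - (coeff S 0 - p ^ (a * l) * h 0) - p ^ (a * l) * coeff_eval l h u)"
        by (simp only: cc flip: power_add)
      then show "p ^ c dvd poly H (\<xi> + p ^ a * u) - ?\<kappa> - p ^ (c - l * (a' - a)) * coeff_eval l h u"
        by (simp only: e1 e2 right_diff_distrib mult.assoc)
    qed
  qed
qed

text \<open>The translates along the transverse polynomials fix the second sum exactly, so its power
  serves as the invariant weight. Decoupling of degree \<open>l\<close> then refines the first class
  from scale \<open>a\<close> to \<open>a'\<close> at the cost \<open>Cl\<close> for
  \<open>a' - a\<close> scales.\<close>

lemma bil_decoupled_step:
  fixes p :: int
  assumes p: "prime p" and k: "int k < p" and l: "1 \<le> l" "l \<le> k" and ab: "1 \<le> a" "1 \<le> b"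
    and aa: "a \<le> a'" "a' \<le> m" and la: "l * a' \<le> (l + 1) * a" and lb: "l * a' \<le> (k - l + 1) * b"
    and D: "decoupled p l (a' - a) Cl" "Cl \<ge> 0" and B: "bil_decoupled p k (critical l) s2 a' b m C" "C \<ge> 0"
  shows "bil_decoupled p k (critical l) s2 a b m (Cl * C)"
proof (rule bil_decoupledI, goal_cases)
  case (1 c f A1 A2 \<xi> \<eta>)
  have p1: "p > 1" using p by (simp add: prime_gt_1_int)
  have Q: "p ^ c > 0" using p1 by simp
  have pab: "p dvd p ^ a" "p dvd p ^ b" using ab by (auto simp: dvd_power)
  show ?case
  proof (cases "A1 = {}")
    case True
    then show ?thesis using B D critical_pos[OF l(1)] by (simp add: avg_def norm_sum_parts_nonneg power_0_left)
  next
    case False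
    then obtain n1 where n1: "n1 \<in> A1" by auto
    \<comment> \<open>If \<open>A2\<close> is empty the given centre may be congruent to
      \<open>\<xi>\<close>; \<open>\<xi> + 1\<close> then serves as a separated centre. Otherwise
      separation of actual elements passes to the centres because \<open>a\<close> and
      \<open>b\<close> are at least 1.\<close>
    obtain \<eta>' where \<eta>': "\<And>n. n \<in> A2 \<Longrightarrow> p ^ b dvd n - \<eta>'" "\<not> p dvd \<xi> - \<eta>'"
    proof (cases "A2 = {}")
      case True
      have "\<not> p dvd \<xi> - (\<xi> + 1)" using p1 by (simp add: zdvd_not_zless)
      then show ?thesis using True by (intro that[of "\<xi> + 1"]) auto
    next
      case False
      then obtain n2 where n2: "n2 \<in> A2" by auto
      have "p dvd n1 - \<xi>" "p dvd n2 - \<eta>"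
        using 1(4)[OF n1] 1(5)[OF n2] pab dvd_trans by blast+
      moreover have "\<not> p dvd n1 - n2" by (rule 1(6)[OF n1 n2])
      moreover have "n1 - n2 = (n1 - \<xi>) - (n2 - \<eta>) + (\<xi> - \<eta>)" by simp
      ultimately have "\<not> p dvd \<xi> - \<eta>" by (metis dvd_add dvd_diff)
      then show ?thesis using 1(5) by (intro that[of \<eta>])
    qed
    have lac: "l * a' \<le> c"
      using 1(1) mult_le_mono[OF l(2) aa(2)] by linarith
    have "\<exists>H. \<forall>h. degree (H h) \<le> k \<and> (\<forall>n. p ^ b dvd n - \<eta>' \<longrightarrow> p ^ c dvd poly (H h) n) \<and>
     (\<exists>\<kappa>. \<forall>u. p ^ c dvd poly (H h) (\<xi> + p ^ a * u) - \<kappa> - p ^ (c - l * (a' - a)) * coeff_eval l h u)"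
      by (intro choice allI transverse_translates p k l \<eta>' aa la lb lac)
    then obtain H where H: "\<And>h. degree (H h) \<le> k" "\<And>h n. p ^ b dvd n - \<eta>' \<Longrightarrow> p ^ c dvd poly (H h) n"
      "\<And>h. \<exists>\<kappa>. \<forall>u. p ^ c dvd poly (H h) (\<xi> + p ^ a * u) - \<kappa> - p ^ (c - l * (a' - a)) * coeff_eval l h u"
      by blast
    show ?thesis
    proof (rule bil_decoupled_sum[OF B D(2) critical_pos[OF l(1)] aa(2) _ _ 1(1-3) 1(5,6)])
      let ?w = "\<lambda>g. norm (exp_sum k (p ^ c) f A2 g) ^ (2 * s2)"
      have w: "?w (shift_coeffs k (p ^ c) (H h) g) = ?w g" for g h
      proof -
        have "unit_exp (real_of_int (poly (H h) n) / real_of_int (p ^ c)) = 1" if "n \<in> A2" for n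
          using unit_exp_cong_mod[OF Q, of "poly (H h) n" 0] H(2)[OF \<eta>'(1)[OF that], of h] by simp
        then show ?thesis unfolding exp_sum_shift[OF Q H(1)] unfolding exp_sum_def by simp
      qed
      have "avg (coeff_box k (p ^ c)) (\<lambda>g. ?w g * norm (exp_sum k (p ^ c) f A1 g) ^ (2 * critical l))
        \<le> Cl * (\<Sum>\<theta>\<in>{0..<p ^ (a + (a' - a))}. avg (coeff_box k (p ^ c)) (\<lambda>g. ?w g *
          norm (exp_sum k (p ^ c) f (residue_part p (a + (a' - a)) A1 \<theta>) g) ^ (2 * critical l)) powr (1 / real (critical l))) ^ critical l"
        by (rule decoupled_along_translates[OF p1 D l(1), where H = H and c'' = "l * (a' - a)" and \<xi> = \<xi>])
          (use lac 1 H w in \<open>auto simp: diff_mult_distrib2\<close>)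
      then show "avg (coeff_box k (p ^ c)) (\<lambda>g. norm (exp_sum k (p ^ c) f A1 g) ^ (2 * critical l) * norm (exp_sum k (p ^ c) f A2 g) ^ (2 * s2))
        \<le> Cl * (\<Sum>\<theta>\<in>{0..<p ^ a'}. avg (coeff_box k (p ^ c)) (\<lambda>g. ?w g *
          norm (exp_sum k (p ^ c) f (residue_part p a' A1 \<theta>) g) ^ (2 * critical l)) powr (1 / real (critical l))) ^ critical l"
        using aa by (simp add: mult.commute)
    qed (use p1 l in auto)
  qed
qed


section \<open>Degree one, and the passage from bilinear to linear decoupling\<close>

lemma exp_sum_orthogonal:
  assumes Q: "Q > 0" and H: "degree H \<le> k"
    and ne: "\<And>n n'. n \<in> A \<Longrightarrow> n' \<in> B \<Longrightarrow> \<not> Q dvd poly H n - poly H n'"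
  shows "(\<Sum>g\<in>coeff_box k Q. exp_sum k Q f A g * cnj (exp_sum k Q f B g)) = 0"
proof -
  let ?e = "\<lambda>x. unit_exp (real_of_int x / real_of_int Q)"
  have z: "(\<Sum>g\<in>coeff_box k Q. ?e (coeff_eval k g n - coeff_eval k g n')) = 0" if "n \<in> A" "n' \<in> B" for n n'
  proof -
    let ?S = "\<Sum>g\<in>coeff_box k Q. ?e (coeff_eval k g n - coeff_eval k g n')"
    have "?S = (\<Sum>g\<in>coeff_box k Q. ?e (coeff_eval k (shift_coeffs k Q H g) n - coeff_eval k (shift_coeffs k Q H g) n'))"
      by (rule sum.reindex_bij_betw[OF bij_shift_coeffs[OF Q], symmetric])
    also have "\<dots> = (\<Sum>g\<in>coeff_box k Q. ?e (poly H n - poly H n') * ?e (coeff_eval k g n - coeff_eval k g n'))"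
    proof (intro sum.cong refl)
      fix g
      have "(coeff_eval k (shift_coeffs k Q H g) n - coeff_eval k (shift_coeffs k Q H g) n') mod Q
          = ((coeff_eval k g n + poly H n) - (coeff_eval k g n' + poly H n')) mod Q"
        by (intro mod_diff_cong coeff_eval_shift Q H)
      then have "?e (coeff_eval k (shift_coeffs k Q H g) n - coeff_eval k (shift_coeffs k Q H g) n') = ?e ((coeff_eval k g n + poly H n) - (coeff_eval k g n' + poly H n'))"
        by (rule unit_exp_cong_mod[OF Q])
      also have "\<dots> = ?e (poly H n - poly H n') * ?e (coeff_eval k g n - coeff_eval k g n')"
        unfolding unit_exp_add[symmetric] add_divide_distrib[symmetric] of_int_add[symmetric] by (simp add: algebra_simps)
      finally show "?e (coeff_eval k (shift_coeffs k Q H g) n - coeff_eval k (shift_coeffs k Q H g) n') = \<dots>" .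
    qed
    \<comment> \<open>Translation by \<open>H\<close> reproduces the character sum with a factor
      different from 1, so the sum vanishes.\<close>
    finally have "?S = ?e (poly H n - poly H n') * ?S" unfolding sum_distrib_left[symmetric] .
    moreover have "?e (poly H n - poly H n') \<noteq> 1"
    proof
      assume "?e (poly H n - poly H n') = 1"
      then obtain z where "real_of_int (poly H n - poly H n') / real_of_int Q = real_of_int z"
        unfolding unit_exp_eq_1_iff by (auto elim: Ints_cases)
      then have "real_of_int (poly H n - poly H n') = real_of_int (Q * z)" using Q by (simp add: field_simps)
      then have "poly H n - poly H n' = Q * z" by (simp only: of_int_eq_iff)
      then show False using ne[OF that] by simp
    qed
    moreover have "S = e * S \<Longrightarrow> e \<noteq> 1 \<Longrightarrow> S = 0" for S e :: complex by simp
    ultimately show "?S = 0" by blast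
  qed
  have "(\<Sum>g\<in>coeff_box k Q. exp_sum k Q f A g * cnj (exp_sum k Q f B g))
      = (\<Sum>g\<in>coeff_box k Q. \<Sum>n\<in>A. \<Sum>n'\<in>B. f n * cnj (f n') * ?e (coeff_eval k g n - coeff_eval k g n'))"
    by (simp add: exp_sum_def sum_product diff_divide_distrib unit_exp_diff mult_ac)
  also have "\<dots> = (\<Sum>n\<in>A. \<Sum>n'\<in>B. f n * cnj (f n') * (\<Sum>g\<in>coeff_box k Q. ?e (coeff_eval k g n - coeff_eval k g n')))"
    by (subst sum.swap, intro sum.cong refl, subst sum.swap) (simp add: sum_distrib_left)
  also have "\<dots> = 0" using z by simp
  finally show ?thesis .
qed

text \<open>In degree 1 the critical moment is a second moment. Integers in distinct classes modulo
  \<open>p ^ m\<close> are distinct modulo \<open>p ^ c\<close>, so Parseval gives equality, with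
  constant 1 at every scale.\<close>

lemma decoupled_1:
  fixes p :: int
  assumes p: "p > 1" shows "decoupled p 1 m 1"
  unfolding decoupled_def
proof (intro allI impI)
  fix c f A assume c: "1 * m \<le> c" and A: "finite (A :: int set)"
  let ?Q = "p ^ c" and ?C = "coeff_box 1 (p ^ c)"
  let ?F = "\<lambda>\<theta> g. exp_sum 1 ?Q f (residue_part p m A \<theta>) g"
  have Q: "?Q > 0" using p by simp
  have s: "critical 1 = 1" by (simp add: critical_def)
  have sq: "complex_of_real (norm z ^ 2) = z * cnj z" for z by (rule complex_norm_square)
  have orth: "(\<Sum>g\<in>?C. ?F \<theta> g * cnj (?F \<theta>' g)) = 0" if "\<theta> \<noteq> \<theta>'" for \<theta> \<theta>'
  proof (rule exp_sum_orthogonal[OF Q, where H = "[:0, 1:]"])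
    fix n n' assume n: "n \<in> residue_part p m A \<theta>" "n' \<in> residue_part p m A \<theta>'"
    show "\<not> ?Q dvd poly [:0, 1:] n - poly [:0, 1:] n'"
    proof
      assume "?Q dvd poly [:0, 1:] n - poly [:0, 1:] n'"
      then have "p ^ m dvd n - n'" using c le_imp_power_dvd[of m c p] by (auto intro: dvd_trans)
      then have "n mod p ^ m = n' mod p ^ m" by (simp add: mod_eq_dvd_iff)
      then show False using n that by (simp add: residue_part_def)
    qed
  qed simp
  have "complex_of_real (\<Sum>g\<in>?C. norm (exp_sum 1 ?Q f A g) ^ 2)
      = (\<Sum>g\<in>?C. (\<Sum>\<theta>\<in>{0..<p ^ m}. ?F \<theta> g) * cnj (\<Sum>\<theta>\<in>{0..<p ^ m}. ?F \<theta> g))"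
    unfolding of_real_sum sq using exp_sum_partition[OF A, of p 1 ?Q f _ m] p by simp
  also have "\<dots> = (\<Sum>g\<in>?C. \<Sum>\<theta>\<in>{0..<p ^ m}. \<Sum>\<theta>'\<in>{0..<p ^ m}. ?F \<theta> g * cnj (?F \<theta>' g))"
    by (simp add: sum_product)
  also have "\<dots> = (\<Sum>\<theta>\<in>{0..<p ^ m}. \<Sum>\<theta>'\<in>{0..<p ^ m}. \<Sum>g\<in>?C. ?F \<theta> g * cnj (?F \<theta>' g))"
    by (subst sum.swap, intro sum.cong refl, rule sum.swap)
  also have "\<dots> = (\<Sum>\<theta>\<in>{0..<p ^ m}. \<Sum>\<theta>'\<in>{0..<p ^ m}. if \<theta> = \<theta>' then \<Sum>g\<in>?C. ?F \<theta> g * cnj (?F \<theta> g) else 0)"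
    using orth by (intro sum.cong refl) auto
  also have "\<dots> = (\<Sum>\<theta>\<in>{0..<p ^ m}. \<Sum>g\<in>?C. ?F \<theta> g * cnj (?F \<theta> g))"
    by (intro sum.cong refl) (simp add: sum.delta')
  also have "\<dots> = complex_of_real (\<Sum>\<theta>\<in>{0..<p ^ m}. \<Sum>g\<in>?C. norm (?F \<theta> g) ^ 2)"
    by (simp only: of_real_sum sq)
  finally have "(\<Sum>g\<in>?C. norm (exp_sum 1 ?Q f A g) ^ 2) = (\<Sum>\<theta>\<in>{0..<p ^ m}. \<Sum>g\<in>?C. norm (?F \<theta> g) ^ 2)"
    by (simp only: of_real_eq_iff)
  then have "moment 1 ?Q (critical 1) f A = norm_sum_parts p m 1 ?Q f A ^ critical 1"
    unfolding moment_def norm_sum_parts_def avg_def s by (simp add: sum_nonneg flip: sum_divide_distrib)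
  then show "moment 1 ?Q (critical 1) f A \<le> 1 * norm_sum_parts p m 1 ?Q f A ^ critical 1" by simp
qed

text \<open>The dichotomy of Bourgain and Guth around the largest term. If all others are below
  \<open>\<tau> / P\<close> times it, they add at most a fraction \<open>\<tau>\<close>; otherwise
  some second term is comparable to it and their product controls everything. The narrow loss
  \<open>1 + \<tau>\<close> can be brought arbitrarily close to 1.\<close>

lemma broad_narrow:
  fixes x :: "'a \<Rightarrow> real"
  assumes fin: "finite T" and x: "\<And>i. i \<in> T \<Longrightarrow> x i \<ge> 0" and \<tau>: "0 < \<tau>" and z: "0 \<le> z" "z \<le> (\<Sum>i\<in>T. x i)"
    and P: "real (card T) \<le> P" "P > 0" and n1: "n1 > 0"
  shows "z ^ (n1 + n2) \<le> (1 + \<tau>) ^ (n1 + n2) * (\<Sum>i\<in>T. x i ^ (n1 + n2))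
     + P ^ (n1 + n2) * (P / \<tau>) ^ n2 * (\<Sum>i\<in>T. \<Sum>j\<in>T - {i}. x i ^ n1 * x j ^ n2)"
proof (cases "T = {}")
  case True
  then show ?thesis using z n1 by (simp add: power_0_left)
next
  case False
  let ?n = "n1 + n2"
  have "Max (x ` T) \<in> x ` T" using False fin by (intro Max_in) auto
  then obtain i where "i \<in> T" "x i = Max (x ` T)" by auto
  then have i: "i \<in> T" "\<And>j. j \<in> T \<Longrightarrow> x j \<le> x i" using fin by auto
  have S1: "x i ^ ?n \<le> (\<Sum>i\<in>T. x i ^ ?n)"
    using i fin x by (intro member_le_sum) auto
  have in0: "(\<Sum>j\<in>T - {i'}. x i' ^ n1 * x j ^ n2) \<ge> 0" if "i' \<in> T" for i'
    using x that by (intro sum_nonneg) auto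
  have S20: "(\<Sum>i\<in>T. \<Sum>j\<in>T - {i}. x i ^ n1 * x j ^ n2) \<ge> 0"
    by (intro sum_nonneg in0)
  have sumT: "(\<Sum>i\<in>T. x i) = x i + (\<Sum>j\<in>T - {i}. x j)" using i fin by (simp add: sum.remove)
  show ?thesis
  proof (cases "\<forall>j\<in>T - {i}. x j \<le> \<tau> / P * x i")
    case True
    then have "(\<Sum>j\<in>T - {i}. x j) \<le> real (card (T - {i})) * (\<tau> / P * x i)"
      by (intro sum_bounded_above) auto
    also have "\<dots> \<le> P * (\<tau> / P * x i)"
      using P \<tau> x[OF i(1)] card_Diff1_le[of T i] by (intro mult_right_mono) auto
    finally have "z \<le> (1 + \<tau>) * x i" using z sumT P by (simp add: algebra_simps)
    then have "z ^ ?n \<le> (1 + \<tau>) ^ ?n * x i ^ ?n"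
      unfolding power_mult_distrib[symmetric] by (rule power_mono) (rule z)
    also have "\<dots> \<le> (1 + \<tau>) ^ ?n * (\<Sum>i\<in>T. x i ^ ?n)" using S1 \<tau> by (intro mult_left_mono) auto
    finally show ?thesis using S20 P \<tau> by (smt (verit) divide_nonneg_nonneg mult_nonneg_nonneg zero_le_power)
  next
    case False
    then obtain j where j: "j \<in> T - {i}" "\<tau> / P * x i \<le> x j" by (meson linear)
    have xi: "x i \<ge> 0" "x j \<ge> 0" using x i j by auto
    have "(\<Sum>i\<in>T. x i) \<le> real (card T) * x i" by (intro sum_bounded_above i(2))
    also have "\<dots> \<le> P * x i" using P xi by (intro mult_right_mono)
    finally have "z ^ ?n \<le> (P * x i) ^ ?n" using z by (intro power_mono) auto
    also have "\<dots> = P ^ ?n * (x i ^ n1 * x i ^ n2)" by (simp add: power_mult_distrib power_add)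
    also have "\<dots> \<le> P ^ ?n * (x i ^ n1 * ((P / \<tau>) * x j) ^ n2)"
      using j(2) P \<tau> xi by (intro mult_left_mono power_mono) (auto simp: field_simps)
    also have "\<dots> = P ^ ?n * (P / \<tau>) ^ n2 * (x i ^ n1 * x j ^ n2)" by (simp only: power_mult_distrib mult_ac)
    also have "\<dots> \<le> P ^ ?n * (P / \<tau>) ^ n2 * (\<Sum>i\<in>T. \<Sum>j\<in>T - {i}. x i ^ n1 * x j ^ n2)"
    proof (intro mult_left_mono)
      have "x i ^ n1 * x j ^ n2 \<le> (\<Sum>j\<in>T - {i}. x i ^ n1 * x j ^ n2)"
        using j fin x xi by (intro member_le_sum[where f = "\<lambda>j. x i ^ n1 * x j ^ n2"]) auto
      also have "\<dots> \<le> (\<Sum>i\<in>T. \<Sum>j\<in>T - {i}. x i ^ n1 * x j ^ n2)"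
        using i fin in0 by (intro member_le_sum[where f = "\<lambda>i. \<Sum>j\<in>T - {i}. x i ^ n1 * x j ^ n2"]) auto
      finally show "x i ^ n1 * x j ^ n2 \<le> \<dots>" .
    qed (use P \<tau> in auto)
    finally have "z ^ ?n \<le> \<dots>" .
    moreover have "0 \<le> (1 + \<tau>) ^ ?n * (\<Sum>i\<in>T. x i ^ ?n)" using \<tau> x by (intro mult_nonneg_nonneg sum_nonneg) auto
    ultimately show ?thesis by linarith
  qed
qed

text \<open>Applied to the classes modulo \<open>p\<close>: a narrow class rescales from
  \<open>Suc m\<close> to \<open>m\<close> scales, and a broad pair is transverse. The result is a
  recursion in \<open>m\<close> whose homogeneous factor is nearly 1.\<close>

lemma decoupled_broad:
  fixes p :: int
  assumes p: "p > 1" and k: "k \<ge> 1" and s: "s1 + s2 = critical k" "s1 \<ge> 1" and \<tau>: "\<tau> > 0"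
    and D: "decoupled p k m C1" "C1 \<ge> 0" and B: "bil_decoupled p k s1 s2 1 1 (Suc m) C2" "C2 \<ge> 0"
  shows "decoupled p k (Suc m) ((1 + \<tau>) ^ (2 * critical k) * C1
      + real_of_int p ^ (2 * critical k) * (real_of_int p / \<tau>) ^ (2 * s2) * real_of_int p ^ 2 * C2)"
  unfolding decoupled_def
proof (intro allI impI)
  fix c f A assume c: "k * Suc m \<le> c" and A: "finite (A :: int set)"
  let ?Q = "p ^ c" and ?n = "2 * critical k"
  let ?T = "{0..<p ^ 1}"
  let ?x = "\<lambda>i g. norm (exp_sum k ?Q f (residue_part p 1 A i) g)"
  let ?N = "norm_sum_parts p (Suc m) k ?Q f"
  let ?K = "real_of_int p ^ ?n * (real_of_int p / \<tau>) ^ (2 * s2)"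
  have K0: "?K \<ge> 0" using p \<tau> by simp
  have n: "?n = 2 * s1 + 2 * s2" using s by simp
  have dv: "p ^ 1 dvd n - i" if "n \<in> residue_part p 1 A i" for n i
    using that by (auto simp: residue_part_def mod_eq_dvd_iff)
  have "norm (exp_sum k ?Q f A g) ^ ?n \<le> (1 + \<tau>) ^ ?n * (\<Sum>i\<in>?T. ?x i g ^ ?n)
      + ?K * (\<Sum>i\<in>?T. \<Sum>j\<in>?T - {i}. ?x i g ^ (2 * s1) * ?x j g ^ (2 * s2))" for g
    unfolding n
    by (rule broad_narrow) (use p \<tau> s exp_sum_partition[OF A, of p k ?Q f g 1] in \<open>auto intro!: norm_sum\<close>)
  then have "moment k ?Q (critical k) f A \<le> avg (coeff_box k ?Q) (\<lambda>g. (1 + \<tau>) ^ ?n * (\<Sum>i\<in>?T. ?x i g ^ ?n)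
      + ?K * (\<Sum>i\<in>?T. \<Sum>j\<in>?T - {i}. ?x i g ^ (2 * s1) * ?x j g ^ (2 * s2)))"
    unfolding moment_def by (intro avg_mono)
  also have "\<dots> = (1 + \<tau>) ^ ?n * (\<Sum>i\<in>?T. moment k ?Q (critical k) f (residue_part p 1 A i))
      + ?K * (\<Sum>i\<in>?T. \<Sum>j\<in>?T - {i}. avg (coeff_box k ?Q) (\<lambda>g. ?x i g ^ (2 * s1) * ?x j g ^ (2 * s2)))"
    by (simp only: avg_add avg_cmult avg_sum moment_def)
  also have "\<dots> \<le> (1 + \<tau>) ^ ?n * (C1 * ?N A ^ critical k) + ?K * (real_of_int p ^ 2 * (C2 * ?N A ^ critical k))"
  proof (intro add_mono mult_left_mono)
    have "(\<Sum>i\<in>?T. moment k ?Q (critical k) f (residue_part p 1 A i)) \<le> (\<Sum>i\<in>?T. C1 * (?N (residue_part p 1 A i) * ?N A ^ (critical k - 1)))"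
    proof (intro sum_mono)
      fix i assume i: "i \<in> ?T"
      have "moment k ?Q (critical k) f (residue_part p 1 A i) \<le> C1 * ?N (residue_part p 1 A i) ^ critical k"
        by (rule decoupled_rescale[where a = 1 and \<xi> = i]) (use p k c A D dv in auto)
      \<comment> \<open>One factor is kept for the additive sum over classes; the remaining ones are
        bounded by the norm sum of the whole set.\<close>
      also have "?N (residue_part p 1 A i) ^ critical k = ?N (residue_part p 1 A i) * ?N (residue_part p 1 A i) ^ (critical k - 1)"
        using critical_pos[OF k] by (simp add: power_eq_if)
      also have "C1 * \<dots> \<le> C1 * (?N (residue_part p 1 A i) * ?N A ^ (critical k - 1))"
        using p k i by (intro mult_left_mono power_mono norm_sum_parts_cls_le) (auto simp: norm_sum_parts_nonneg D)
      finally show "moment k ?Q (critical k) f (residue_part p 1 A i) \<le> \<dots>" .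
    qed
    also have "\<dots> = C1 * ((\<Sum>i\<in>?T. ?N (residue_part p 1 A i)) * ?N A ^ (critical k - 1))"
      by (simp only: sum_distrib_left sum_distrib_right)
    also have "\<dots> = C1 * ?N A ^ critical k"
      using norm_sum_parts_split[of 1 "Suc m" p k ?Q f A] p k critical_pos[OF k] by (simp add: power_eq_if[of _ "critical k"])
    finally show "(\<Sum>i\<in>?T. moment k ?Q (critical k) f (residue_part p 1 A i)) \<le> C1 * ?N A ^ critical k" .
    have "(\<Sum>i\<in>?T. \<Sum>j\<in>?T - {i}. avg (coeff_box k ?Q) (\<lambda>g. ?x i g ^ (2 * s1) * ?x j g ^ (2 * s2)))
       \<le> (\<Sum>i\<in>?T. \<Sum>j\<in>?T. C2 * ?N A ^ critical k)"
    proof (intro sum_mono)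
      fix i assume i: "i \<in> ?T"
      have "(\<Sum>j\<in>?T - {i}. avg (coeff_box k ?Q) (\<lambda>g. ?x i g ^ (2 * s1) * ?x j g ^ (2 * s2)))
        \<le> (\<Sum>j\<in>?T - {i}. C2 * ?N A ^ critical k)"
      proof (intro sum_mono)
        fix j assume j: "j \<in> ?T - {i}"
        have sep: "\<not> p dvd n1 - n2" if "n1 \<in> residue_part p 1 A i" "n2 \<in> residue_part p 1 A j" for n1 n2
          using that j by (auto simp: residue_part_def mod_eq_dvd_iff[symmetric])
        have "avg (coeff_box k ?Q) (\<lambda>g. ?x i g ^ (2 * s1) * ?x j g ^ (2 * s2))
          \<le> C2 * ?N (residue_part p 1 A i) ^ s1 * ?N (residue_part p 1 A j) ^ s2"
          by (rule bil_decoupledD[OF B(1) c _ _ dv dv sep]) (use A in auto)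
        also have "\<dots> \<le> C2 * ?N A ^ s1 * ?N A ^ s2"
          using p k i j B(2) by (intro mult_mono power_mono norm_sum_parts_cls_le mult_nonneg_nonneg) (auto simp: norm_sum_parts_nonneg)
        finally show "avg (coeff_box k ?Q) (\<lambda>g. ?x i g ^ (2 * s1) * ?x j g ^ (2 * s2)) \<le> C2 * ?N A ^ critical k"
          by (simp add: power_add flip: s(1))
      qed
      also have "\<dots> \<le> (\<Sum>j\<in>?T. C2 * ?N A ^ critical k)"
        using B(2) by (intro sum_mono2) (auto simp: norm_sum_parts_nonneg)
      finally show "(\<Sum>j\<in>?T - {i}. avg (coeff_box k ?Q) (\<lambda>g. ?x i g ^ (2 * s1) * ?x j g ^ (2 * s2)))
        \<le> (\<Sum>j\<in>?T. C2 * ?N A ^ critical k)" .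
    qed
    also have "\<dots> = real_of_int p ^ 2 * (C2 * ?N A ^ critical k)" using p by (simp add: power2_eq_square)
    finally show "(\<Sum>i\<in>?T. \<Sum>j\<in>?T - {i}. avg (coeff_box k ?Q) (\<lambda>g. ?x i g ^ (2 * s1) * ?x j g ^ (2 * s2)))
       \<le> real_of_int p ^ 2 * (C2 * ?N A ^ critical k)" .
  qed (use \<tau> K0 in auto)
  finally show "moment k ?Q (critical k) f A \<le> ((1 + \<tau>) ^ ?n * C1
      + real_of_int p ^ ?n * (real_of_int p / \<tau>) ^ (2 * s2) * real_of_int p ^ 2 * C2) * ?N A ^ critical k"
    by (simp only: distrib_right mult.assoc)
qed

section \<open>Exchanging the two factors\<close>

text \<open>One transverse step reaches at most \<open>a' = (l + 1) * a / l\<close>, so larger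
  ratios are reached by geometric iteration. The powers of \<open>p\<close> telescope to
  \<open>a' - a\<close>, while the constants multiply once per step, with \<open>n\<close>
  independent of the scales.\<close>

lemma bil_decoupled_lift:
  fixes p :: int
  assumes p: "prime p" and k: "int k < p" and l: "1 \<le> l" "l \<le> k" and \<epsilon>: "\<epsilon> > 0"
    and low: "\<And>e. e > 0 \<Longrightarrow> decoupling_exponent p l e"
  shows "\<exists>K>0. \<forall>a a' b m C. 2 * l \<le> a \<longrightarrow> a \<le> a' \<longrightarrow> a' \<le> m \<longrightarrow> 1 \<le> b \<longrightarrow> l * a' \<le> (k - l + 1) * b \<longrightarrow>
     real a' \<le> real a * (1 + 1 / (2 * real l)) ^ n \<longrightarrow> C \<ge> 0 \<longrightarrow> bil_decoupled p k (critical l) s2 a' b m C \<longrightarrow>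
     bil_decoupled p k (critical l) s2 a b m (K * real_of_int p powr (\<epsilon> * (real a' - real a)) * C)"
proof (induction n)
  case 0
  show ?case
  proof (intro exI[of _ 1] conjI allI impI)
    fix a a' b m C assume "a \<le> a'" "real a' \<le> real a * (1 + 1 / (2 * real l)) ^ 0" "bil_decoupled p k (critical l) s2 a' b m C"
    then show "bil_decoupled p k (critical l) s2 a b m (1 * real_of_int p powr (\<epsilon> * (real a' - real a)) * C)"
      using prime_gt_0_int[OF p] by simp
  qed simp
next
  case (Suc n)
  then obtain K where K: "K > 0" "\<And>a a' b m C. \<lbrakk>2 * l \<le> a; a \<le> a'; a' \<le> m; 1 \<le> b; l * a' \<le> (k - l + 1) * b;
     real a' \<le> real a * (1 + 1 / (2 * real l)) ^ n; C \<ge> 0; bil_decoupled p k (critical l) s2 a' b m C\<rbrakk> \<Longrightarrow>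
     bil_decoupled p k (critical l) s2 a b m (K * real_of_int p powr (\<epsilon> * (real a' - real a)) * C)" by blast
  obtain K0 where K0: "K0 > 0" "\<And>m. decoupled p l m (K0 * real_of_int p powr (\<epsilon> * real m))" using low[OF \<epsilon>] by blast
  show ?case
  proof (intro exI[of _ "K0 * K"] conjI allI impI)
    show "K0 * K > 0" using K K0 by simp
    fix a a' b m C
    assume h: "2 * l \<le> a" "a \<le> a'" "a' \<le> m" "1 \<le> b" "l * a' \<le> (k - l + 1) * b"
      and h2: "real a' \<le> real a * (1 + 1 / (2 * real l)) ^ Suc n" and C: "C \<ge> 0" and B: "bil_decoupled p k (critical l) s2 a' b m C"
    \<comment> \<open>The farthest admissible scale in one step, rounded down and capped at the
      target.\<close>
    define a1 where "a1 = min a' ((l + 1) * a div l)"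
    have a1: "a \<le> a1" "a1 \<le> a'" "l * a1 \<le> (l + 1) * a"
    proof -
      have "a = l * a div l" using l by simp
      also have "\<dots> \<le> (l + 1) * a div l" by (intro div_le_mono) simp
      finally show "a \<le> a1" using h by (simp add: a1_def)
      show "a1 \<le> a'" by (simp add: a1_def)
      have "l * a1 \<le> l * ((l + 1) * a div l)" by (simp add: a1_def)
      then show "l * a1 \<le> (l + 1) * a" by (meson le_trans times_div_less_eq_dividend)
    qed
    have le: "real a' \<le> real a1 * (1 + 1 / (2 * real l)) ^ n"
    proof (cases "a1 = a'")
      case True
      have "(1::real) \<le> (1 + 1 / (2 * real l)) ^ n" by (intro one_le_power) simp
      then show ?thesis using True by (simp add: mult_le_cancel_left1)
    next
      case False
      then have "a1 = (l + 1) * a div l" by (simp add: a1_def min_def split: if_splits)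
      then have "(l + 1) * a < l + l * a1"
        using dividend_less_times_div[of l "(l + 1) * a"] l by simp
      then have "real ((l + 1) * a) < real (l + l * a1)" by (rule of_nat_less_iff[THEN iffD2])
      then have "real a1 \<ge> real ((l + 1) * a) / real l - 1"
        using l by (simp add: field_simps)
      also have "real ((l + 1) * a) / real l - 1 = real a + real a / real l - 1"
        using l by (simp add: field_simps)
      also have "\<dots> \<ge> real a * (1 + 1 / (2 * real l))"
      proof -
        \<comment> \<open>The rounding loses at most 1, and \<open>a / l - 1 >= a / (2 * l)\<close>
          because \<open>a >= 2 * l\<close>; hence the growth factor
          \<open>1 + 1 / (2 * l)\<close>.\<close>
        have "real a \<ge> 2 * real l" using h(1) by linarith
        then show ?thesis using l by (simp add: field_simps)
      qed
      finally have "real a * (1 + 1 / (2 * real l)) \<le> real a1" by simp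
      then have "real a * (1 + 1 / (2 * real l)) * (1 + 1 / (2 * real l)) ^ n \<le> real a1 * (1 + 1 / (2 * real l)) ^ n"
        by (intro mult_right_mono) auto
      then show ?thesis using h2 by (simp add: mult.assoc)
    qed
    have B0: "bil_decoupled p k (critical l) s2 a1 b m (K * real_of_int p powr (\<epsilon> * (real a' - real a1)) * C)"
      by (rule K(2)) (use h a1 le C B in auto)
    have B1: "bil_decoupled p k (critical l) s2 a b m
        (K0 * real_of_int p powr (\<epsilon> * real (a1 - a)) * (K * real_of_int p powr (\<epsilon> * (real a' - real a1)) * C))"
      by (rule bil_decoupled_step[OF p k l _ h(4) a1(1) _ a1(3) order.trans[OF mult_le_mono2[OF a1(2)] h(5)] K0(2) _ B0])
        (use l h a1 K(1) K0 C in auto)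
    have e: "real_of_int p powr (\<epsilon> * real (a1 - a)) * real_of_int p powr (\<epsilon> * (real a' - real a1))
        = real_of_int p powr (\<epsilon> * (real a' - real a))"
      using a1 by (simp add: of_nat_diff algebra_simps flip: powr_add)
    have "K0 * real_of_int p powr (\<epsilon> * real (a1 - a)) * (K * real_of_int p powr (\<epsilon> * (real a' - real a1)) * C)
        = K0 * K * real_of_int p powr (\<epsilon> * (real a' - real a)) * C"
      unfolding e[symmetric] by (simp only: mult_ac)
    then show "bil_decoupled p k (critical l) s2 a b m (K0 * K * real_of_int p powr (\<epsilon> * (real a' - real a)) * C)"
      using B1 by (simp only:)
  qed
qed

text \<open>In the exchange of factors the target scale never exceeds \<open>k\<^sup>2 * a\<close>,
  so a number of steps depending only on \<open>k\<close> and \<open>l\<close> suffices.\<close>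

lemma bil_decoupled_lift_ratio:
  fixes p :: int
  assumes p: "prime p" and k: "int k < p" and l: "1 \<le> l" "l \<le> k" and \<epsilon>: "\<epsilon> > 0"
    and low: "\<And>e. e > 0 \<Longrightarrow> decoupling_exponent p l e"
  shows "\<exists>K>0. \<forall>a a' b m C. 2 * l \<le> a \<longrightarrow> a \<le> a' \<longrightarrow> a' \<le> m \<longrightarrow> 1 \<le> b \<longrightarrow> l * a' \<le> (k - l + 1) * b \<longrightarrow>
     a' \<le> k\<^sup>2 * a \<longrightarrow> C \<ge> 0 \<longrightarrow> bil_decoupled p k (critical l) s2 a' b m C \<longrightarrow>
     bil_decoupled p k (critical l) s2 a b m (K * real_of_int p powr (\<epsilon> * real m) * C)"
proof -
  have "1 < 1 + 1 / (2 * real l)" using l by simp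
  then obtain n where n: "real (k\<^sup>2) < (1 + 1 / (2 * real l)) ^ n" using real_arch_pow by blast
  obtain K where K: "K > 0" "\<And>a a' b m C. \<lbrakk>2 * l \<le> a; a \<le> a'; a' \<le> m; 1 \<le> b; l * a' \<le> (k - l + 1) * b;
     real a' \<le> real a * (1 + 1 / (2 * real l)) ^ n; C \<ge> 0; bil_decoupled p k (critical l) s2 a' b m C\<rbrakk> \<Longrightarrow>
     bil_decoupled p k (critical l) s2 a b m (K * real_of_int p powr (\<epsilon> * (real a' - real a)) * C)"
    using bil_decoupled_lift[OF p k l \<epsilon> low, of n s2] by blast
  show ?thesis
  proof (intro exI[of _ K] conjI allI impI K(1))
    fix a a' b m C
    assume h: "2 * l \<le> a" "a \<le> a'" "a' \<le> m" "1 \<le> b" "l * a' \<le> (k - l + 1) * b" "a' \<le> k\<^sup>2 * a"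
       and C: "C \<ge> 0" and B: "bil_decoupled p k (critical l) s2 a' b m C"
    have "real a' \<le> real (k\<^sup>2 * a)" using h(6) by (rule of_nat_mono)
    also have "\<dots> = real a * real (k\<^sup>2)" by (simp add: mult.commute)
    also have "\<dots> \<le> real a * (1 + 1 / (2 * real l)) ^ n" using n by (intro mult_left_mono) auto
    finally have "bil_decoupled p k (critical l) s2 a b m (K * real_of_int p powr (\<epsilon> * (real a' - real a)) * C)"
      by (intro K(2)) (use h C B in auto)
    then show "bil_decoupled p k (critical l) s2 a b m (K * real_of_int p powr (\<epsilon> * real m) * C)"
      by (rule bil_decoupled_mono) (use h(2,3) K(1) C \<epsilon> prime_gt_1_int[OF p] in \<open>intro mult_right_mono mult_left_mono powr_mono, auto\<close>)
  qed
qed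

text \<open>\<open>gain k t l * b\<close> is the number of scales gained for free after \<open>t\<close> rounds of
  exchanging the two factors.\<close>

primrec gain :: "nat \<Rightarrow> nat \<Rightarrow> nat \<Rightarrow> real" where
  "gain k 0 l = (if l = 0 then 1 else 0)"
| "gain k (Suc t) l = (if l = 0 then 1 else
     gain k t (k - l) / real l + real (k - l) / real (k - l + 1) * gain k t (l - 1))"

lemma gain_0 [simp]: "gain k t 0 = 1"
  by (cases t) auto

text \<open>The recursion preserves mass: the value at \<open>j\<close> with
  \<open>1 <= j < k\<close> is passed on with weights \<open>1 / (k - j)\<close> and
  \<open>(k - j - 1) / (k - j)\<close>, which sum to 1. The value 1 at \<open>j = 0\<close> feeds in
  \<open>(k - 1) / k\<close> anew each round, so the total grows without bound.\<close>

lemma sum_gain: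
  assumes k: "k \<ge> 2"
  shows "(\<Sum>l\<in>{1..<k}. gain k t l) = real t * (real (k - 1) / real k)"
proof (induction t)
  case 0 then show ?case by simp
next
  case (Suc t)
  let ?x = "gain k t"
  have "(\<Sum>l\<in>{1..<k}. gain k (Suc t) l)
      = (\<Sum>l\<in>{1..<k}. ?x (k - l) / real l) + (\<Sum>l\<in>{1..<k}. real (k - l) / real (k - l + 1) * ?x (l - 1))"
    by (simp add: sum.distrib)
  also have "(\<Sum>l\<in>{1..<k}. ?x (k - l) / real l) = (\<Sum>j\<in>{1..<k}. ?x j / real (k - j))"
    by (rule sum.reindex_bij_witness[of _ "\<lambda>j. k - j" "\<lambda>j. k - j"]) auto
  also have "(\<Sum>l\<in>{1..<k}. real (k - l) / real (k - l + 1) * ?x (l - 1)) = (\<Sum>j\<in>{0..<k - 1}. real (k - j - 1) / real (k - j) * ?x j)"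
    by (rule sum.reindex_bij_witness[of _ "\<lambda>j. j + 1" "\<lambda>j. j - 1"]) (auto simp: Suc_diff_le)
  also have "\<dots> = (\<Sum>j\<in>{0..<k}. real (k - j - 1) / real (k - j) * ?x j)"
    using k by (intro sum.mono_neutral_left) auto
  also have "\<dots> = real (k - 1) / real k + (\<Sum>j\<in>{1..<k}. real (k - j - 1) / real (k - j) * ?x j)"
    using k by (subst sum.atLeast_Suc_lessThan) auto
  also have "(\<Sum>j\<in>{1..<k}. ?x j / real (k - j)) + \<dots>
      = real (k - 1) / real k + (\<Sum>j\<in>{1..<k}. ?x j / real (k - j) + real (k - j - 1) / real (k - j) * ?x j)"
    by (simp add: sum.distrib)
  also have "(\<Sum>j\<in>{1..<k}. ?x j / real (k - j) + real (k - j - 1) / real (k - j) * ?x j) = (\<Sum>j\<in>{1..<k}. ?x j)"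
  proof (intro sum.cong refl)
    fix j assume "j \<in> {1..<k}"
    then have kj: "real (k - j) > 0" "real (k - j - 1) = real (k - j) - 1" by auto
    have "x / y + (y - 1) / y * x = x" if "y > 0" for x y :: real
      using that by (simp add: field_simps)
    from this[OF kj(1)] show "?x j / real (k - j) + real (k - j - 1) / real (k - j) * ?x j = ?x j"
      unfolding kj(2) .
  qed
  finally have "(\<Sum>l\<in>{1..<k}. gain k (Suc t) l) = real (k - 1) / real k + real t * (real (k - 1) / real k)"
    unfolding Suc .
  then show ?case by (simp only: of_nat_Suc distrib_right mult_1)
qed

lemma exists_gain:
  assumes k: "k \<ge> 2" shows "\<exists>l. 1 \<le> l \<and> l < k \<and> gain k t l \<ge> real t / real k"
proof (rule ccontr)
  assume "\<not> ?thesis"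
  then have "\<And>l. l \<in> {1..<k} \<Longrightarrow> gain k t l < real t / real k" by (meson atLeastLessThan_iff not_le)
  then have "(\<Sum>l\<in>{1..<k}. gain k t l) < (\<Sum>l\<in>{1..<k}. real t / real k)"
    using k by (intro sum_strict_mono) auto
  also have "\<dots> = real t * (real (k - 1) / real k)" by simp
  finally show False unfolding sum_gain[OF k] by simp
qed

text \<open>At \<open>l * a = (k - l + 1) * b\<close>, the exponent \<open>critical l\<close> on the
  first factor interpolates between two pairs. In one, the second factor carries
  \<open>critical (k - l)\<close> and its class is refined from \<open>b\<close> at fixed
  \<open>a\<close>; in the other, the first factor carries \<open>critical (l - 1)\<close> and its
  class is refined from \<open>a\<close> at fixed \<open>b\<close>. Divisibility of \<open>b\<close>
  by powers of \<open>fact k\<close> keeps \<open>a\<close> exact through the rounds, and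
  \<open>k ^ (t + 1) * b <= m\<close> leaves room for the scales.\<close>

lemma bil_decoupled_exchange:
  fixes p :: int
  assumes p: "prime p" and k: "int k < p" and l: "1 \<le> l" "l < k" and e: "e \<ge> 0" and \<epsilon>: "\<epsilon> > 0"
    and low: "\<And>j e. 1 \<le> j \<Longrightarrow> j < k \<Longrightarrow> e > 0 \<Longrightarrow> decoupling_exponent p j e"
    and D: "\<And>\<epsilon>. \<epsilon> > 0 \<Longrightarrow> decoupling_exponent p k (e + \<epsilon>)"
    and IH: "\<And>j \<epsilon>. 1 \<le> j \<Longrightarrow> j < k \<Longrightarrow> \<epsilon> > 0 \<Longrightarrow> \<exists>K>0. \<forall>m b. fact k ^ t dvd b \<longrightarrow> b \<ge> 1 \<longrightarrow> k ^ (t + 1) * b \<le> m \<longrightarrow>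
       bil_decoupled p k (critical j) (critical k - critical j) ((k - j + 1) * b div j) b m
         (K * real_of_int p powr (e * (real m - gain k t j * real b) + \<epsilon> * real m))"
  shows "\<exists>K>0. \<forall>m b. fact k ^ Suc t dvd b \<longrightarrow> b \<ge> 1 \<longrightarrow> k ^ (Suc t + 1) * b \<le> m \<longrightarrow>
       bil_decoupled p k (critical l) (critical k - critical l) ((k - l + 1) * b div l) b m
         (K * real_of_int p powr (e * (real m - gain k (Suc t) l * real b) + \<epsilon> * real m))"
proof -
  let ?P = "real_of_int p"
  have p1: "p > 1" "?P > 1" using prime_gt_1_int[OF p] by auto
  define \<delta> where "\<delta> = \<epsilon> / 2"
  have \<delta>: "\<delta> > 0" "\<delta> + \<delta> = \<epsilon>" using \<epsilon> by (auto simp: \<delta>_def)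
  have kl: "1 \<le> k - l" "k - l < k" "k - l \<le> k" "k - (k - l) = l" using l by auto
  obtain K1 where K1: "K1 > 0" "\<And>m b. fact k ^ t dvd b \<Longrightarrow> b \<ge> 1 \<Longrightarrow> k ^ (t + 1) * b \<le> m \<Longrightarrow>
       bil_decoupled p k (critical (k - l)) (critical k - critical (k - l)) ((l + 1) * b div (k - l)) b m
         (K1 * ?P powr (e * (real m - gain k t (k - l) * real b) + \<delta> * real m))"
    using IH[OF kl(1,2) \<delta>(1)] unfolding kl(4) by blast
  obtain L1 where L1: "L1 > 0" "\<And>a a' b m C. \<lbrakk>2 * (k - l) \<le> a; a \<le> a'; a' \<le> m; 1 \<le> b; (k - l) * a' \<le> (l + 1) * b;
     a' \<le> k\<^sup>2 * a; C \<ge> 0; bil_decoupled p k (critical (k - l)) (critical k - critical (k - l)) a' b m C\<rbrakk> \<Longrightarrow>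
     bil_decoupled p k (critical (k - l)) (critical k - critical (k - l)) a b m (L1 * ?P powr (\<delta> * real m) * C)"
    using bil_decoupled_lift_ratio[OF p k kl(1,3) \<delta>(1) low[OF kl(1,2)], of "critical k - critical (k - l)"] unfolding kl(4) by blast
  have "\<exists>K2>0. \<forall>m a b. fact k ^ t dvd b \<longrightarrow> b \<ge> 1 \<longrightarrow> k ^ (t + 1) * b \<le> m \<longrightarrow> 2 * (l - 1) \<le> a \<longrightarrow> (l - 1) * a \<le> (k - l + 2) * b \<longrightarrow> b \<le> k * a \<longrightarrow>
      bil_decoupled p k (critical (l - 1)) (critical k - critical (l - 1)) a b m
        (K2 * ?P powr (e * (real m - gain k t (l - 1) * real b) + \<epsilon> * real m))"
  \<comment> \<open>For \<open>l = 1\<close> the exponent \<open>critical 0\<close> is 0, and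
    rescaling the second class by \<open>b\<close> replaces the inductive bound.\<close>
  proof (cases "l = 1")
    case True
    obtain K where K: "K > 0" "\<And>m. decoupled p k m (K * ?P powr ((e + \<epsilon>) * real m))" using D[OF \<epsilon>] by blast
    show ?thesis
    proof (intro exI[of _ K] conjI allI impI K(1))
      fix m a b :: nat assume b: "b \<ge> 1" "k ^ (t + 1) * b \<le> m"
      have "1 * b \<le> k ^ (t + 1) * b" using l by (intro mult_le_mono1) simp
      then have bm: "b \<le> m" using b by linarith
      have "bil_decoupled p k 0 (critical k) a b m (K * ?P powr ((e + \<epsilon>) * real (m - b)))"
        by (rule bil_decoupled_zero[OF p1(1) K(2)]) (use p1 K(1) l bm in auto)
      moreover have "K * ?P powr ((e + \<epsilon>) * real (m - b)) \<le> K * ?P powr (e * (real m - gain k t (l - 1) * real b) + \<epsilon> * real m)"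
        using True K(1) p1 bm \<epsilon> by (intro mult_left_mono powr_mono) (auto simp: of_nat_diff algebra_simps)
      ultimately show "bil_decoupled p k (critical (l - 1)) (critical k - critical (l - 1)) a b m
        (K * ?P powr (e * (real m - gain k t (l - 1) * real b) + \<epsilon> * real m))"
        using True by (auto simp: critical_def intro: bil_decoupled_mono)
    qed
  next
    case False
    then have l1: "1 \<le> l - 1" "l - 1 < k" "l - 1 \<le> k" "k - (l - 1) + 1 = k - l + 2" using l by auto
    obtain K where K: "K > 0" "\<And>m b. fact k ^ t dvd b \<Longrightarrow> b \<ge> 1 \<Longrightarrow> k ^ (t + 1) * b \<le> m \<Longrightarrow>
       bil_decoupled p k (critical (l - 1)) (critical k - critical (l - 1)) ((k - l + 2) * b div (l - 1)) b m
         (K * ?P powr (e * (real m - gain k t (l - 1) * real b) + \<delta> * real m))"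
      using IH[OF l1(1,2) \<delta>(1)] unfolding l1(4) by blast
    obtain L where L: "L > 0" "\<And>a a' b m C. \<lbrakk>2 * (l - 1) \<le> a; a \<le> a'; a' \<le> m; 1 \<le> b; (l - 1) * a' \<le> (k - l + 2) * b;
       a' \<le> k\<^sup>2 * a; C \<ge> 0; bil_decoupled p k (critical (l - 1)) (critical k - critical (l - 1)) a' b m C\<rbrakk> \<Longrightarrow>
       bil_decoupled p k (critical (l - 1)) (critical k - critical (l - 1)) a b m (L * ?P powr (\<delta> * real m) * C)"
      using bil_decoupled_lift_ratio[OF p k l1(1,3) \<delta>(1) low[OF l1(1,2)], of "critical k - critical (l - 1)"] unfolding l1(4) by blast
    show ?thesis
    proof (intro exI[of _ "L * K"] conjI allI impI)
      show "L * K > 0" using L K by simp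
      fix m a b :: nat
      assume b: "fact k ^ t dvd b" "b \<ge> 1" "k ^ (t + 1) * b \<le> m" and a: "2 * (l - 1) \<le> a" "(l - 1) * a \<le> (k - l + 2) * b" "b \<le> k * a"
      let ?a' = "(k - l + 2) * b div (l - 1)"
      have "?a' \<le> (k - l + 2) * b" by simp
      also have "\<dots> \<le> k * b" using l1 by (intro mult_le_mono1) auto
      finally have a'k: "?a' \<le> k * b" .
      have "k * b \<le> k ^ (t + 1) * b" using l by (intro mult_le_mono1) (simp add: self_le_power)
      then have am: "?a' \<le> m" using a'k b(3) by linarith
      have "?a' \<le> k * (k * a)" using a'k mult_le_mono2[OF a(3), of k] by linarith
      then have ak: "?a' \<le> k\<^sup>2 * a" by (simp add: power2_eq_square)
      have aa: "a \<le> ?a'" using div_le_mono[OF a(2), of "l - 1"] l1 by simp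
      have "bil_decoupled p k (critical (l - 1)) (critical k - critical (l - 1)) a b m (L * ?P powr (\<delta> * real m) *
          (K * ?P powr (e * (real m - gain k t (l - 1) * real b) + \<delta> * real m)))"
        by (rule L(2)[OF a(1) aa am b(2) times_div_less_eq_dividend ak _ K(2)[OF b]]) (use K(1) in auto)
      also have "L * ?P powr (\<delta> * real m) * (K * ?P powr (e * (real m - gain k t (l - 1) * real b) + \<delta> * real m))
         = L * K * (?P powr (\<delta> * real m) * ?P powr (e * (real m - gain k t (l - 1) * real b) + \<delta> * real m))" by simp
      also have "\<dots> = L * K * ?P powr (e * (real m - gain k t (l - 1) * real b) + \<epsilon> * real m)"
        by (simp add: algebra_simps flip: powr_add \<delta>(2))
      finally show "bil_decoupled p k (critical (l - 1)) (critical k - critical (l - 1)) a b m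
        (L * K * ?P powr (e * (real m - gain k t (l - 1) * real b) + \<epsilon> * real m))" .
    qed
  qed
  then obtain K2 where K2: "K2 > 0" "\<And>m a b. \<lbrakk>fact k ^ t dvd b; b \<ge> 1; k ^ (t + 1) * b \<le> m; 2 * (l - 1) \<le> a; (l - 1) * a \<le> (k - l + 2) * b; b \<le> k * a\<rbrakk> \<Longrightarrow>
      bil_decoupled p k (critical (l - 1)) (critical k - critical (l - 1)) a b m
        (K2 * ?P powr (e * (real m - gain k t (l - 1) * real b) + \<epsilon> * real m))" by blast
  \<comment> \<open>The weight is forced by \<open>critical l = \<theta> * (critical k - critical (k
    - l)) + (1 - \<theta>) * critical (l - 1)\<close>.\<close>
  define \<theta> where "\<theta> = 1 / real (k - l + 1)"
  have \<theta>: "0 < \<theta>" "\<theta> < 1" using l by (auto simp: \<theta>_def)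
  have kml: "real (k - l) = real k - real l" using l by (simp add: of_nat_diff)
  have critical_le: "critical i \<le> critical k" if "i \<le> k" for i
    unfolding critical_def using that by (intro div_le_mono mult_le_mono) auto
  have s1: "real (critical l) = \<theta> * real (critical k - critical (k - l)) + (1 - \<theta>) * real (critical (l - 1))"
  proof -
    define D where "D = real (k - l + 1)"
    have D: "D > 0" "real (k - l) = D - 1" "real k = D - 1 + real l" "real (l - 1) = real l - 1"
      using l by (auto simp: D_def)
    have "real l * (real l + 1) / 2 = (1 / D) * ((D - 1 + real l) * (D - 1 + real l + 1) / 2 - (D - 1) * (D - 1 + 1) / 2)
        + (1 - 1 / D) * ((real l - 1) * (real l - 1 + 1) / 2)"
      using D(1) by (simp add: field_simps)
    then show ?thesis
      using critical_le[of "k - l"] by (simp only: of_nat_diff real_critical \<theta>_def D_def[symmetric] D(2,3,4) kl(3))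
  qed
  have s2: "real (critical k - critical l) = \<theta> * real (critical (k - l)) + (1 - \<theta>) * real (critical k - critical (l - 1))"
    using s1 l critical_le[of "k - l"] critical_le[of l] critical_le[of "l - 1"] by (simp add: of_nat_diff algebra_simps)
  show ?thesis
  proof (intro exI[of _ "(L1 * K1) powr \<theta> * K2 powr (1 - \<theta>)"] conjI allI impI)
    show "(L1 * K1) powr \<theta> * K2 powr (1 - \<theta>) > 0" using L1 K1 K2 by simp
    fix m b :: nat
    assume b: "fact k ^ Suc t dvd b" "b \<ge> 1" "k ^ (Suc t + 1) * b \<le> m"
    obtain w where w: "b = fact k ^ Suc t * w" using b(1) by (elim dvdE)
    have "l dvd fact k" using l by (simp add: dvd_fact)
    then obtain q where q: "fact k = l * q" by (elim dvdE)
    define a where "a = (k - l + 1) * b div l"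
    have bl: "b = l * (fact k ^ t * q * w)"
      unfolding w power_Suc by (subst (1) q) (simp only: mult_ac)
    have "(k - l + 1) * b = l * ((k - l + 1) * (fact k ^ t * q * w))" unfolding bl by (simp only: mult_ac)
    then have a: "a = (k - l + 1) * (fact k ^ t * q * w)" using l by (simp add: a_def)
    have al: "l * a = (k - l + 1) * b" unfolding a bl by (simp only: mult_ac)
    have ra: "real l * real a = (real k - real l + 1) * real b"
      using arg_cong[OF al, of real] by (simp add: kml distrib_right)
    have ad: "fact k ^ t dvd a" by (simp add: a)
    have bd: "fact k ^ t dvd b" by (simp add: w)
    have a1: "a \<ge> 1" using al b(2) l by (cases a) auto
    have fk: "fact k \<le> b" using b(1,2) dvd_imp_le[of "fact k" b] dvd_mult_left[of "fact k" "fact k ^ t" b] by simp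
    \<comment> \<open>With \<open>fact k <= b\<close> this gives the lower bounds
      \<open>2 * (k - l) <= b\<close> and \<open>2 * (l - 1) <= a\<close> required for
      lifting.\<close>
    have "k * (k - 1) \<le> fact k"
    proof -
      have "fact k = k * fact (k - 1)" using l by (simp add: fact_num_eq_if)
      then show ?thesis using fact_ge_self[of "k - 1"] by simp
    qed
    then have kb: "k * (k - 1) \<le> b" using fk by linarith
    have akb: "a \<le> k * b"
    proof -
      have "a \<le> l * a" using l by simp
      also have "\<dots> \<le> k * b" unfolding al using l by (intro mult_le_mono1) auto
      finally show ?thesis .
    qed
    have blka: "b \<le> l * a" unfolding al by simp
    have kt: "k ^ (t + 1) * (k * b) \<le> m" using b(3) by (simp add: mult_ac)
    have ktb: "k ^ (t + 1) * b \<le> m" 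
      by (rule order.trans[OF mult_le_mono2 kt]) (use l in simp)
    have kta: "k ^ (t + 1) * a \<le> m" using kt mult_le_mono2[OF akb, of "k ^ (t + 1)"] by linarith
    have B1: "bil_decoupled p k (critical (k - l)) (critical k - critical (k - l)) b a m (L1 * ?P powr (\<delta> * real m) *
         (K1 * ?P powr (e * (real m - gain k t (k - l) * real a) + \<delta> * real m)))"
    proof (rule L1(2)[OF _ _ _ a1 times_div_less_eq_dividend _ _ K1(2)[OF ad a1 kta]])
      have "2 * (k - l) \<le> k * (k - 1)" using l by (intro mult_le_mono) auto
      then show "2 * (k - l) \<le> b" using kb by linarith
      have "(b * (k - l)) * l \<le> ((l + 1) * a) * l"
      proof -
        have "(b * (k - l)) * l = (l * (k - l)) * b" by simp
        also have "\<dots> \<le> ((l + 1) * (k - l + 1)) * b" by (intro mult_le_mono) auto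
        also have "\<dots> = (l + 1) * (l * a)" unfolding al by (simp only: mult.assoc)
        finally show ?thesis by (simp only: mult_ac)
      qed
      then have "b * (k - l) \<le> (l + 1) * a" using l by simp
      then show "b \<le> (l + 1) * a div (k - l)" using l by (simp add: less_eq_div_iff_mult_less_eq)
      have "(l + 1) * a div (k - l) \<le> (l + 1) * a" by (rule div_le_dividend)
      also have "\<dots> \<le> k * a" using l by (intro mult_le_mono1) auto
      finally have d: "(l + 1) * a div (k - l) \<le> k * a" .
      have "k * a \<le> k ^ (t + 1) * a" using l by (intro mult_le_mono1) (simp add: self_le_power)
      then show "(l + 1) * a div (k - l) \<le> m" using d kta by linarith
      show "(l + 1) * a div (k - l) \<le> k\<^sup>2 * b"
        using order.trans[OF d mult_le_mono2[OF akb, of k]] by (simp only: power2_eq_square mult.assoc)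
    qed (use K1(1) in auto)
    have B2: "bil_decoupled p k (critical (l - 1)) (critical k - critical (l - 1)) a b m
        (K2 * ?P powr (e * (real m - gain k t (l - 1) * real b) + \<epsilon> * real m))"
    proof (rule K2(2)[OF bd b(2) ktb])
      have "l * (2 * (l - 1)) = 2 * (l * (l - 1))" by simp
      also have "\<dots> \<le> (k - l + 1) * (k * (k - 1))" using l by (intro mult_le_mono) auto
      also have "\<dots> \<le> l * a" unfolding al by (intro mult_le_mono2 kb)
      finally show "2 * (l - 1) \<le> a" using l by simp
      have "(l - 1) * a \<le> l * a" by (intro mult_le_mono1) simp
      also have "\<dots> \<le> (k - l + 2) * b" unfolding al by (intro mult_le_mono1) simp
      finally show "(l - 1) * a \<le> (k - l + 2) * b" .
      show "b \<le> k * a" using blka l mult_le_mono1[of l k a] by linarith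
    qed
    have "bil_decoupled p k (critical l) (critical k - critical l) a b m ((L1 * ?P powr (\<delta> * real m) *
         (K1 * ?P powr (e * (real m - gain k t (k - l) * real a) + \<delta> * real m))) powr \<theta> *
        (K2 * ?P powr (e * (real m - gain k t (l - 1) * real b) + \<epsilon> * real m)) powr (1 - \<theta>))"
      by (rule bil_decoupled_holder[OF bil_decoupled_sym[OF B1] B2 _ _ \<theta> s1 s2]) (use L1 K1 K2 in auto)
    also have "L1 * ?P powr (\<delta> * real m) * (K1 * ?P powr (e * (real m - gain k t (k - l) * real a) + \<delta> * real m))
       = L1 * K1 * (?P powr (\<delta> * real m) * ?P powr (e * (real m - gain k t (k - l) * real a) + \<delta> * real m))" by simp
    also have "\<dots> = L1 * K1 * ?P powr (e * (real m - gain k t (k - l) * real a) + \<epsilon> * real m)"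
      by (simp add: algebra_simps flip: powr_add \<delta>(2))
    also have "(L1 * K1 * ?P powr (e * (real m - gain k t (k - l) * real a) + \<epsilon> * real m)) powr \<theta> *
        (K2 * ?P powr (e * (real m - gain k t (l - 1) * real b) + \<epsilon> * real m)) powr (1 - \<theta>)
      = (L1 * K1) powr \<theta> * K2 powr (1 - \<theta>) * ?P powr ((e * (real m - gain k t (k - l) * real a) + \<epsilon> * real m) * \<theta>
         + (e * (real m - gain k t (l - 1) * real b) + \<epsilon> * real m) * (1 - \<theta>))"
    proof -
      have "(A * ?P powr x) powr \<theta> * (B * ?P powr y) powr \<eta> = A powr \<theta> * B powr \<eta> * ?P powr (x * \<theta> + y * \<eta>)" for A B x y \<eta>
        by (simp only: powr_mult powr_powr powr_add mult_ac)
      then show ?thesis .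
    qed
    also have "(e * (real m - gain k t (k - l) * real a) + \<epsilon> * real m) * \<theta>
         + (e * (real m - gain k t (l - 1) * real b) + \<epsilon> * real m) * (1 - \<theta>)
      = e * (real m - gain k (Suc t) l * real b) + \<epsilon> * real m"
    proof -
      \<comment> \<open>The saving at degree \<open>k - l\<close> is measured in units of
        \<open>a\<close>; weighting by \<open>\<theta>\<close> converts it to \<open>b / l\<close>,
        the first coefficient in \<open>gain\<close>.\<close>
      have ta: "\<theta> * real a = real b / real l"
        using ra l by (simp add: \<theta>_def kml field_simps)
      have t1: "1 - \<theta> = real (k - l) / real (k - l + 1)" using l by (simp add: \<theta>_def field_simps)
      have eq: "gain k (Suc t) l * real b = gain k t (k - l) * (\<theta> * real a) + (1 - \<theta>) * gain k t (l - 1) * real b"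
        unfolding ta t1 using l by (simp add: distrib_right)
      have "(e * (z - x * u) + \<epsilon> * z) * \<theta> + (e * (z - y * v) + \<epsilon> * z) * (1 - \<theta>)
          = e * (z - (x * (\<theta> * u) + (1 - \<theta>) * y * v)) + \<epsilon> * z" for x y z u v
        by (simp add: algebra_simps)
      then show ?thesis unfolding eq .
    qed
    finally show "bil_decoupled p k (critical l) (critical k - critical l) ((k - l + 1) * b div l) b m
         ((L1 * K1) powr \<theta> * K2 powr (1 - \<theta>) * ?P powr (e * (real m - gain k (Suc t) l * real b) + \<epsilon> * real m))"
      unfolding a_def .
  qed
qed

text \<open>Induction on the number of rounds. The base case has no saving for \<open>l >= 1\<close>
  and follows from linear decoupling.\<close>

lemma bil_decoupled_gain:
  fixes p :: int
  assumes p: "prime p" and k: "int k < p" and e: "e \<ge> 0"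
    and low: "\<And>j e. 1 \<le> j \<Longrightarrow> j < k \<Longrightarrow> e > 0 \<Longrightarrow> decoupling_exponent p j e"
    and D: "\<And>\<epsilon>. \<epsilon> > 0 \<Longrightarrow> decoupling_exponent p k (e + \<epsilon>)"
    and l: "1 \<le> l" "l < k" and \<epsilon>: "\<epsilon> > 0"
  shows "\<exists>K>0. \<forall>m b. fact k ^ t dvd b \<longrightarrow> b \<ge> 1 \<longrightarrow> k ^ (t + 1) * b \<le> m \<longrightarrow>
       bil_decoupled p k (critical l) (critical k - critical l) ((k - l + 1) * b div l) b m
         (K * real_of_int p powr (e * (real m - gain k t l * real b) + \<epsilon> * real m))"
  using l \<epsilon>
proof (induction t arbitrary: l \<epsilon>)
  case 0
  obtain K where K: "K > 0" "\<And>m. decoupled p k m (K * real_of_int p powr ((e + \<epsilon>) * real m))" using D[OF 0(3)] by blast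
  have "critical l \<le> critical k" unfolding critical_def using 0 by (intro div_le_mono mult_le_mono) auto
  then have "bil_decoupled p k (critical l) (critical k - critical l) a b m (K * real_of_int p powr ((e + \<epsilon>) * real m))" for a b m
    by (intro bil_decoupled_of_decoupled K(2)) (use prime_gt_1_int[OF p] K(1) 0 in auto)
  then show ?case using K(1) 0 by (intro exI[of _ K]) (auto simp: algebra_simps)
next
  case (Suc t)
  show ?case by (rule bil_decoupled_exchange[OF p k Suc.prems(1,2) e Suc.prems(3) low D Suc.IH])
qed

text \<open>Starting from scales 1 and 1, trivial decoupling reaches the scales \<open>a\<close> and
  \<open>b\<close> at a cost of at most \<open>k * b * critical k\<close>. Enough rounds of exchange
  outweigh that cost, and since \<open>b\<close> is proportional to \<open>m\<close>, the surplus is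
  a fixed decrease of the exponent.\<close>

lemma bil_decoupled_saving:
  fixes p :: int
  assumes p: "prime p" and k: "int k < p" "k \<ge> 2" and e: "e > 0"
    and low: "\<And>j e. 1 \<le> j \<Longrightarrow> j < k \<Longrightarrow> e > 0 \<Longrightarrow> decoupling_exponent p j e"
    and D: "\<And>\<epsilon>. \<epsilon> > 0 \<Longrightarrow> decoupling_exponent p k (e + \<epsilon>)"
  shows "\<exists>l \<omega> K. 1 \<le> l \<and> l < k \<and> \<omega> > 0 \<and> K > 0 \<and>
    (\<forall>m. bil_decoupled p k (critical l) (critical k - critical l) 1 1 m (K * real_of_int p powr ((e - \<omega>) * real m)))"
proof -
  let ?P = "real_of_int p"
  have p1: "p > 1" "?P > 1" using prime_gt_1_int[OF p] by auto
  \<comment> \<open>Enough rounds that the saving per unit of \<open>b\<close> exceeds the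
    coarsening cost \<open>k * critical k\<close> by 1.\<close>
  obtain t :: nat where "t \<ge> real k * (real k * real (critical k) + 1) / e" using real_arch_simple by blast
  then have t: "e * (real t / real k) \<ge> real k * real (critical k) + 1" using e k by (simp add: field_simps)
  obtain l where l: "1 \<le> l" "l < k" "gain k t l \<ge> real t / real k" using exists_gain[OF k(2)] by blast
  have eg: "e * gain k t l \<ge> real k * real (critical k) + 1"
    using order.trans[OF t mult_left_mono[OF l(3)]] e by simp
  have cl: "critical l \<ge> 1" "critical l < critical k" "critical l + (critical k - critical l) = critical k"
  proof -
    show "critical l \<ge> 1" using l by (intro critical_pos)
    have "real l * (real l + 1) < real k * (real k + 1)" using l by (intro mult_strict_mono) auto
    then have "real (critical l) < real (critical k)" by (simp add: real_critical)
    then show "critical l < critical k" "critical l + (critical k - critical l) = critical k" by auto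
  qed
  define Z where "Z = k ^ (t + 1) * fact k ^ t"
  have Z: "Z > 0" using k by (simp add: Z_def)
  \<comment> \<open>Up to rounding, \<open>b\<close> is \<open>\<kappa> * m\<close>, the largest
    scale with \<open>k ^ (t + 1) * b <= m\<close>. The surplus is then \<open>\<kappa> * m\<close>,
    of which half is given up to the epsilon loss.\<close>
  define \<kappa> where "\<kappa> = 1 / real (k ^ (t + 1))"
  have \<kappa>: "\<kappa> > 0" using k by (simp add: \<kappa>_def)
  obtain K where K: "K > 0" "\<And>m b. fact k ^ t dvd b \<Longrightarrow> b \<ge> 1 \<Longrightarrow> k ^ (t + 1) * b \<le> m \<Longrightarrow>
       bil_decoupled p k (critical l) (critical k - critical l) ((k - l + 1) * b div l) b m
         (K * ?P powr (e * (real m - gain k t l * real b) + \<kappa> / 2 * real m))"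
    using bil_decoupled_gain[OF p k(1) less_imp_le[OF e] low D l(1,2), where \<epsilon> = "\<kappa> / 2" and t = t] \<kappa> by auto
  obtain K0 where K0: "K0 > 0" "\<And>m. decoupled p k m (K0 * ?P powr ((e + \<kappa> / 2) * real m))"
    using D[of "\<kappa> / 2"] \<kappa> by auto
  \<comment> \<open>The first summand pays for rounding \<open>b\<close> down to a multiple of
    \<open>fact k ^ t\<close>, the second for the finitely many \<open>m < Z\<close>.\<close>
  define K1 where "K1 = K * ?P powr real (fact k ^ t) + K0 * ?P powr (\<kappa> * real Z)"
  have K1: "K1 > 0" using K K0 p1 by (simp add: K1_def add_pos_pos)
  have "bil_decoupled p k (critical l) (critical k - critical l) 1 1 m (K1 * ?P powr ((e - \<kappa> / 2) * real m))" for m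
  proof (cases "m < Z")
    case True
    have "bil_decoupled p k (critical l) (critical k - critical l) 1 1 m (K0 * ?P powr ((e + \<kappa> / 2) * real m))"
      by (intro bil_decoupled_of_decoupled K0(2)) (use p1 K0(1) k cl in auto)
    moreover have "K0 * ?P powr ((e + \<kappa> / 2) * real m) = K0 * ?P powr (\<kappa> * real m) * ?P powr ((e - \<kappa> / 2) * real m)"
      by (simp add: algebra_simps flip: powr_add)
    moreover have "\<dots> \<le> K1 * ?P powr ((e - \<kappa> / 2) * real m)"
    proof (intro mult_right_mono)
      have "K0 * ?P powr (\<kappa> * real m) \<le> K0 * ?P powr (\<kappa> * real Z)"
        using True \<kappa> K0(1) p1 by (intro mult_left_mono powr_mono) auto
      then show "K0 * ?P powr (\<kappa> * real m) \<le> K1" unfolding K1_def using K(1) by (simp add: add_increasing)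
    qed auto
    ultimately show ?thesis using bil_decoupled_mono by simp
  next
    case False
    define b where "b = fact k ^ t * (m div Z)"
    define a where "a = (k - l + 1) * b div l"
    have mz: "m div Z \<ge> 1" using False Z by (simp add: Suc_le_eq div_greater_zero_iff)
    then have b1: "b \<ge> 1" by (simp add: b_def)
    have "k ^ (t + 1) * b = Z * (m div Z)" by (simp add: Z_def b_def mult_ac)
    then have kb: "k ^ (t + 1) * b \<le> m" by simp
    have "k * b \<le> k ^ (t + 1) * b" using l by (intro mult_le_mono1) (simp add: self_le_power)
    then have kbm: "k * b \<le> m" using kb by linarith
    have "a \<le> (k - l + 1) * b" unfolding a_def by (rule div_le_dividend)
    also have "\<dots> \<le> k * b" using l by (intro mult_le_mono1) auto
    finally have akb: "a \<le> k * b" .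
    have bkb: "b \<le> k * b" using l by simp
    let ?C = "K * ?P powr (e * (real m - gain k t l * real b) + \<kappa> / 2 * real m)"
    have C0: "?C \<ge> 0" using K(1) by simp
    have "bil_decoupled p k (critical l) (critical k - critical l) a b m ?C"
      unfolding a_def by (rule K(2)[OF _ b1 kb]) (simp add: b_def)
    then have "bil_decoupled p k (critical l) (critical k - critical l) 1 b m (?P ^ (a * critical l) * ?C)"
      by (rule bil_decoupled_coarsen) (use C0 cl p1 k order.trans[OF akb kbm] in auto)
    then have "bil_decoupled p k (critical k - critical l) (critical l) b 1 m (?P ^ (a * critical l) * ?C)" by (rule bil_decoupled_sym)
    then have "bil_decoupled p k (critical k - critical l) (critical l) 1 1 m (?P ^ (b * (critical k - critical l)) * (?P ^ (a * critical l) * ?C))"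
      by (rule bil_decoupled_coarsen) (use C0 cl p1 k order.trans[OF bkb kbm] in auto)
    then have B: "bil_decoupled p k (critical l) (critical k - critical l) 1 1 m (?P ^ (b * (critical k - critical l)) * (?P ^ (a * critical l) * ?C))"
      by (rule bil_decoupled_sym)
    have "b * (critical k - critical l) + a * critical l \<le> k * b * (critical k - critical l) + k * b * critical l"
      using akb bkb by (intro add_mono mult_le_mono1)
    also have "\<dots> = k * b * critical k" using cl(3) by (metis add.commute distrib_left)
    finally have ex: "b * (critical k - critical l) + a * critical l \<le> k * b * critical k" .
    have bk: "real b \<ge> \<kappa> * real m - real (fact k ^ t)"
    proof -
      have "m < Z + Z * (m div Z)" using dividend_less_times_div[OF Z] .
      then have "real m < real (Z + Z * (m div Z))" by (rule of_nat_less_iff[THEN iffD2])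
      also have "\<dots> = real (k ^ (t + 1)) * (real (fact k ^ t) + real b)" by (simp add: Z_def b_def algebra_simps)
      finally show ?thesis unfolding \<kappa>_def using k by (simp add: field_simps)
    qed
    have "?P ^ (b * (critical k - critical l)) * (?P ^ (a * critical l) * ?C) = K * (?P ^ (b * (critical k - critical l) + a * critical l)
        * ?P powr (e * (real m - gain k t l * real b) + \<kappa> / 2 * real m))" by (simp add: power_add mult_ac)
    also have "\<dots> \<le> K * (?P ^ (k * b * critical k) * ?P powr (e * (real m - gain k t l * real b) + \<kappa> / 2 * real m))"
      using K(1) p1 ex by (intro mult_left_mono mult_right_mono power_increasing) auto
    also have "\<dots> = K * ?P powr (real (k * b * critical k) + (e * (real m - gain k t l * real b) + \<kappa> / 2 * real m))"
      using p1 by (simp only: powr_add powr_realpow)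
    also have "\<dots> \<le> K * ?P powr (real (fact k ^ t) + (e - \<kappa> / 2) * real m)"
    proof (intro mult_left_mono powr_mono)
      have "(real k * real (critical k) + 1) * real b \<le> e * gain k t l * real b" using eg by (intro mult_right_mono) auto
      then show "real (k * b * critical k) + (e * (real m - gain k t l * real b) + \<kappa> / 2 * real m) \<le> real (fact k ^ t) + (e - \<kappa> / 2) * real m"
        using bk by (simp add: algebra_simps)
    qed (use K p1 in auto)
    also have "\<dots> = K * ?P powr real (fact k ^ t) * ?P powr ((e - \<kappa> / 2) * real m)" by (simp only: powr_add mult.assoc)
    also have "\<dots> \<le> K1 * ?P powr ((e - \<kappa> / 2) * real m)"
      unfolding K1_def using K0(1) by (intro mult_right_mono) auto
    finally show ?thesis using B bil_decoupled_mono by blast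
  qed
  then show ?thesis using l \<kappa> K1 by (intro exI[of _ l] exI[of _ "\<kappa> / 2"] exI[of _ K1]) auto
qed

text \<open>In the broad-narrow recursion the bilinear term already has a smaller exponent, and the
  narrow factor can be chosen below \<open>p powr e'\<close>; the recursion then closes at the
  exponent \<open>e' < e\<close>.\<close>

lemma decoupled_bootstrap:
  fixes p :: int
  assumes p: "prime p" and k: "int k < p" "k \<ge> 2" and e: "e > 0"
    and low: "\<And>j e. 1 \<le> j \<Longrightarrow> j < k \<Longrightarrow> e > 0 \<Longrightarrow> decoupling_exponent p j e"
    and D: "\<And>\<epsilon>. \<epsilon> > 0 \<Longrightarrow> decoupling_exponent p k (e + \<epsilon>)"
  shows "\<exists>e'. 0 < e' \<and> e' < e \<and> (decoupling_exponent p k e')"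
proof -
  let ?P = "real_of_int p"
  have p1: "p > 1" "?P > 1" using prime_gt_1_int[OF p] by auto
  obtain l \<omega> K where l: "1 \<le> l" "l < k" and \<omega>: "\<omega> > 0" and K: "K > 0"
    and B: "\<And>m. bil_decoupled p k (critical l) (critical k - critical l) 1 1 m (K * ?P powr ((e - \<omega>) * real m))"
    using bil_decoupled_saving[OF assms] by blast
  have cl: "critical l \<ge> 1" "critical l + (critical k - critical l) = critical k"
  proof -
    show "critical l \<ge> 1" using l by (intro critical_pos)
    have "critical l \<le> critical k" unfolding critical_def using l by (intro div_le_mono mult_le_mono) auto
    then show "critical l + (critical k - critical l) = critical k" by simp
  qed
  \<comment> \<open>The maximum with \<open>e / 2\<close> keeps the new exponent positive even if
    \<open>\<omega> >= e\<close>.\<close>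
  define e' where "e' = max (e / 2) (e - \<omega>)"
  have e': "0 < e'" "e' < e" "e - \<omega> \<le> e'" using e \<omega> by (auto simp: e'_def)
  \<comment> \<open>Chosen so that the narrow loss per scale is exactly
    \<open>p powr (e' / 2)\<close>, half of the growth allowed.\<close>
  define \<tau> where "\<tau> = ?P powr (e' / 2 / real (2 * critical k)) - 1"
  have s: "critical k \<ge> 1" using k by (intro critical_pos) auto
  have \<tau>: "\<tau> > 0" "(1 + \<tau>) ^ (2 * critical k) = ?P powr (e' / 2)"
  proof -
    have "1 < ?P powr (e' / 2 / real (2 * critical k))" using e' p1 s by (intro gr_one_powr) auto
    then show "\<tau> > 0" by (simp add: \<tau>_def)
    have "(1 + \<tau>) ^ (2 * critical k) = (?P powr (e' / 2 / real (2 * critical k))) powr real (2 * critical k)"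
      using p1 unfolding \<tau>_def by (simp flip: powr_realpow)
    then show "(1 + \<tau>) ^ (2 * critical k) = ?P powr (e' / 2)" using s by (simp add: powr_powr)
  qed
  define A where "A = ?P ^ (2 * critical k) * (?P / \<tau>) ^ (2 * (critical k - critical l)) * ?P ^ 2"
  have A: "A \<ge> 0" using p1 \<tau> by (simp add: A_def)
  have q: "?P powr (- (e' / 2)) < 1" using p1 e' by (simp add: powr_less_one)
  \<comment> \<open>After division by \<open>p powr (e' * Suc m)\<close> the narrow part takes the
    fraction \<open>p powr (- (e' / 2))\<close> of \<open>K3\<close>; the rest must accommodate the
    broad part \<open>A * K\<close>.\<close>
  define K3 where "K3 = max 1 (A * K / (1 - ?P powr (- (e' / 2))))"
  have K3: "K3 \<ge> 1" "A * K \<le> K3 * (1 - ?P powr (- (e' / 2)))"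
  proof -
    show "K3 \<ge> 1" by (simp add: K3_def)
    have "A * K / (1 - ?P powr (- (e' / 2))) \<le> K3" by (simp add: K3_def)
    then show "A * K \<le> K3 * (1 - ?P powr (- (e' / 2)))" using q by (simp add: field_simps)
  qed
  have "decoupled p k m (K3 * ?P powr (e' * real m))" for m
  proof (induction m)
    case 0
    have "decoupled p k 0 1" using decoupled_trivial[of p k 0] p1 k by simp
    then show ?case by (rule decoupled_mono) (use K3 p1 in simp)
  next
    case (Suc m)
    have "decoupled p k (Suc m) ((1 + \<tau>) ^ (2 * critical k) * (K3 * ?P powr (e' * real m))
       + A * (K * ?P powr ((e - \<omega>) * real (Suc m))))"
      unfolding A_def
      by (rule decoupled_broad[OF p1(1) _ cl(2,1) \<tau>(1) Suc _ B]) (use k K K3 in auto)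
    moreover have "(1 + \<tau>) ^ (2 * critical k) * (K3 * ?P powr (e' * real m)) + A * (K * ?P powr ((e - \<omega>) * real (Suc m)))
      \<le> K3 * ?P powr (e' * real (Suc m))"
    proof -
      have "(1 + \<tau>) ^ (2 * critical k) * (K3 * ?P powr (e' * real m)) = K3 * ?P powr (- (e' / 2)) * ?P powr (e' * real (Suc m))"
        unfolding \<tau>(2) by (simp add: algebra_simps flip: powr_add)
      moreover have "A * (K * ?P powr ((e - \<omega>) * real (Suc m))) \<le> A * (K * ?P powr (e' * real (Suc m)))"
        using A K p1 e' by (intro mult_left_mono powr_mono mult_right_mono) auto
      moreover have "A * (K * ?P powr (e' * real (Suc m))) \<le> K3 * (1 - ?P powr (- (e' / 2))) * ?P powr (e' * real (Suc m))"
        unfolding mult.assoc[of A K, symmetric] using K3(2) by (intro mult_right_mono) auto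
      moreover have "K3 * ?P powr (- (e' / 2)) * ?P powr (e' * real (Suc m))
          + K3 * (1 - ?P powr (- (e' / 2))) * ?P powr (e' * real (Suc m)) = K3 * ?P powr (e' * real (Suc m))"
        by (simp add: right_diff_distrib left_diff_distrib)
      ultimately show ?thesis by linarith
    qed
    ultimately show ?case by (rule decoupled_mono)
  qed
  then show ?thesis using e' K3(1) by (intro exI[of _ e'] conjI exI[of _ K3]) auto
qed

text \<open>Strong induction on the degree, and for each degree an infimum argument: the set of
  admissible exponents is upward closed, and a positive infimum would be undercut by the bootstrap.
  The infimum need not be attained, hence the bootstrap assumes only exponents
  \<open>e + \<epsilon>\<close>.\<close>

theorem decoupled_moment_curve:
  fixes p :: int
  assumes p: "prime p"
  shows "1 \<le> k \<Longrightarrow> int k < p \<Longrightarrow> e > 0 \<Longrightarrow> decoupling_exponent p k e"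
proof (induction k arbitrary: e rule: less_induct)
  case (less k)
  let ?P = "real_of_int p"
  have p1: "p > 1" "?P > 1" using prime_gt_1_int[OF p] by auto
  show ?case
  proof (cases "k = 1")
    case True
    have "decoupled p k m (1 * ?P powr (e * real m))" for m
      unfolding True by (rule decoupled_mono[OF decoupled_1[OF p1(1)]]) (use p1 less in \<open>simp add: ge_one_powr_ge_zero\<close>)
    then show ?thesis by (intro exI[of _ 1]) auto
  next
    case False
    then have k2: "k \<ge> 2" using less by simp
    have low: "decoupling_exponent p j e" if "1 \<le> j" "j < k" "e > 0" for j e
      using less.IH[OF that(2) that(1) _ that(3)] that less.prems by auto
    define S where "S = {e. e > 0 \<and> (decoupling_exponent p k e)}"
    have up: "e' \<in> S" if e: "e \<in> S" "e \<le> e'" for e e'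
    proof -
      obtain K where K: "K > 0" "\<And>m. decoupled p k m (K * ?P powr (e * real m))" and "e > 0" using e unfolding S_def by blast
      have "decoupled p k m (K * ?P powr (e' * real m))" for m
        by (rule decoupled_mono[OF K(2)]) (use e K(1) p1 in \<open>auto intro!: mult_left_mono powr_mono mult_right_mono\<close>)
      then show ?thesis using K(1) e \<open>e > 0\<close> unfolding S_def by auto
    qed
    have "real (critical k) \<in> S"
    proof -
      have "decoupled p k m (1 * ?P powr (real (critical k) * real m))" for m
        using decoupled_trivial[of p k m] p1 k2 by (simp add: mult.commute flip: powr_realpow)
      moreover have "critical k \<ge> 1" using k2 by (intro critical_pos) auto
      ultimately show ?thesis unfolding S_def by (intro CollectI conjI exI[of _ 1]) auto
    qed
    then have ne: "S \<noteq> {}" by auto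
    have bd: "bdd_below S" unfolding S_def by (rule bdd_belowI[of _ 0]) auto
    define e0 where "e0 = Inf S"
    have e00: "e0 \<ge> 0" unfolding e0_def by (rule cInf_greatest[OF ne]) (auto simp: S_def)
    have above: "e \<in> S" if "e > e0" for e
    proof -
      have "Inf S < e" using that by (simp add: e0_def)
      then obtain e1 where "e1 \<in> S" "e1 < e" using cInf_lessD[OF ne] by blast
      then show ?thesis using up by auto
    qed
    have "e0 = 0"
    proof (rule ccontr)
      assume "e0 \<noteq> 0"
      then have "e0 > 0" using e00 by simp
      moreover have "decoupling_exponent p k (e0 + \<epsilon>)" if "\<epsilon> > 0" for \<epsilon>
        using above[of "e0 + \<epsilon>"] that unfolding S_def by auto
      ultimately obtain e' where "e' < e0" "e' \<in> S"
        using decoupled_bootstrap[OF p less.prems(2) k2 _ low, of e0] unfolding S_def by auto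
      then show False using cInf_lower[OF _ bd] unfolding e0_def by force
    qed
    then have "e \<in> S" using above less.prems by auto
    then show ?thesis unfolding S_def by auto
  qed
qed

section \<open>Vinogradov's mean value\<close>

definition tuples :: "nat \<Rightarrow> int set \<Rightarrow> (nat \<Rightarrow> int) set" where
  "tuples s I = PiE {..<s} (\<lambda>_. I)"

definition vinogradov_pairs :: "nat \<Rightarrow> nat \<Rightarrow> int set \<Rightarrow> ((nat \<Rightarrow> int) \<times> (nat \<Rightarrow> int)) set" where
  "vinogradov_pairs K s I = {(x, y) \<in> tuples s I \<times> tuples s I. \<forall>j\<in>{1..K}. (\<Sum>i<s. x i ^ j) = (\<Sum>i<s. y i ^ j)}"

lemma finite_tuples [simp]: "finite I \<Longrightarrow> finite (tuples s I)"
  by (simp add: tuples_def finite_PiE)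

lemma sum_power_tuples: "finite I \<Longrightarrow> (\<Sum>n\<in>I. f n) ^ s = (\<Sum>x\<in>tuples s I. \<Prod>i<s. f (x i))"
  for f :: "int \<Rightarrow> 'a::comm_semiring_1"
  unfolding tuples_def using prod_sum_PiE[of "{..<s}" "\<lambda>_. I" "\<lambda>_ n. f n"] by simp

lemma unit_exp_sum: "unit_exp (\<Sum>i\<in>A. f i) = (\<Prod>i\<in>A. unit_exp (f i))"
  by (induction A rule: infinite_finite_induct) (simp_all add: unit_exp_add)

text \<open>Orthogonality on the finite torus: the sum is the full count if all power sums agree
  modulo \<open>Q\<close>, and 0 otherwise.\<close>

lemma char_sum_nonneg:
  fixes x y :: "nat \<Rightarrow> int" and s k :: nat
  assumes Q: "Q > 0"
  defines "L \<equiv> \<lambda>g. (\<Sum>i<s. coeff_eval k g (x i)) - (\<Sum>i<s. coeff_eval k g (y i))"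
  shows "0 \<le> Re (\<Sum>g\<in>coeff_box k Q. unit_exp (real_of_int (L g) / real_of_int Q))"
    and "(\<And>j. 1 \<le> j \<Longrightarrow> j \<le> k \<Longrightarrow> (\<Sum>i<s. x i ^ j) = (\<Sum>i<s. y i ^ j)) \<Longrightarrow>
      (\<Sum>g\<in>coeff_box k Q. unit_exp (real_of_int (L g) / real_of_int Q)) = of_nat (card (coeff_box k Q))"
proof -
  let ?e = "\<lambda>z. unit_exp (real_of_int z / real_of_int Q)"
  have Lg: "L g = (\<Sum>j\<le>k. g j * ((\<Sum>i<s. x i ^ j) - (\<Sum>i<s. y i ^ j)))" for g
  proof -
    have "(\<Sum>i<s. coeff_eval k g (z i)) = (\<Sum>j\<le>k. g j * (\<Sum>i<s. z i ^ j))" for z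
      unfolding coeff_eval_def by (subst sum.swap) (simp add: sum_distrib_left)
    then show ?thesis by (simp add: L_def sum_subtractf right_diff_distrib)
  qed
  show "(\<Sum>g\<in>coeff_box k Q. ?e (L g)) = of_nat (card (coeff_box k Q))"
    if "\<And>j. 1 \<le> j \<Longrightarrow> j \<le> k \<Longrightarrow> (\<Sum>i<s. x i ^ j) = (\<Sum>i<s. y i ^ j)"
  proof -
    have "L g = 0" for g unfolding Lg
    proof (rule sum.neutral, rule ballI)
      fix j assume "j \<in> {..k}"
      then show "g j * ((\<Sum>i<s. x i ^ j) - (\<Sum>i<s. y i ^ j)) = 0"
        using that[of j] by (cases "j = 0") auto
    qed
    then show ?thesis by simp
  qed
  define d where "d j = (\<Sum>i<s. x i ^ j) - (\<Sum>i<s. y i ^ j)" for j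
  show "0 \<le> Re (\<Sum>g\<in>coeff_box k Q. ?e (L g))"
  proof (cases "\<forall>j\<le>k. Q dvd d j")
    case True
    have "?e (L g) = 1" for g
    proof -
      have "Q dvd L g" unfolding Lg using True by (intro dvd_sum dvd_mult) (simp add: d_def)
      then show ?thesis using unit_exp_cong_mod[OF Q, of "L g" 0] by simp
    qed
    then show ?thesis by simp
  next
    case False
    then obtain j where j: "j \<le> k" "\<not> Q dvd d j" by auto
    let ?H = "monom 1 j :: int poly"
    have deg: "degree ?H \<le> k" using j(1) by (simp add: degree_monom_eq)
    let ?S = "\<Sum>g\<in>coeff_box k Q. ?e (L g)"
    have "?S = (\<Sum>g\<in>coeff_box k Q. ?e (L (shift_coeffs k Q ?H g)))"
      by (rule sum.reindex_bij_betw[OF bij_shift_coeffs[OF Q], symmetric])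
    also have "\<dots> = (\<Sum>g\<in>coeff_box k Q. ?e (d j) * ?e (L g))"
    proof (intro sum.cong refl)
      fix g
      have sm: "(\<Sum>i<s. coeff_eval k (shift_coeffs k Q ?H g) (z i)) mod Q = ((\<Sum>i<s. coeff_eval k g (z i)) + (\<Sum>i<s. z i ^ j)) mod Q" for z
        unfolding sum.distrib[symmetric]
        by (subst (1 2) mod_sum_eq[symmetric]) (simp only: coeff_eval_shift[OF Q deg] poly_monom mult_1)
      have "L (shift_coeffs k Q ?H g) mod Q = (L g + d j) mod Q"
        unfolding L_def d_def using mod_diff_cong[OF sm[of x] sm[of y]] by (simp add: algebra_simps)
      from unit_exp_cong_mod[OF Q this] show "?e (L (shift_coeffs k Q ?H g)) = ?e (d j) * ?e (L g)"
        by (simp add: add_divide_distrib unit_exp_add)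
    qed
    finally have "?S = ?e (d j) * ?S" unfolding sum_distrib_left[symmetric] .
    moreover have "?e (d j) \<noteq> 1"
    proof
      assume "?e (d j) = 1"
      then obtain z where "real_of_int (d j) / real_of_int Q = real_of_int z"
        unfolding unit_exp_eq_1_iff by (auto elim: Ints_cases)
      then have "real_of_int (d j) = real_of_int (Q * z)" using Q by (simp add: field_simps)
      then have "d j = Q * z" by (simp only: of_int_eq_iff)
      then show False using j by simp
    qed
    moreover have "S = e * S \<Longrightarrow> e \<noteq> 1 \<Longrightarrow> S = 0" for S e :: complex by simp
    ultimately have "?S = 0" by blast
    then show ?thesis by simp
  qed
qed

text \<open>The moment counts solutions of the congruences modulo \<open>Q\<close>; solutions over
  the integers are among them, and the others contribute nonnegatively.\<close>

lemma card_vinogradov_pairs_le_moment: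
  assumes Q: "Q > 0" and I: "finite I"
  shows "real (card (vinogradov_pairs k s I)) \<le> moment k Q s (\<lambda>_. 1) I"
proof -
  let ?e = "\<lambda>z. unit_exp (real_of_int z / real_of_int Q)"
  let ?L = "\<lambda>x y g. (\<Sum>i<s. coeff_eval k g (x i)) - (\<Sum>i<s. coeff_eval k g (y i))"
  let ?N = "real (card (coeff_box k Q))"
  let ?T = "tuples s I"
  have N: "?N > 0" using Q by (simp add: card_gt_0_iff)
  have exp_sum_pow: "exp_sum k Q (\<lambda>_. 1) I g ^ s = (\<Sum>x\<in>?T. ?e (\<Sum>i<s. coeff_eval k g (x i)))" for g
    unfolding exp_sum_def sum_power_tuples[OF I]
    by (simp add: sum_divide_distrib unit_exp_sum)
  have "complex_of_real (norm (exp_sum k Q (\<lambda>_. 1) I g) ^ (2 * s)) = (\<Sum>x\<in>?T. \<Sum>y\<in>?T. ?e (?L x y g))" for g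
  proof -
    have "complex_of_real (norm (exp_sum k Q (\<lambda>_. 1) I g) ^ (2 * s)) = (exp_sum k Q (\<lambda>_. 1) I g ^ s) * cnj (exp_sum k Q (\<lambda>_. 1) I g ^ s)"
      using complex_norm_square[of "exp_sum k Q (\<lambda>_. 1) I g ^ s"]
      by (simp add: norm_power power_mult[symmetric] mult.commute[of 2])
    also have "\<dots> = (\<Sum>x\<in>?T. \<Sum>y\<in>?T. ?e (\<Sum>i<s. coeff_eval k g (x i)) * cnj (?e (\<Sum>i<s. coeff_eval k g (y i))))"
      unfolding exp_sum_pow by (simp add: sum_product)
    also have "\<dots> = (\<Sum>x\<in>?T. \<Sum>y\<in>?T. ?e (?L x y g))"
      by (intro sum.cong refl) (simp only: of_int_diff diff_divide_distrib unit_exp_diff)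
    finally show ?thesis .
  qed
  then have "complex_of_real (\<Sum>g\<in>coeff_box k Q. norm (exp_sum k Q (\<lambda>_. 1) I g) ^ (2 * s))
      = (\<Sum>g\<in>coeff_box k Q. \<Sum>x\<in>?T. \<Sum>y\<in>?T. ?e (?L x y g))" by simp
  also have "\<dots> = (\<Sum>x\<in>?T. \<Sum>y\<in>?T. \<Sum>g\<in>coeff_box k Q. ?e (?L x y g))"
    by (rule trans[OF sum.swap], rule sum.cong, rule refl, rule sum.swap)
  finally have "(\<Sum>g\<in>coeff_box k Q. norm (exp_sum k Q (\<lambda>_. 1) I g) ^ (2 * s))
      = Re (\<Sum>x\<in>?T. \<Sum>y\<in>?T. \<Sum>g\<in>coeff_box k Q. ?e (?L x y g))" by (metis Re_complex_of_real)
  also have "\<dots> = (\<Sum>z\<in>?T \<times> ?T. Re (\<Sum>g\<in>coeff_box k Q. ?e (?L (fst z) (snd z) g)))"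
  proof -
    have "Re (\<Sum>x\<in>?T. \<Sum>y\<in>?T. F x y) = (\<Sum>z\<in>?T \<times> ?T. Re (F (fst z) (snd z)))" for F
      by (simp add: sum.cartesian_product split_def)
    then show ?thesis .
  qed
  also have "\<dots> \<ge> (\<Sum>z\<in>vinogradov_pairs k s I. Re (\<Sum>g\<in>coeff_box k Q. ?e (?L (fst z) (snd z) g)))"
    using I char_sum_nonneg(1)[OF Q] by (intro sum_mono2) (auto simp: vinogradov_pairs_def)
  also have "(\<Sum>z\<in>vinogradov_pairs k s I. Re (\<Sum>g\<in>coeff_box k Q. ?e (?L (fst z) (snd z) g))) = (\<Sum>z\<in>vinogradov_pairs k s I. ?N)"
  proof (intro sum.cong refl)
    fix z assume "z \<in> vinogradov_pairs k s I"
    then have "(\<Sum>g\<in>coeff_box k Q. ?e (?L (fst z) (snd z) g)) = of_nat (card (coeff_box k Q))"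
      by (intro char_sum_nonneg(2)[OF Q]) (auto simp: vinogradov_pairs_def)
    then show "Re (\<Sum>g\<in>coeff_box k Q. ?e (?L (fst z) (snd z) g)) = ?N" by simp
  qed
  finally show ?thesis using N by (simp add: moment_def avg_def field_simps)
qed

text \<open>Decoupling with unit weights down to classes so fine that each contains at most one
  integer of the interval; every occupied class then has moment 1, and the norm sum is at most the
  number of integers.\<close>

theorem vinogradov_mean_value:
  assumes k: "k \<ge> 1" and \<epsilon>: "\<epsilon> > 0"
  shows "\<exists>C>0. \<forall>M\<ge>1. real (card (vinogradov_pairs k (critical k) {- int M<..<int M})) \<le> C * real M powr (real (critical k) + \<epsilon>)"
proof -
  obtain p0 :: nat where p0: "prime p0" "p0 > k" using bigger_prime by blast
  define p where "p = int p0"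
  have p: "prime p" "int k < p" "p > 1" using p0 prime_gt_1_nat[OF p0(1)] by (auto simp: p_def)
  let ?P = "real_of_int p"
  let ?s = "critical k"
  have s: "?s \<ge> 1" using k by (rule critical_pos)
  have P: "?P > 1" using p by simp
  obtain K where K: "K > 0" "\<And>m. decoupled p k m (K * ?P powr (\<epsilon> * real m))"
    using decoupled_moment_curve[OF p(1) k p(2) \<epsilon>] by blast
  define C where "C = K * (2 * ?P) powr \<epsilon> * 2 ^ ?s"
  show ?thesis
  proof (intro exI[of _ C] conjI allI impI)
    show "C > 0" using K P by (simp add: C_def)
    fix M :: nat assume M: "M \<ge> 1"
    define I where "I = {- int M<..<int M}"
    have fin: "finite I" by (simp add: I_def)
    \<comment> \<open>Least with \<open>p ^ m >= 2 * M\<close>: classes separate the interval, while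
      \<open>p ^ m <= 2 * p * M\<close> keeps the loss at
      \<open>(2 * p * M) powr \<epsilon>\<close>.\<close>
    define m where "m = (LEAST m. 2 * real M \<le> ?P ^ m)"
    have ex: "\<exists>m. 2 * real M \<le> ?P ^ m" using real_arch_pow[OF P, of "2 * real M"] less_imp_le by blast
    have m: "2 * real M \<le> ?P ^ m" unfolding m_def by (rule LeastI_ex[OF ex])
    have m2: "?P ^ m \<le> 2 * ?P * real M"
    proof (cases m)
      case 0 then show ?thesis using P M mult_mono[of 1 "2 * ?P" 1 "real M"] by simp
    next
      case (Suc m')
      then have "\<not> 2 * real M \<le> ?P ^ m'" using not_less_Least[of m' "\<lambda>m. 2 * real M \<le> ?P ^ m"] by (simp add: m_def)
      then show ?thesis using Suc P by simp
    qed
    have m': "2 * int M \<le> p ^ m"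
    proof -
      have "real_of_int (2 * int M) \<le> real_of_int (p ^ m)" using m by simp
      then show ?thesis by (simp only: of_int_le_iff)
    qed
    let ?Q = "p ^ (k * m)"
    have "norm_sum_parts p m k ?Q (\<lambda>_. 1) I \<le> real (card I)"
    proof -
      define R where "R = (\<lambda>n. n mod p ^ m) ` I"
      have single: "moment k ?Q ?s (\<lambda>_. 1) (residue_part p m I \<theta>) powr (1 / real ?s) \<le> (if \<theta> \<in> R then 1 else 0)" for \<theta>
      proof (cases "\<theta> \<in> R")
        case False
        then have "residue_part p m I \<theta> = {}" by (auto simp: residue_part_def R_def)
        then show ?thesis using False s by (simp add: moment_empty)
      next
        case True
        then obtain n where n: "n \<in> I" "n mod p ^ m = \<theta>" by (auto simp: R_def)
        have "residue_part p m I \<theta> = {n}"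
        proof -
          have "n' = n" if "n' \<in> I" "n' mod p ^ m = \<theta>" for n'
          proof -
            have "p ^ m dvd n' - n" using that n by (simp add: mod_eq_dvd_iff[symmetric])
            moreover have "\<bar>n' - n\<bar> < p ^ m" using that n m' by (auto simp: I_def)
            ultimately show ?thesis using dvd_imp_le_int[of "n' - n" "p ^ m"] by linarith
          qed
          then show ?thesis using n unfolding residue_part_def by blast
        qed
        then have "moment k ?Q ?s (\<lambda>_. 1) (residue_part p m I \<theta>) = avg (coeff_box k ?Q) (\<lambda>_. 1)"
          by (simp add: moment_def exp_sum_def)
        also have "\<dots> = 1" using p by (intro avg_const) auto
        finally show ?thesis using True by simp
      qed
      have "norm_sum_parts p m k ?Q (\<lambda>_. 1) I \<le> (\<Sum>\<theta>\<in>{0..<p ^ m}. if \<theta> \<in> R then 1 else 0)"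
        unfolding norm_sum_parts_def by (intro sum_mono single)
      also have "\<dots> = real (card ({0..<p ^ m} \<inter> R))" by (simp add: sum.If_cases)
      also have "\<dots> \<le> real (card R)" using fin by (intro of_nat_mono card_mono) (auto simp: R_def)
      also have "\<dots> \<le> real (card I)" unfolding R_def using fin by (intro of_nat_mono card_image_le)
      finally show ?thesis .
    qed
    also have "\<dots> \<le> 2 * real M" using M by (simp add: I_def)
    finally have norm_sum_parts: "norm_sum_parts p m k ?Q (\<lambda>_. 1) I \<le> 2 * real M" .
    have "real (card (vinogradov_pairs k ?s I)) \<le> moment k ?Q ?s (\<lambda>_. 1) I" using p fin by (intro card_vinogradov_pairs_le_moment) auto
    also have "\<dots> \<le> K * ?P powr (\<epsilon> * real m) * norm_sum_parts p m k ?Q (\<lambda>_. 1) I ^ ?s"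
      using K(2)[of m] fin by (simp add: decoupled_def)
    also have "\<dots> \<le> K * ?P powr (\<epsilon> * real m) * (2 * real M) ^ ?s"
      using K(1) norm_sum_parts by (intro mult_left_mono power_mono norm_sum_parts_nonneg) auto
    also have "?P powr (\<epsilon> * real m) = (?P ^ m) powr \<epsilon>"
      using P by (simp add: powr_powr mult.commute flip: powr_realpow)
    also have "K * (?P ^ m) powr \<epsilon> * (2 * real M) ^ ?s \<le> K * (2 * ?P * real M) powr \<epsilon> * (2 * real M) ^ ?s"
      using K(1) m2 P \<epsilon> by (intro mult_right_mono mult_left_mono powr_mono2) auto
    also have "\<dots> = C * real M powr (real ?s + \<epsilon>)"
      using M by (simp add: C_def powr_mult powr_add powr_realpow power_mult_distrib)
    finally show "real (card (vinogradov_pairs k ?s {- int M<..<int M})) \<le> C * real M powr (real ?s + \<epsilon>)"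
      by (simp add: I_def)
  qed
qed

section \<open>Weyl sums\<close>

definition dist_int :: "real \<Rightarrow> real" where
  "dist_int x = \<bar>x - real_of_int (round x)\<bar>"

lemma dist_int_nonneg: "dist_int x \<ge> 0"
  by (simp add: dist_int_def)

lemma dist_int_le: "dist_int x \<le> \<bar>x - real_of_int n\<bar>"
  unfolding dist_int_def using round_diff_minimal[of x n] by (simp add: abs_minus_commute)

lemma dist_int_le_half: "dist_int x \<le> 1 / 2"
  unfolding dist_int_def using of_int_round_abs_le[of x] by (simp add: abs_minus_commute)

text \<open>Jordan's inequality, from concavity of the sine on \<open>{0..pi / 2}\<close>.\<close>

lemma sin_ge_linear: "0 \<le> y \<Longrightarrow> y \<le> 1 / 2 \<Longrightarrow> 2 * y \<le> sin (pi * y)"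
proof -
  assume y: "0 \<le> y" "y \<le> 1 / 2"
  have "convex_on {0..pi / 2} (\<lambda>x. - sin x)"
  proof (rule f''_ge0_imp_convex[where f' = "\<lambda>x. - cos x" and f'' = sin])
    fix x :: real assume x: "x \<in> {0..pi / 2}"
    show "((\<lambda>x. - sin x) has_real_derivative - cos x) (at x)" by (auto intro!: derivative_eq_intros)
    show "((\<lambda>x. - cos x) has_real_derivative sin x) (at x)" by (auto intro!: derivative_eq_intros)
    show "sin x \<ge> 0" using x by (intro sin_ge_zero) auto
  qed simp
  then have "- sin ((1 - 2 * y) *\<^sub>R 0 + (2 * y) *\<^sub>R (pi / 2)) \<le> (1 - 2 * y) * (- sin 0) + (2 * y) * (- sin (pi / 2))"
    by (rule convex_onD) (use y in auto)
  then show ?thesis by (simp add: mult.commute)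
qed

lemma norm_unit_exp_minus_1: "norm (unit_exp x - 1) \<ge> 4 * dist_int x"
proof -
  define y where "y = x - real_of_int (round x)"
  have y: "\<bar>y\<bar> \<le> 1 / 2" "dist_int x = \<bar>y\<bar>" using dist_int_le_half[of x] by (auto simp: y_def dist_int_def)
  have "unit_exp x = unit_exp (y + real_of_int (round x))" by (simp add: y_def)
  also have "\<dots> = cis (2 * (pi * y))" unfolding unit_exp_add unit_exp_of_int by (simp add: unit_exp_cis mult_ac)
  finally have e: "unit_exp x = cis (2 * (pi * y))" .
  have "norm (unit_exp x - 1) ^ 2 = (cos (2 * (pi * y)) - 1)\<^sup>2 + (sin (2 * (pi * y)))\<^sup>2"
    unfolding e cmod_power2 by simp
  also have "\<dots> = 2 - 2 * cos (2 * (pi * y))"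
    using sin_cos_squared_add[of "2 * (pi * y)"] by (simp add: power2_eq_square algebra_simps)
  also have "\<dots> = (2 * sin (pi * y))\<^sup>2"
    by (simp add: cos_double_sin power2_eq_square)
  also have "\<dots> = (2 * sin (pi * \<bar>y\<bar>))\<^sup>2" by (cases "y \<ge> 0") auto
  finally have "norm (unit_exp x - 1) ^ 2 = (2 * sin (pi * \<bar>y\<bar>))\<^sup>2" .
  moreover have "2 * \<bar>y\<bar> \<le> sin (pi * \<bar>y\<bar>)" using y by (intro sin_ge_linear) auto
  then have "(4 * dist_int x)\<^sup>2 \<le> (2 * sin (pi * \<bar>y\<bar>))\<^sup>2" using y by (intro power_mono) auto
  ultimately have "(4 * dist_int x)\<^sup>2 \<le> norm (unit_exp x - 1) ^ 2" by simp
  then show ?thesis by (rule power2_le_imp_le) simp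
qed

lemma unit_exp_power: "unit_exp (real i * x) = unit_exp x ^ i"
  by (induction i) (simp_all add: distrib_right unit_exp_add)

lemma norm_geometric_le:
  assumes "dist_int x > 0"
  shows "norm (\<Sum>i<L. unit_exp (real i * x)) \<le> 1 / (2 * dist_int x)"
proof -
  let ?z = "unit_exp x"
  have n: "norm (?z - 1) \<ge> 4 * dist_int x" by (rule norm_unit_exp_minus_1)
  then have z: "?z \<noteq> 1" using assms by auto
  have "(\<Sum>i<L. unit_exp (real i * x)) = (\<Sum>i<L. ?z ^ i)" by (simp add: unit_exp_power)
  also have "\<dots> = (?z ^ L - 1) / (?z - 1)" by (rule geometric_sum[OF z])
  finally have "norm (\<Sum>i<L. unit_exp (real i * x)) = norm (?z ^ L - 1) / norm (?z - 1)" by (simp add: norm_divide)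
  also have "\<dots> \<le> 2 / norm (?z - 1)"
  proof (rule divide_right_mono)
    have "norm (?z ^ L - 1) \<le> norm (?z ^ L) + norm (1::complex)" by (rule norm_triangle_ineq4)
    also have "norm (?z ^ L) = 1" by (simp add: norm_power)
    finally show "norm (?z ^ L - 1) \<le> 2" by simp
  qed simp
  also have "\<dots> \<le> 2 / (4 * dist_int x)" using n assms by (intro frac_le) auto
  finally show ?thesis by simp
qed

lemma norm_geometric_trivial: "norm (\<Sum>i<L. unit_exp (real i * x)) \<le> real L"
proof -
  have "norm (\<Sum>i<L. unit_exp (real i * x)) \<le> (\<Sum>i<L. norm (unit_exp (real i * x)))" by (rule norm_sum)
  then show ?thesis by simp
qed

text \<open>This is \<open>min 1 (1 / (X * dist_int x)\<^sup>2)\<close> except that it is 1, not 0, at integers, where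
  \<open>1 / 0 = 0\<close>.\<close>

definition near_weight :: "real \<Rightarrow> real \<Rightarrow> real" where
  "near_weight X x = (if X * dist_int x \<le> 1 then 1 else 1 / (X * dist_int x)\<^sup>2)"

lemma near_weight_nonneg: "near_weight X x \<ge> 0"
  by (simp add: near_weight_def)

lemma norm_geometric_near:
  assumes "X \<ge> 1"
  shows "norm (\<Sum>i<2 * X. unit_exp (real i * x)) ^ 2 / real X \<le> 4 * real X * near_weight (real X) x"
proof (cases "real X * dist_int x \<le> 1")
  case True
  have "norm (\<Sum>i<2 * X. unit_exp (real i * x)) ^ 2 \<le> real (2 * X) ^ 2"
    by (intro power_mono norm_geometric_trivial) simp
  then show ?thesis using True assms by (simp add: near_weight_def field_simps power2_eq_square)
next
  case False
  then have d: "dist_int x > 0" using dist_int_nonneg[of x] by (cases "dist_int x = 0") auto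
  have "norm (\<Sum>i<2 * X. unit_exp (real i * x)) ^ 2 \<le> (1 / (2 * dist_int x)) ^ 2"
    by (intro power_mono norm_geometric_le d) simp
  also have "\<dots> \<le> (4 * real X * (1 / (real X * dist_int x)\<^sup>2)) * real X"
    using d assms by (simp add: field_simps power2_eq_square)
  finally show ?thesis using False assms by (simp add: near_weight_def field_simps)
qed

section \<open>The dual large sieve and Vinogradov's method\<close>

lemma sum_square_expand:
  "complex_of_real (norm (\<Sum>t\<in>T. f t) ^ 2) = (\<Sum>t\<in>T. \<Sum>t'\<in>T. f t * cnj (f t'))"
  unfolding complex_norm_square by (simp add: sum_product)

lemma sum_swap_last:
  "(\<Sum>i\<in>A. \<Sum>j\<in>B. \<Sum>u\<in>D. G i j u) = (\<Sum>u\<in>D. \<Sum>i\<in>A. \<Sum>j\<in>B. G i j u)"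
  by (rule trans[OF sum.cong[OF refl sum.swap] sum.swap])

lemma sum_swap_pairs:
  "(\<Sum>i\<in>A. \<Sum>j\<in>B. \<Sum>t\<in>C. \<Sum>u\<in>D. F i j t u) = (\<Sum>t\<in>C. \<Sum>u\<in>D. \<Sum>i\<in>A. \<Sum>j\<in>B. F i j t u)"
  by (rule trans[OF sum_swap_last sum.cong[OF refl sum_swap_last]])

text \<open>Every \<open>n\<close> with \<open>\<bar>n\<bar> <= X\<close> is a difference of two
  numbers below \<open>2 * X\<close> in at least \<open>X\<close> ways. Summing over all such pairs
  thus majorises the sum over \<open>n\<close>, and opening the square turns the kernel into the
  squared modulus of a geometric sum, of Fejer type.\<close>

lemma dual_large_sieve:
  fixes \<phi> :: "'t \<Rightarrow> real"
  assumes T: "finite T" and \<eta>: "\<And>t. t \<in> T \<Longrightarrow> norm (\<eta> t) \<le> 1" and X: "X \<ge> 1"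
  shows "(\<Sum>n\<in>{- int X..int X}. norm (\<Sum>t\<in>T. \<eta> t * unit_exp (real_of_int n * \<phi> t)) ^ 2)
    \<le> (\<Sum>t\<in>T. \<Sum>t'\<in>T. 4 * real X * near_weight (real X) (\<phi> t - \<phi> t'))"
proof -
  define S where "S n = norm (\<Sum>t\<in>T. \<eta> t * unit_exp (real_of_int n * \<phi> t)) ^ 2" for n :: int
  let ?D = "\<lambda>x. \<Sum>i<2 * X. unit_exp (real i * x)"
  \<comment> \<open>For each \<open>v < X\<close>, the pair with difference \<open>n\<close> and
    minimum \<open>v\<close>; both data can be read off, so the map is injective.\<close>
  define g where "g = (\<lambda>(n, v). if n \<ge> 0 then (nat (v + n), nat v) else (nat v, nat (v - n)))"
  let ?A = "{- int X..int X} \<times> {0..<int X}"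
  have gin: "g z \<in> {..<2 * X} \<times> {..<2 * X}" "int (fst (g z)) - int (snd (g z)) = fst z"
    "min (int (fst (g z))) (int (snd (g z))) = snd z" if "z \<in> ?A" for z
    using that by (auto simp: g_def split: prod.splits)
  have inj: "inj_on g ?A"
    by (rule inj_onI) (metis gin(2,3) prod_eq_iff)
  have "real X * (\<Sum>n\<in>{- int X..int X}. S n) = (\<Sum>z\<in>?A. S (fst z))"
  proof -
    have "(\<Sum>z\<in>?A. S (fst z)) = (\<Sum>n\<in>{- int X..int X}. \<Sum>v\<in>{0..<int X}. S n)"
      by (simp only: sum.cartesian_product split_def)
    then show ?thesis unfolding sum_distrib_left by simp
  qed
  also have "\<dots> = (\<Sum>z\<in>?A. S (int (fst (g z)) - int (snd (g z))))"
    by (intro sum.cong refl) (simp add: gin)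
  also have "\<dots> = (\<Sum>z\<in>g ` ?A. S (int (fst z) - int (snd z)))"
    by (simp add: sum.reindex[OF inj])
  also have "\<dots> \<le> (\<Sum>z\<in>{..<2 * X} \<times> {..<2 * X}. S (int (fst z) - int (snd z)))"
  proof (rule sum_mono2)
    show "g ` ?A \<subseteq> {..<2 * X} \<times> {..<2 * X}" using gin(1) by (rule image_subsetI)
  qed (auto simp: S_def)
  also have "\<dots> = (\<Sum>i<2 * X. \<Sum>i'<2 * X. S (int i - int i'))"
    by (simp add: sum.cartesian_product split_def)
  also have "\<dots> = norm (complex_of_real (\<Sum>i<2 * X. \<Sum>i'<2 * X. S (int i - int i')))"
    by (simp only: norm_of_real, rule abs_of_nonneg[symmetric]) (simp add: sum_nonneg S_def)
  also have "complex_of_real (\<Sum>i<2 * X. \<Sum>i'<2 * X. S (int i - int i'))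
      = (\<Sum>t\<in>T. \<Sum>t'\<in>T. \<eta> t * cnj (\<eta> t') * complex_of_real (norm (?D (\<phi> t - \<phi> t')) ^ 2))"
  proof -
    have "complex_of_real (S (int i - int i')) = (\<Sum>t\<in>T. \<Sum>t'\<in>T. \<eta> t * cnj (\<eta> t') *
        (unit_exp (real i * (\<phi> t - \<phi> t')) * cnj (unit_exp (real i' * (\<phi> t - \<phi> t')))))" for i i'
      unfolding S_def sum_square_expand
      by (intro sum.cong refl) (simp add: algebra_simps unit_exp_add unit_exp_diff)
    then have "complex_of_real (\<Sum>i<2 * X. \<Sum>i'<2 * X. S (int i - int i'))
       = (\<Sum>i<2 * X. \<Sum>i'<2 * X. \<Sum>t\<in>T. \<Sum>t'\<in>T. \<eta> t * cnj (\<eta> t') *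
        (unit_exp (real i * (\<phi> t - \<phi> t')) * cnj (unit_exp (real i' * (\<phi> t - \<phi> t')))))" by simp
    also have "\<dots> = (\<Sum>t\<in>T. \<Sum>t'\<in>T. \<Sum>i<2 * X. \<Sum>i'<2 * X. \<eta> t * cnj (\<eta> t') *
        (unit_exp (real i * (\<phi> t - \<phi> t')) * cnj (unit_exp (real i' * (\<phi> t - \<phi> t')))))"
      by (rule sum_swap_pairs)
    finally show ?thesis by (simp only: sum_square_expand sum_distrib_left)
  qed
  also have "norm \<dots> \<le> (\<Sum>t\<in>T. \<Sum>t'\<in>T. norm (?D (\<phi> t - \<phi> t')) ^ 2)"
  proof (intro order.trans[OF norm_sum] sum_mono)
    fix t t' assume "t \<in> T" "t' \<in> T"
    then have "norm (\<eta> t) * norm (\<eta> t') \<le> 1 * 1" by (intro mult_mono \<eta>) auto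
    then have "norm (\<eta> t) * norm (\<eta> t') * norm (?D (\<phi> t - \<phi> t')) ^ 2 \<le> 1 * norm (?D (\<phi> t - \<phi> t')) ^ 2"
      by (intro mult_right_mono) auto
    then show "norm (\<eta> t * cnj (\<eta> t') * complex_of_real (norm (?D (\<phi> t - \<phi> t')) ^ 2)) \<le> norm (?D (\<phi> t - \<phi> t')) ^ 2"
      by (simp add: norm_mult norm_power)
  qed
  finally have "(\<Sum>n\<in>{- int X..int X}. S n) \<le> (\<Sum>t\<in>T. \<Sum>t'\<in>T. norm (?D (\<phi> t - \<phi> t')) ^ 2 / real X)"
    using X by (simp add: field_simps flip: sum_divide_distrib)
  also have "\<dots> \<le> (\<Sum>t\<in>T. \<Sum>t'\<in>T. 4 * real X * near_weight (real X) (\<phi> t - \<phi> t'))"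
    by (intro sum_mono norm_geometric_near X)
  finally show ?thesis by (simp add: S_def)
qed

lemma sum_power_mean:
  fixes x :: "'t \<Rightarrow> real"
  assumes T: "finite T" and x: "\<And>t. t \<in> T \<Longrightarrow> x t \<ge> 0" and s: "s \<ge> 1"
  shows "(\<Sum>t\<in>T. x t) ^ s \<le> real (card T) ^ (s - 1) * (\<Sum>t\<in>T. x t ^ s)"
proof (cases "s = 1")
  case False
  then have s2: "s \<ge> 2" using s by simp
  let ?S = "\<Sum>t\<in>T. x t ^ s"
  have S0: "?S \<ge> 0" using x by (simp add: sum_nonneg)
  have "(\<Sum>t\<in>T. x t) = (\<Sum>t\<in>T. (x t ^ s) powr (1 / real s) * 1 powr (1 - 1 / real s))"
    using x s by (intro sum.cong refl) (simp add: power_powr_inverse)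
  also have "\<dots> \<le> ?S powr (1 / real s) * (\<Sum>t\<in>T. 1) powr (1 - 1 / real s)"
    by (rule holder_two) (use x s2 in auto)
  finally have "(\<Sum>t\<in>T. x t) ^ s \<le> (?S powr (1 / real s) * real (card T) powr (1 - 1 / real s)) ^ s"
    using x by (intro power_mono) (auto intro: sum_nonneg)
  also have "\<dots> = ?S * (real (card T) powr (1 - 1 / real s)) ^ s"
    using S0 s by (simp only: power_mult_distrib powr_inverse_power)
  also have "(real (card T) powr (1 - 1 / real s)) ^ s = real (card T) ^ (s - 1)"
  proof (cases "card T = 0")
    case True then show ?thesis using s2 by (simp add: zero_power)
  next
    case False
    then have "(real (card T) powr (1 - 1 / real s)) ^ s = real (card T) powr ((1 - 1 / real s) * real s)"
      by (simp add: powr_powr flip: powr_realpow)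
    also have "(1 - 1 / real s) * real s = real (s - 1)" using s by (simp add: field_simps of_nat_diff)
    finally show ?thesis using False by (simp add: powr_realpow)
  qed
  finally show ?thesis by (simp add: mult.commute)
qed simp

text \<open>The \<open>s\<close>-th powers are expanded over tuples and grouped by their vectors of
  power sums. Cauchy-Schwarz separates the squares of the multiplicities, which count the Vinogradov
  system, from a sum over the box of power sums. There only the coordinate of degree
  \<open>K\<close> is exploited; the lower ones are counted trivially.\<close>

lemma box_large_sieve:
  fixes c :: "'t \<Rightarrow> nat \<Rightarrow> real" and a :: "int \<Rightarrow> complex"
  assumes T: "finite T" and K: "K \<ge> 1" and s: "s \<ge> 1" and M: "M \<ge> 1" and a: "\<And>m. norm (a m) \<le> 1"
  defines "h \<equiv> \<lambda>t. \<Sum>m\<in>{- int M<..<int M}. a m * unit_exp (\<Sum>j\<in>{1..K}. c t j * real_of_int m ^ j)"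
    and "X \<equiv> s * M ^ K"
  shows "(\<Sum>t\<in>T. norm (h t) ^ s) ^ 2 \<le> real (card (vinogradov_pairs K s {- int M<..<int M}))
    * (real (\<Prod>j\<in>{1..<K}. 2 * (s * M ^ j) + 1)
        * (\<Sum>t\<in>T. \<Sum>t'\<in>T. 4 * real X * near_weight (real X) (c t K - c t' K)))"
proof -
  define I where "I = {- int M<..<int M}"
  have I: "finite I" by (simp add: I_def)
  \<comment> \<open>The conjugate sign linearises the modulus: \<open>\<eta> t * h t ^ s\<close> is
    \<open>norm (h t) ^ s\<close>.\<close>
  define \<eta> where "\<eta> t = cnj (sgn (h t ^ s))" for t
  have \<eta>: "norm (\<eta> t) \<le> 1" for t by (simp add: \<eta>_def norm_sgn)
  have \<eta>h: "\<eta> t * h t ^ s = complex_of_real (norm (h t) ^ s)" for t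
  proof (cases "h t = 0")
    case True then show ?thesis using s by (simp add: zero_power)
  next
    case False
    have "cnj (sgn z) * z = complex_of_real (norm z)" for z :: complex
      by (cases "z = 0") (simp_all add: sgn_eq complex_norm_square[symmetric] mult.commute power2_eq_square)
    then show ?thesis by (simp add: \<eta>_def norm_power)
  qed
  define V where "V N = (\<Sum>t\<in>T. \<eta> t * unit_exp (\<Sum>j\<in>{1..K}. c t j * real_of_int (N j)))" for N :: "nat \<Rightarrow> int"
  define N where "N x = (\<lambda>j\<in>{1..K}. \<Sum>i<s. x i ^ j)" for x :: "nat \<Rightarrow> int"
  define Bx where "Bx = (\<lambda>j. {- int (s * M ^ j)..int (s * M ^ j)})"
  define B where "B = PiE {1..K} Bx"
  have finB: "finite B" by (simp add: B_def Bx_def finite_PiE)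
  have NB: "N x \<in> B" if "x \<in> tuples s I" for x
  proof -
    have "\<bar>\<Sum>i<s. x i ^ j\<bar> \<le> int (s * M ^ j)" for j
    proof -
      have "\<bar>\<Sum>i<s. x i ^ j\<bar> \<le> (\<Sum>i<s. \<bar>x i ^ j\<bar>)" by (rule sum_abs)
      also have "\<dots> \<le> (\<Sum>i<s. int M ^ j)"
      proof (intro sum_mono)
        fix i assume "i \<in> {..<s}"
        then have "x i \<in> I" using that by (auto simp: tuples_def)
        then have "\<bar>x i\<bar> \<le> int M" by (auto simp: I_def)
        then show "\<bar>x i ^ j\<bar> \<le> int M ^ j" unfolding power_abs by (intro power_mono) auto
      qed
      finally show ?thesis by simp
    qed
    then have "(\<Sum>i<s. x i ^ j) \<in> Bx j" for j
      unfolding Bx_def atLeastAtMost_iff by (meson abs_le_iff minus_le_iff)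
    then show ?thesis unfolding B_def N_def restrict_PiE_iff by blast
  qed
  have hp: "h t ^ s = (\<Sum>x\<in>tuples s I. (\<Prod>i<s. a (x i)) * unit_exp (\<Sum>j\<in>{1..K}. c t j * real_of_int (N x j)))" for t
  proof -
    have e: "(\<Prod>i<s. unit_exp (\<Sum>j\<in>{1..K}. c t j * real_of_int (x i) ^ j)) = unit_exp (\<Sum>j\<in>{1..K}. c t j * real_of_int (N x j))" for x
    proof -
      have "(\<Sum>i<s. \<Sum>j\<in>{1..K}. c t j * real_of_int (x i) ^ j) = (\<Sum>j\<in>{1..K}. c t j * real_of_int (N x j))"
        by (subst sum.swap) (simp add: N_def sum_distrib_left)
      then show ?thesis by (simp only: unit_exp_sum[symmetric])
    qed
    show ?thesis unfolding h_def I_def[symmetric] sum_power_tuples[OF I] prod.distrib e ..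
  qed
  have "complex_of_real (\<Sum>t\<in>T. norm (h t) ^ s) = (\<Sum>t\<in>T. \<eta> t * h t ^ s)" by (simp only: \<eta>h of_real_sum)
  also have "\<dots> = (\<Sum>t\<in>T. \<Sum>x\<in>tuples s I. (\<Prod>i<s. a (x i)) * (\<eta> t * unit_exp (\<Sum>j\<in>{1..K}. c t j * real_of_int (N x j))))"
    unfolding hp sum_distrib_left by (simp only: mult_ac)
  also have "\<dots> = (\<Sum>x\<in>tuples s I. (\<Prod>i<s. a (x i)) * V (N x))"
    unfolding V_def sum_distrib_left by (rule sum.swap)
  finally have "norm (complex_of_real (\<Sum>t\<in>T. norm (h t) ^ s)) = norm (\<Sum>x\<in>tuples s I. (\<Prod>i<s. a (x i)) * V (N x))" by simp
  then have "(\<Sum>t\<in>T. norm (h t) ^ s) = norm (\<Sum>x\<in>tuples s I. (\<Prod>i<s. a (x i)) * V (N x))"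
    unfolding norm_of_real by (simp add: sum_nonneg)
  also have "\<dots> \<le> (\<Sum>x\<in>tuples s I. norm (V (N x)))"
  proof (intro order.trans[OF norm_sum] sum_mono)
    fix x
    have "norm (\<Prod>i<s. a (x i)) \<le> (\<Prod>i<s. 1)" unfolding prod_norm[symmetric] using a by (intro prod_mono) auto
    then show "norm ((\<Prod>i<s. a (x i)) * V (N x)) \<le> norm (V (N x))"
      by (simp add: norm_mult mult_left_le_one_le)
  qed
  also have "\<dots> = (\<Sum>n\<in>B. \<Sum>x\<in>{x \<in> tuples s I. N x = n}. norm (V (N x)))"
    using NB by (intro sum.group[symmetric] finite_tuples I finB) auto
  also have "\<dots> = (\<Sum>n\<in>B. real (card {x \<in> tuples s I. N x = n}) * norm (V n))" by simp
  finally have "(\<Sum>t\<in>T. norm (h t) ^ s) ^ 2 \<le> (\<Sum>n\<in>B. real (card {x \<in> tuples s I. N x = n}) * norm (V n)) ^ 2"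
    by (intro power_mono sum_nonneg) auto
  also have "\<dots> \<le> (\<Sum>n\<in>B. real (card {x \<in> tuples s I. N x = n}) ^ 2) * (\<Sum>n\<in>B. norm (V n) ^ 2)"
    by (rule Cauchy_Schwarz_ineq_sum)
  also have "(\<Sum>n\<in>B. real (card {x \<in> tuples s I. N x = n}) ^ 2) = real (card (vinogradov_pairs K s I))"
  proof -
    have "(\<Sum>n\<in>B. card {x \<in> tuples s I. N x = n} ^ 2) = (\<Sum>n\<in>B. \<Sum>x\<in>{x \<in> tuples s I. N x = n}. card {y \<in> tuples s I. N x = N y})"
    proof (rule sum.cong[OF refl])
      fix n
      have "(\<Sum>x\<in>{x \<in> tuples s I. N x = n}. card {y \<in> tuples s I. N x = N y})
          = (\<Sum>x\<in>{x \<in> tuples s I. N x = n}. card {y \<in> tuples s I. N y = n})"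
        by (intro sum.cong refl arg_cong[where f = card]) auto
      then show "card {x \<in> tuples s I. N x = n} ^ 2 = (\<Sum>x\<in>{x \<in> tuples s I. N x = n}. card {y \<in> tuples s I. N x = N y})"
        unfolding power2_eq_square by (simp only: sum_constant of_nat_id)
    qed
    also have "\<dots> = (\<Sum>x\<in>tuples s I. card {y \<in> tuples s I. N x = N y})"
      using NB by (intro sum.group finite_tuples I finB) auto
    also have "\<dots> = card (Sigma (tuples s I) (\<lambda>x. {y \<in> tuples s I. N x = N y}))"
      using I by (subst card_SigmaI) auto
    also have "Sigma (tuples s I) (\<lambda>x. {y \<in> tuples s I. N x = N y}) = vinogradov_pairs K s I"
    proof -
      have "N x = N y \<longleftrightarrow> (\<forall>j\<in>{1..K}. (\<Sum>i<s. x i ^ j) = (\<Sum>i<s. y i ^ j))" for x y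
        unfolding N_def restrict_def fun_eq_iff by auto
      then show ?thesis by (auto simp: vinogradov_pairs_def)
    qed
    finally have "real (\<Sum>n\<in>B. card {x \<in> tuples s I. N x = n} ^ 2) = real (card (vinogradov_pairs K s I))" by simp
    then show ?thesis by simp
  qed
  also have "(\<Sum>n\<in>B. norm (V n) ^ 2) \<le> real (\<Prod>j\<in>{1..<K}. 2 * (s * M ^ j) + 1)
        * (\<Sum>t\<in>T. \<Sum>t'\<in>T. 4 * real X * near_weight (real X) (c t K - c t' K))"
  proof -
    let ?B' = "PiE {1..<K} Bx"
    have ins: "{1..K} = insert K {1..<K}" using K by auto
    have "(\<Sum>n\<in>B. norm (V n) ^ 2) = (\<Sum>z\<in>Bx K \<times> ?B'. norm (V ((snd z)(K := fst z))) ^ 2)"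
      unfolding B_def ins PiE_insert_eq
      by (subst sum.reindex[OF inj_combinator]) (auto simp: split_def o_def)
    also have "\<dots> = (\<Sum>g\<in>?B'. \<Sum>n\<in>Bx K. norm (V (g(K := n))) ^ 2)"
      by (subst sum.swap) (simp add: sum.cartesian_product split_def)
    also have "\<dots> \<le> (\<Sum>g\<in>?B'. \<Sum>t\<in>T. \<Sum>t'\<in>T. 4 * real X * near_weight (real X) (c t K - c t' K))"
    proof (rule sum_mono)
      fix g
      \<comment> \<open>With the lower coordinates fixed, their phases join the unimodular weights,
        and the dual large sieve applies to the last one.\<close>
      define \<eta>' where "\<eta>' t = \<eta> t * unit_exp (\<Sum>j\<in>{1..<K}. c t j * real_of_int (g j))" for t
      have "V (g(K := n)) = (\<Sum>t\<in>T. \<eta>' t * unit_exp (real_of_int n * c t K))" for n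
      proof -
        have "(\<Sum>j\<in>{1..K}. c t j * real_of_int ((g(K := n)) j)) = (\<Sum>j\<in>{1..<K}. c t j * real_of_int (g j)) + real_of_int n * c t K" for t
          unfolding ins by (subst sum.insert) (auto simp: mult.commute intro!: sum.cong)
        then show ?thesis unfolding V_def \<eta>'_def by (simp only: unit_exp_add mult.assoc)
      qed
      moreover have "(\<Sum>n\<in>{- int X..int X}. norm (\<Sum>t\<in>T. \<eta>' t * unit_exp (real_of_int n * c t K)) ^ 2)
          \<le> (\<Sum>t\<in>T. \<Sum>t'\<in>T. 4 * real X * near_weight (real X) (c t K - c t' K))"
        by (rule dual_large_sieve[OF T]) (use \<eta> s M in \<open>auto simp: \<eta>'_def norm_mult X_def Suc_le_eq\<close>)
      ultimately show "(\<Sum>n\<in>Bx K. norm (V (g(K := n))) ^ 2) \<le> (\<Sum>t\<in>T. \<Sum>t'\<in>T. 4 * real X * near_weight (real X) (c t K - c t' K))"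
        by (simp only: Bx_def X_def)
    qed
    also have "\<dots> = real (card ?B') * (\<Sum>t\<in>T. \<Sum>t'\<in>T. 4 * real X * near_weight (real X) (c t K - c t' K))" by simp
    also have "card ?B' = (\<Prod>j\<in>{1..<K}. 2 * (s * M ^ j) + 1)"
      by (subst card_PiE) (auto simp: Bx_def nat_add_distrib nat_mult_distrib nat_power_eq intro!: prod.cong)
    finally show ?thesis .
  qed
  finally show ?thesis unfolding I_def by (simp add: mult_left_mono)
qed

section \<open>Completion: expressing a sharp cutoff through additive characters\<close>

lemma unit_exp_sum_mod:
  assumes R: "R \<ge> 1"
  shows "(\<Sum>\<nu><R. unit_exp (real \<nu> * (real_of_int z / real R))) = (if int R dvd z then of_nat R else 0)"
proof (cases "int R dvd z")
  case True
  then obtain w where "z = int R * w" by (elim dvdE)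
  then have "real \<nu> * (real_of_int z / real R) = real_of_int (int \<nu> * w)" for \<nu>
    using R by simp
  then show ?thesis using True by (simp only: unit_exp_of_int) simp
next
  case False
  let ?x = "unit_exp (real_of_int z / real R)"
  have "?x \<noteq> 1"
  proof
    assume "?x = 1"
    then obtain w where "real_of_int z / real R = real_of_int w" unfolding unit_exp_eq_1_iff by (auto elim: Ints_cases)
    then have "real_of_int z = real_of_int (int R * w)" using R by (simp add: field_simps)
    then have "z = int R * w" by (simp only: of_int_eq_iff)
    then show False using False by simp
  qed
  moreover have "?x ^ R = 1"
    unfolding unit_exp_power[symmetric] using R by simp
  ultimately have "(\<Sum>\<nu><R. ?x ^ \<nu>) = 0" by (simp add: geometric_sum)
  then show ?thesis using False by (simp only: unit_exp_power if_False)
qed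

definition dft_coeff :: "nat \<Rightarrow> nat \<Rightarrow> complex" where
  "dft_coeff M \<nu> = (\<Sum>i<M. unit_exp (- (real i * (real \<nu> / real (3 * M)))))"

text \<open>Fourier inversion modulo \<open>3 * M\<close>. For \<open>t < M\<close> and
  \<open>\<bar>m\<bar> < M\<close> the argument \<open>t + m\<close> lies strictly between
  \<open>- M\<close> and \<open>2 * M\<close>, so a period of \<open>3 * M\<close> avoids
  wraparound.\<close>

lemma indicator_dft:
  fixes n :: int
  assumes M: "M \<ge> 1" and n: "- int M < n" "n < 2 * int M"
  shows "(\<Sum>\<nu><3 * M. dft_coeff M \<nu> * unit_exp (real \<nu> * real_of_int n / real (3 * M)))
    = (if 0 \<le> n \<and> n < int M then of_nat (3 * M) else 0)"
proof -
  have "(\<Sum>\<nu><3 * M. dft_coeff M \<nu> * unit_exp (real \<nu> * real_of_int n / real (3 * M)))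
     = (\<Sum>\<nu><3 * M. \<Sum>i<M. unit_exp (real \<nu> * (real_of_int (n - int i) / real (3 * M))))"
    unfolding dft_coeff_def sum_distrib_right unit_exp_add[symmetric]
    by (intro sum.cong refl arg_cong[where f = unit_exp]) (use M in \<open>simp add: field_simps\<close>)
  also have "\<dots> = (\<Sum>i<M. \<Sum>\<nu><3 * M. unit_exp (real \<nu> * (real_of_int (n - int i) / real (3 * M))))"
    by (rule sum.swap)
  also have "\<dots> = (\<Sum>i<M. if int (3 * M) dvd n - int i then of_nat (3 * M) else 0)"
    using M by (intro sum.cong refl unit_exp_sum_mod) auto
  also have "\<dots> = (\<Sum>i<M. if i = nat n \<and> n \<ge> 0 then of_nat (3 * M) else 0)"
  proof (intro sum.cong refl)
    fix i assume i: "i \<in> {..<M}"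
    have "int (3 * M) dvd n - int i \<longleftrightarrow> n = int i"
    proof
      assume "int (3 * M) dvd n - int i"
      moreover have "\<bar>n - int i\<bar> < int (3 * M)" using i n by auto
      ultimately show "n = int i" using dvd_imp_le_int[of "n - int i" "int (3 * M)"] by linarith
    qed simp
    moreover have "n = int i \<longleftrightarrow> i = nat n \<and> n \<ge> 0" by auto
    ultimately show "(if int (3 * M) dvd n - int i then of_nat (3 * M) else 0)
       = (if i = nat n \<and> n \<ge> 0 then of_nat (3 * M) else (0::complex))" by simp
  qed
  also have "\<dots> = (if 0 \<le> n \<and> n < int M then of_nat (3 * M) else 0)"
  proof (cases "n \<ge> 0")
    case True
    then have "nat n < M \<longleftrightarrow> n < int M" by auto
    then show ?thesis using True by (simp add: sum.delta)
  qed simp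
  finally show ?thesis .
qed

lemma harm_le_ln: "n \<ge> 1 \<Longrightarrow> harm n \<le> 1 + ln (real n)"
proof -
  assume n: "n \<ge> 1"
  have "harm (Suc (n - 1)) - ln (real (Suc (n - 1))) \<le> harm (Suc 0) - ln (real (Suc 0))"
    by (rule decseqD[OF decseq_harm_diff_ln]) simp
  then show ?thesis using n by (simp add: harm_def)
qed

text \<open>The Dirichlet kernel has \<open>L1\<close> norm of logarithmic size: each nonzero
  frequency is bounded by a geometric sum, and the distances to the nearest integer sum to a
  harmonic series from either end.\<close>

lemma sum_norm_dft_coeff:
  assumes M: "M \<ge> 1"
  shows "(\<Sum>\<nu><3 * M. norm (dft_coeff M \<nu>)) \<le> real (3 * M) * (2 + ln (real (3 * M)))"
proof -
  let ?R = "3 * M"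
  have R: "?R \<ge> 1" using M by simp
  have b: "norm (dft_coeff M \<nu>) \<le> (real ?R / real \<nu> + real ?R / real (?R - \<nu>)) / 2" if "\<nu> \<in> {1..<?R}" for \<nu>
  proof -
    let ?x = "real \<nu> / real ?R"
    have n: "0 < \<nu>" "\<nu> < ?R" using that by auto
    have d: "min ?x (1 - ?x) \<le> dist_int ?x"
    proof -
      define z where "z = round ?x"
      have x1: "?x > 0" "?x < 1" using n by auto
      have "z \<le> 0 \<or> z \<ge> 1" by linarith
      then have "\<bar>?x - real_of_int z\<bar> \<ge> min ?x (1 - ?x)"
      proof
        assume "z \<le> 0"
        then have "real_of_int z \<le> 0" by simp
        then show ?thesis using x1 by linarith
      next
        assume "z \<ge> 1"
        then have "real_of_int z \<ge> 1" by simp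
        then show ?thesis using x1 by linarith
      qed
      then show ?thesis by (simp add: dist_int_def z_def)
    qed
    have p: "?x > 0" "1 - ?x > 0" using n by auto
    then have d0: "dist_int ?x > 0" using d by linarith
    have "norm (dft_coeff M \<nu>) = norm (cnj (\<Sum>i<M. unit_exp (real i * ?x)))"
      unfolding dft_coeff_def by (simp add: unit_exp_minus)
    also have "\<dots> = norm (\<Sum>i<M. unit_exp (real i * ?x))" by (rule complex_mod_cnj)
    also have "\<dots> \<le> 1 / (2 * dist_int ?x)" by (rule norm_geometric_le[OF d0])
    also have "\<dots> \<le> 1 / (2 * min ?x (1 - ?x))" using d p d0 by (intro divide_left_mono) auto
    also have "\<dots> \<le> (1 / ?x + 1 / (1 - ?x)) / 2"
    proof -
      have "1 / (2 * min y z) \<le> (1 / y + 1 / z) / 2" if "y > 0" "z > 0" for y z :: real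
        using that divide_pos_pos[of 1 y] divide_pos_pos[of 1 z]
        by (auto simp: min_def field_simps)
      then show ?thesis using p by blast
    qed
    also have "1 / (1 - ?x) = real ?R / real (?R - \<nu>)" using n by (simp add: of_nat_diff field_simps)
    finally show ?thesis by simp
  qed
  have sh: "(\<Sum>\<nu>\<in>{1..<?R}. 1 / real \<nu>) \<le> harm ?R"
    unfolding harm_def inverse_eq_divide by (rule sum_mono2) auto
  have "(\<Sum>\<nu>\<in>{1..<?R}. norm (dft_coeff M \<nu>)) \<le> (\<Sum>\<nu>\<in>{1..<?R}. (real ?R / real \<nu> + real ?R / real (?R - \<nu>)) / 2)"
    by (intro sum_mono b)
  also have "\<dots> = ((\<Sum>\<nu>\<in>{1..<?R}. real ?R / real \<nu>) + (\<Sum>\<nu>\<in>{1..<?R}. real ?R / real (?R - \<nu>))) / 2"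
    by (simp only: sum.distrib flip: sum_divide_distrib)
  also have "(\<Sum>\<nu>\<in>{1..<?R}. real ?R / real (?R - \<nu>)) = (\<Sum>\<nu>\<in>{1..<?R}. real ?R / real \<nu>)"
    by (rule sum.reindex_bij_witness[of _ "\<lambda>\<nu>. ?R - \<nu>" "\<lambda>\<nu>. ?R - \<nu>"]) auto
  also have "((\<Sum>\<nu>\<in>{1..<?R}. real ?R / real \<nu>) + (\<Sum>\<nu>\<in>{1..<?R}. real ?R / real \<nu>)) / 2 = real ?R * (\<Sum>\<nu>\<in>{1..<?R}. 1 / real \<nu>)"
  proof -
    have "(x + x) / 2 = x" for x :: real by simp
    then show ?thesis by (simp only: sum_distrib_left times_divide_eq_right mult_1_right)
  qed
  also have "\<dots> \<le> real ?R * (1 + ln (real ?R))"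
    using order.trans[OF sh harm_le_ln[OF R]] by (intro mult_left_mono) auto
  finally have 1: "(\<Sum>\<nu>\<in>{1..<?R}. norm (dft_coeff M \<nu>)) \<le> real ?R * (1 + ln (real ?R))" .
  have "norm (dft_coeff M 0) \<le> real ?R" by (simp add: dft_coeff_def)
  moreover have "(\<Sum>\<nu><?R. norm (dft_coeff M \<nu>)) = norm (dft_coeff M 0) + (\<Sum>\<nu>\<in>{1..<?R}. norm (dft_coeff M \<nu>))"
    using R by (simp add: lessThan_atLeast0 sum.atLeast_Suc_lessThan)
  ultimately show ?thesis using 1 by (simp add: algebra_simps)
qed

lemma coeff_pcompose_linear:
  fixes f :: "real poly"
  assumes "degree f \<le> n"
  shows "coeff (pcompose f [:b, c:]) j = (\<Sum>i\<in>{j..n}. coeff f i * real (i choose j) * c ^ j * b ^ (i - j))"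
proof -
  have "poly (pcompose f [:b, c:]) x = poly (\<Sum>i\<le>n. smult (coeff f i) ([:b, c:] ^ i)) x" for x
    by (simp add: poly_pcompose poly_eq_sum_le[OF assms] poly_sum poly_power)
  then have eq: "pcompose f [:b, c:] = (\<Sum>i\<le>n. smult (coeff f i) ([:b, c:] ^ i))"
    by (simp add: poly_eq_poly_eq_iff[symmetric] fun_eq_iff)
  have "coeff (pcompose f [:b, c:]) j = (\<Sum>i\<le>n. coeff f i * coeff ([:b, c:] ^ i) j)"
    by (simp add: eq coeff_sum)
  also have "\<dots> = (\<Sum>i\<in>{j..n}. coeff f i * coeff ([:b, c:] ^ i) j)"
  proof (rule sum.mono_neutral_right)
    show "\<forall>i\<in>{..n} - {j..n}. coeff f i * coeff ([:b, c:] ^ i) j = 0"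
    proof
      fix i assume "i \<in> {..n} - {j..n}"
      then have "i < j" by auto
      moreover have "degree ([:b, c:] ^ i) \<le> i" by (rule order.trans[OF degree_power_le]) simp
      ultimately show "coeff f i * coeff ([:b, c:] ^ i) j = 0" by (simp add: coeff_eq_0)
    qed
  qed auto
  also have "\<dots> = (\<Sum>i\<in>{j..n}. coeff f i * real (i choose j) * c ^ j * b ^ (i - j))"
    by (intro sum.cong refl) (simp add: coeff_linear_poly_power)
  finally show ?thesis .
qed

text \<open>The exponent count behind \<open>weyl_window\<close>: the trivially counted coordinates
  and the sieved one together contribute \<open>M ^ critical K\<close>.\<close>

lemma sum_1_less: "(\<Sum>j\<in>{1..<K}. j) + K = critical K"
proof (induction K)
  case (Suc K)
  have "critical (Suc K) = critical K + Suc K" by (simp add: critical_def)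
  then show ?case using Suc by (cases "K = 0") (auto simp: atLeastLessThanSuc)
qed (simp add: critical_def)

lemma prod_box_le:
  assumes "s \<ge> 1" "M \<ge> 1"
  shows "real (\<Prod>j\<in>{1..<K}. 2 * (s * M ^ j) + 1) \<le> (3 * real s) ^ (K - 1) * real M ^ (\<Sum>j\<in>{1..<K}. j)"
proof -
  have "real (\<Prod>j\<in>{1..<K}. 2 * (s * M ^ j) + 1) \<le> (\<Prod>j\<in>{1..<K}. 3 * real s * real M ^ j)"
    unfolding of_nat_prod
  proof (intro prod_mono conjI)
    fix j
    have "s * M ^ j \<ge> 1" using assms by (simp add: Suc_le_eq)
    then have "real (2 * (s * M ^ j) + 1) \<le> real (3 * (s * M ^ j))" by (intro of_nat_mono) simp
    then show "real (2 * (s * M ^ j) + 1) \<le> 3 * real s * real M ^ j" by simp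
  qed simp
  also have "\<dots> = (3 * real s) ^ (K - 1) * real M ^ (\<Sum>j\<in>{1..<K}. j)"
    by (simp add: prod.distrib power_sum)
  finally show ?thesis .
qed

text \<open>Shifting by \<open>t\<close> leaves the top coefficient unchanged and moves the
  coefficient of degree \<open>K\<close> linearly, with slope \<open>K + 1\<close> times the top
  one. The shifts thus provide spaced frequencies for the sieve. The exponent adds
  \<open>2 * s - 2\<close> from the power mean, \<open>s + \<epsilon>\<close> from the mean value
  and \<open>s\<close> from the box.\<close>

lemma weyl_window:
  assumes K: "K \<ge> 1" and \<epsilon>: "\<epsilon> > 0"
  shows "\<exists>C>0. \<forall>G M. M \<ge> 1 \<longrightarrow> degree G \<le> K + 1 \<longrightarrow>
    (\<Sum>t<M. norm (\<Sum>m\<in>{- int M<..<int M}. unit_exp (poly G (real t + real_of_int m)))) ^ (2 * critical K)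
    \<le> C * real M powr (4 * real (critical K) - 2 + \<epsilon>)
      * (\<Sum>t<M. \<Sum>t'<M. near_weight (real (critical K * M ^ K)) (real (K + 1) * coeff G (K + 1) * (real t - real t')))"
proof -
  let ?s = "critical K"
  have s: "?s \<ge> 1" by (rule critical_pos[OF K])
  obtain C0 where C0: "C0 > 0" "\<And>M. M \<ge> 1 \<Longrightarrow> real (card (vinogradov_pairs K ?s {- int M<..<int M})) \<le> C0 * real M powr (real ?s + \<epsilon>)"
    using vinogradov_mean_value[OF K \<epsilon>] by blast
  define C where "C = C0 * (3 * real ?s) ^ (K - 1) * (4 * real ?s)"
  show ?thesis
  proof (intro exI[of _ C] conjI allI impI)
    show "C > 0" using C0 s by (simp add: C_def)
    fix G :: "real poly" and M :: nat
    assume M: "M \<ge> 1" and G: "degree G \<le> K + 1"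
    let ?I = "{- int M<..<int M}"
    let ?E = "\<lambda>t. norm (\<Sum>m\<in>?I. unit_exp (poly G (real t + real_of_int m)))"
    define c where "c t j = coeff (pcompose G [:real t, 1:]) j" for t j
    \<comment> \<open>The top degree term does not depend on \<open>t\<close>, so it can be hidden
      in the unimodular weights common to all \<open>t\<close>.\<close>
    define a where "a m = unit_exp (coeff G (K + 1) * real_of_int m ^ (K + 1))" for m
    define h where "h t = (\<Sum>m\<in>?I. a m * unit_exp (\<Sum>j\<in>{1..K}. c t j * real_of_int m ^ j))" for t
    have cK1: "c t (K + 1) = coeff G (K + 1)" for t
      unfolding c_def coeff_pcompose_linear[OF G] by simp
    have cK: "c t K = coeff G K + real (K + 1) * coeff G (K + 1) * real t" for t
      unfolding c_def coeff_pcompose_linear[OF G] by (simp add: sum.atLeast_Suc_atMost)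
    have Eh: "?E t = norm (h t)" for t
    proof -
      have deg: "degree (pcompose G [:real t, 1:]) \<le> K + 1" using G by (simp add: degree_pcompose)
      have "poly G (real t + real_of_int m) = coeff G (K + 1) * real_of_int m ^ (K + 1) + (\<Sum>j\<in>{1..K}. c t j * real_of_int m ^ j) + c t 0" for m
      proof -
        have "poly G (real t + real_of_int m) = poly (pcompose G [:real t, 1:]) (real_of_int m)" by (simp add: poly_pcompose)
        also have "\<dots> = (\<Sum>j\<le>K + 1. c t j * real_of_int m ^ j)" unfolding c_def by (rule poly_eq_sum_le[OF deg])
        also have "{..K + 1} = insert (K + 1) (insert 0 {1..K})" by auto
        also have "(\<Sum>j\<in>\<dots>. c t j * real_of_int m ^ j) = coeff G (K + 1) * real_of_int m ^ (K + 1) + (\<Sum>j\<in>{1..K}. c t j * real_of_int m ^ j) + c t 0"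
          by (subst sum.insert; simp)+ (simp add: cK1[simplified])
        finally show ?thesis .
      qed
      then have "(\<Sum>m\<in>?I. unit_exp (poly G (real t + real_of_int m))) = h t * unit_exp (c t 0)"
        unfolding h_def a_def sum_distrib_right by (simp only: unit_exp_add)
      then show ?thesis by (simp add: norm_mult)
    qed
    let ?S = "\<Sum>t<M. \<Sum>t'<M. near_weight (real (?s * M ^ K)) (real (K + 1) * coeff G (K + 1) * (real t - real t'))"
    have S0: "?S \<ge> 0" by (intro sum_nonneg near_weight_nonneg)
    have cd: "c t K - c t' K = real (K + 1) * coeff G (K + 1) * (real t - real t')" for t t'
      unfolding cK by (simp add: right_diff_distrib)
    have "(\<Sum>t<M. norm (h t) ^ ?s) ^ 2 \<le> real (card (vinogradov_pairs K ?s ?I)) * (real (\<Prod>j\<in>{1..<K}. 2 * (?s * M ^ j) + 1)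
        * (\<Sum>t<M. \<Sum>t'<M. 4 * real (?s * M ^ K) * near_weight (real (?s * M ^ K)) (c t K - c t' K)))"
      unfolding h_def by (rule box_large_sieve) (use K s M in \<open>auto simp: a_def\<close>)
    also have "(\<Sum>t<M. \<Sum>t'<M. 4 * real (?s * M ^ K) * near_weight (real (?s * M ^ K)) (c t K - c t' K)) = 4 * real ?s * real M ^ K * ?S"
      unfolding cd sum_distrib_left[symmetric] by simp
    also have "real (card (vinogradov_pairs K ?s ?I)) * (real (\<Prod>j\<in>{1..<K}. 2 * (?s * M ^ j) + 1) * (4 * real ?s * real M ^ K * ?S))
       \<le> (C0 * real M powr (real ?s + \<epsilon>)) * (((3 * real ?s) ^ (K - 1) * real M ^ (\<Sum>j\<in>{1..<K}. j)) * (4 * real ?s * real M ^ K * ?S))"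
      using S0 C0 by (intro mult_mono C0(2) M prod_box_le s mult_nonneg_nonneg order.refl) (auto intro!: prod_nonneg)
    also have "\<dots> = C * real M powr (real ?s + \<epsilon>) * (real M ^ (\<Sum>j\<in>{1..<K}. j) * real M ^ K) * ?S"
      by (simp add: C_def mult_ac)
    also have "real M ^ (\<Sum>j\<in>{1..<K}. j) * real M ^ K = real M powr real ?s"
      using M by (simp only: power_add[symmetric] sum_1_less powr_realpow) 
    finally have 1: "(\<Sum>t<M. norm (h t) ^ ?s) ^ 2 \<le> C * real M powr (real ?s + \<epsilon>) * real M powr real ?s * ?S" .
    have "(\<Sum>t<M. norm (h t)) ^ ?s \<le> real (card {..<M}) ^ (?s - 1) * (\<Sum>t<M. norm (h t) ^ ?s)"
      by (rule sum_power_mean) (use s in auto)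
    then have "((\<Sum>t<M. norm (h t)) ^ ?s) ^ 2 \<le> (real M ^ (?s - 1) * (\<Sum>t<M. norm (h t) ^ ?s)) ^ 2"
      by (intro power_mono zero_le_power sum_nonneg norm_ge_zero) simp
    also have "\<dots> = (real M ^ (?s - 1)) ^ 2 * (\<Sum>t<M. norm (h t) ^ ?s) ^ 2" by (rule power_mult_distrib)
    also have "\<dots> \<le> (real M ^ (?s - 1)) ^ 2 * (C * real M powr (real ?s + \<epsilon>) * real M powr real ?s * ?S)"
      by (intro mult_left_mono 1) simp
    also have "(real M ^ (?s - 1)) ^ 2 = real M powr (2 * real ?s - 2)"
    proof -
      have "(real M ^ (?s - 1)) ^ 2 = real M ^ (2 * (?s - 1))" by (simp add: power_mult[symmetric] mult.commute)
      also have "\<dots> = real M powr real (2 * (?s - 1))" using M by (simp only: powr_realpow)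
      also have "real (2 * (?s - 1)) = 2 * real ?s - 2" using s by (simp add: of_nat_diff)
      finally show ?thesis .
    qed
    also have "real M powr (2 * real ?s - 2) * (C * real M powr (real ?s + \<epsilon>) * real M powr real ?s * ?S)
        = C * (real M powr (2 * real ?s - 2) * real M powr (real ?s + \<epsilon>) * real M powr real ?s) * ?S" by (simp only: mult_ac)
    also have "real M powr (2 * real ?s - 2) * real M powr (real ?s + \<epsilon>) * real M powr real ?s = real M powr (4 * real ?s - 2 + \<epsilon>)"
      unfolding powr_add[symmetric] by (simp add: algebra_simps)
    finally show "(\<Sum>t<M. ?E t) ^ (2 * ?s) \<le> C * real M powr (4 * real ?s - 2 + \<epsilon>) * ?S"
      unfolding Eh by (simp only: power_mult[symmetric] mult.commute[of 2])
  qed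
qed

text \<open>For each \<open>t < M\<close> the window around \<open>t\<close> contains the whole
  range of summation. Removing the excess by characters adds only a linear term to the polynomial,
  so a bound uniform in \<open>\<nu>\<close> is enough, at a logarithmic cost.\<close>

lemma weyl_sum_window_average:
  assumes M: "M \<ge> 1"
    and Y: "\<And>\<nu>. (\<Sum>t<M. norm (\<Sum>m\<in>{- int M<..<int M}. unit_exp (poly (F + [:0, \<nu>:]) (real t + real_of_int m)))) \<le> Y"
  shows "real M * norm (\<Sum>n<M. unit_exp (poly F (real n))) \<le> (2 + ln (real (3 * M))) * Y"
proof -
  let ?I = "{- int M<..<int M}" and ?R = "3 * M"
  let ?W = "\<Sum>n<M. unit_exp (poly F (real n))"
  let ?G = "\<lambda>\<nu>. F + [:0, real \<nu> / real ?R:]"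
  have W: "of_nat ?R * ?W = (\<Sum>\<nu><?R. dft_coeff M \<nu> * (\<Sum>m\<in>?I. unit_exp (poly (?G \<nu>) (real t + real_of_int m))))" if t: "t < M" for t
  proof -
    have "of_nat ?R * ?W = (\<Sum>n\<in>{m \<in> ?I. 0 \<le> int t + m \<and> int t + m < int M}. of_nat ?R * unit_exp (poly F (real t + real_of_int n)))"
      unfolding sum_distrib_left
      by (rule sum.reindex_bij_witness[of _ "\<lambda>m. nat (int t + m)" "\<lambda>n. int n - int t"]) (use t in auto)
    also have "\<dots> = (\<Sum>m\<in>?I. (if 0 \<le> int t + m \<and> int t + m < int M then of_nat ?R else 0) * unit_exp (poly F (real t + real_of_int m)))"
      by (intro sum.mono_neutral_cong_left) auto
    also have "\<dots> = (\<Sum>m\<in>?I. (\<Sum>\<nu><?R. dft_coeff M \<nu> * unit_exp (real \<nu> * real_of_int (int t + m) / real ?R)) * unit_exp (poly F (real t + real_of_int m)))"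
      by (intro sum.cong refl arg_cong2[where f = "(*)"] indicator_dft[symmetric]) (use t M in auto)
    also have "\<dots> = (\<Sum>m\<in>?I. \<Sum>\<nu><?R. dft_coeff M \<nu> * unit_exp (poly (?G \<nu>) (real t + real_of_int m)))"
      unfolding sum_distrib_right mult.assoc unit_exp_add[symmetric]
      by (intro sum.cong refl arg_cong2[where f = "(*)"] arg_cong[where f = unit_exp]) (simp add: algebra_simps add_divide_distrib)
    also have "\<dots> = (\<Sum>\<nu><?R. dft_coeff M \<nu> * (\<Sum>m\<in>?I. unit_exp (poly (?G \<nu>) (real t + real_of_int m))))"
      unfolding sum_distrib_left by (rule sum.swap)
    finally show ?thesis .
  qed
  have "real M * (real ?R * norm ?W) = (\<Sum>t<M. norm (of_nat ?R * ?W))" by (simp add: norm_mult)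
  also have "\<dots> \<le> (\<Sum>t<M. \<Sum>\<nu><?R. norm (dft_coeff M \<nu>) * norm (\<Sum>m\<in>?I. unit_exp (poly (?G \<nu>) (real t + real_of_int m))))"
  proof (intro sum_mono)
    fix t assume "t \<in> {..<M}"
    then show "norm (of_nat ?R * ?W) \<le> (\<Sum>\<nu><?R. norm (dft_coeff M \<nu>) * norm (\<Sum>m\<in>?I. unit_exp (poly (?G \<nu>) (real t + real_of_int m))))"
      unfolding norm_mult[symmetric] by (subst W) (auto intro: norm_sum)
  qed
  also have "\<dots> = (\<Sum>\<nu><?R. norm (dft_coeff M \<nu>) * (\<Sum>t<M. norm (\<Sum>m\<in>?I. unit_exp (poly (?G \<nu>) (real t + real_of_int m)))))"
    unfolding sum_distrib_left by (rule sum.swap)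
  also have "\<dots> \<le> (\<Sum>\<nu><?R. norm (dft_coeff M \<nu>) * Y)" by (intro sum_mono mult_left_mono Y) auto
  also have "\<dots> = (\<Sum>\<nu><?R. norm (dft_coeff M \<nu>)) * Y" by (rule sum_distrib_right[symmetric])
  also have "\<dots> \<le> (real ?R * (2 + ln (real ?R))) * Y"
    using Y[of 0] by (intro mult_right_mono sum_norm_dft_coeff M) (meson order.trans sum_nonneg norm_ge_zero)
  finally have "real ?R * (real M * norm ?W) \<le> real ?R * ((2 + ln (real ?R)) * Y)" by (simp only: mult_ac)
  then show ?thesis using M by (subst (asm) mult_le_cancel_left_pos) auto
qed

text \<open>As \<open>K + 1 >= 2\<close>, the linear twists from completion do not touch the top
  coefficient, and the window bound is uniform over them.\<close>

theorem weyl_bound: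
  assumes K: "K \<ge> 1" and \<epsilon>: "\<epsilon> > 0"
  shows "\<exists>C>0. \<forall>F M. M \<ge> 1 \<longrightarrow> degree F \<le> K + 1 \<longrightarrow>
    norm (\<Sum>n<M. unit_exp (poly F (real n))) ^ (2 * critical K)
    \<le> C * real M powr (2 * real (critical K) - 2 + \<epsilon>)
      * (\<Sum>t<M. \<Sum>t'<M. near_weight (real (critical K * M ^ K)) (real (K + 1) * coeff F (K + 1) * (real t - real t')))"
proof -
  let ?n = "2 * critical K"
  have s: "critical K \<ge> 1" by (rule critical_pos[OF K])
  obtain C0 where C0: "C0 > 0" "\<And>G M. M \<ge> 1 \<Longrightarrow> degree G \<le> K + 1 \<Longrightarrow>
    (\<Sum>t<M. norm (\<Sum>m\<in>{- int M<..<int M}. unit_exp (poly G (real t + real_of_int m)))) ^ ?n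
    \<le> C0 * real M powr (4 * real (critical K) - 2 + \<epsilon> / 2)
      * (\<Sum>t<M. \<Sum>t'<M. near_weight (real (critical K * M ^ K)) (real (K + 1) * coeff G (K + 1) * (real t - real t')))"
    using weyl_window[OF K, of "\<epsilon> / 2"] \<epsilon> by auto
  \<comment> \<open>The logarithm is bounded by a multiple of \<open>M powr a\<close>, whose power
    \<open>2 * critical K\<close> is \<open>M powr (\<epsilon> / 2)\<close>; the other half of
    \<open>\<epsilon>\<close> was spent in the window bound.\<close>
  define a where "a = \<epsilon> / (2 * real ?n)"
  have a: "a > 0" "a * real ?n = \<epsilon> / 2" using \<epsilon> s by (auto simp: a_def)
  define C1 where "C1 = 4 + 1 / a"
  have C1: "C1 > 0" using a by (simp add: C1_def add_pos_pos)
  show ?thesis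
  proof (intro exI[of _ "C1 ^ ?n * C0"] conjI allI impI)
    show "C1 ^ ?n * C0 > 0" using C1 C0 by simp
    fix F :: "real poly" and M :: nat
    assume M: "M \<ge> 1" and F: "degree F \<le> K + 1"
    let ?W = "norm (\<Sum>n<M. unit_exp (poly F (real n)))"
    let ?S = "\<Sum>t<M. \<Sum>t'<M. near_weight (real (critical K * M ^ K)) (real (K + 1) * coeff F (K + 1) * (real t - real t'))"
    have S0: "?S \<ge> 0" by (intro sum_nonneg near_weight_nonneg)
    define Z where "Z = C0 * real M powr (4 * real (critical K) - 2 + \<epsilon> / 2) * ?S"
    have Z0: "Z \<ge> 0" unfolding Z_def using C0 S0 by (intro mult_nonneg_nonneg) auto
    have n: "?n \<ge> 1" using s by simp
    have Y: "(\<Sum>t<M. norm (\<Sum>m\<in>{- int M<..<int M}. unit_exp (poly (F + [:0, \<nu>:]) (real t + real_of_int m)))) \<le> Z powr (1 / real ?n)" (is "?V \<le> _") for \<nu>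
    proof -
      have "coeff (F + [:0, \<nu>:]) (K + 1) = coeff F (K + 1)" using K by (cases K) (auto simp: coeff_pCons)
      moreover have "degree (F + [:0, \<nu>:]) \<le> K + 1" using F K by (intro degree_add_le) auto
      ultimately have "?V ^ ?n \<le> Z" using C0(2)[OF M, of "F + [:0, \<nu>:]"] by (simp only: Z_def)
      then have "(?V ^ ?n) powr (1 / real ?n) \<le> Z powr (1 / real ?n)" by (intro powr_mono2) (auto intro: sum_nonneg)
      moreover have "(?V ^ ?n) powr (1 / real ?n) = ?V" by (rule power_powr_inverse[OF _ n]) (intro sum_nonneg norm_ge_zero)
      ultimately show ?thesis by (simp only:)
    qed
    have L: "0 \<le> 2 + ln (real (3 * M))" "2 + ln (real (3 * M)) \<le> C1 * real M powr a"
    proof -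
      have l: "ln (real (3 * M)) = ln 3 + ln (real M)" using M by (simp add: ln_mult)
      have "ln (3::real) \<le> 3 - 1" by (rule ln_le_minus_one) simp
      moreover have "ln (real M) \<le> real M powr a / a" using M a by (intro ln_powr_bound) auto
      ultimately have "2 + ln (real (3 * M)) \<le> 4 * 1 + real M powr a / a" unfolding l by simp
      also have "\<dots> \<le> 4 * real M powr a + real M powr a / a" using M a by (intro add_mono mult_left_mono ge_one_powr_ge_zero) auto
      also have "\<dots> = C1 * real M powr a" by (simp add: C1_def distrib_right)
      finally show "2 + ln (real (3 * M)) \<le> C1 * real M powr a" .
      show "0 \<le> 2 + ln (real (3 * M))" using M by (intro add_nonneg_nonneg ln_ge_zero) auto
    qed
    have "real M * ?W \<le> (2 + ln (real (3 * M))) * Z powr (1 / real ?n)"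
      by (rule weyl_sum_window_average[OF M Y])
    also have "\<dots> \<le> C1 * real M powr a * Z powr (1 / real ?n)" by (intro mult_right_mono L) simp
    finally have "(real M * ?W) ^ ?n \<le> (C1 * real M powr a * Z powr (1 / real ?n)) ^ ?n" by (intro power_mono) auto
    also have "\<dots> = C1 ^ ?n * (real M powr a) ^ ?n * Z"
      using Z0 n by (simp only: power_mult_distrib powr_inverse_power)
    also have "(real M powr a) ^ ?n = real M powr (\<epsilon> / 2)"
      using M by (simp only: powr_realpow[symmetric] powr_gt_zero powr_powr a(2))
    finally have 1: "real M ^ ?n * ?W ^ ?n \<le> C1 ^ ?n * real M powr (\<epsilon> / 2) * Z" by (simp only: power_mult_distrib)
    have Mn: "real M ^ ?n = real M powr (2 * real (critical K))" using M by (simp add: powr_realpow[symmetric] del: of_nat_power)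
    have "C1 ^ ?n * real M powr (\<epsilon> / 2) * Z = C1 ^ ?n * C0 * (real M powr (\<epsilon> / 2) * real M powr (4 * real (critical K) - 2 + \<epsilon> / 2)) * ?S"
      by (simp only: Z_def mult_ac)
    also have "real M powr (\<epsilon> / 2) * real M powr (4 * real (critical K) - 2 + \<epsilon> / 2) = real M ^ ?n * real M powr (2 * real (critical K) - 2 + \<epsilon>)"
      unfolding Mn powr_add[symmetric] by (simp add: algebra_simps)
    finally have "real M ^ ?n * ?W ^ ?n \<le> real M ^ ?n * (C1 ^ ?n * C0 * real M powr (2 * real (critical K) - 2 + \<epsilon>) * ?S)"
      using 1 by (simp only: mult_ac)
    then show "?W ^ ?n \<le> C1 ^ ?n * C0 * real M powr (2 * real (critical K) - 2 + \<epsilon>) * ?S"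
      using M by (simp only: mult_le_cancel_left_pos zero_less_power of_nat_0_less_iff Suc_le_eq One_nat_def)
  qed
qed

section \<open>Spacing of multiples of the leading coefficient\<close>

text \<open>For \<open>a >= 1\<close> each term is at most
  \<open>4 * z\<^sup>2 / (z + a)\<^sup>2\<close>, which is dominated by a telescoping difference;
  the term at 0 gives the 1.\<close>

lemma sum_min_inverse_squares_le:
  fixes z :: real and B :: "nat set"
  assumes z: "z > 0" and B: "finite B"
  shows "(\<Sum>a\<in>B. if real a \<le> z then 1 else (z / real a)\<^sup>2) \<le> 1 + 4 * z"
proof -
  let ?b = "\<lambda>a::nat. if real a \<le> z then 1 else (z / real a)\<^sup>2"
  obtain N where N: "B \<subseteq> {..N}" using B finite_nat_iff_bounded_le by blast
  have tel: "?b (Suc a) \<le> 4 * z\<^sup>2 * (1 / (z + real a) - 1 / (z + real (Suc a)))" for a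
  proof -
    have p: "z + real a > 0" "z + real (Suc a) > 0" using z by auto
    have "?b (Suc a) \<le> 4 * z\<^sup>2 / (z + real (Suc a))\<^sup>2"
    proof (cases "real (Suc a) \<le> z")
      case True
      then have "(z + real (Suc a))\<^sup>2 \<le> (2 * z)\<^sup>2" using z by (intro power_mono) auto
      then show ?thesis using True p by (simp add: field_simps)
    next
      case False
      then have "(z + real (Suc a))\<^sup>2 \<le> (2 * real (Suc a))\<^sup>2" using z by (intro power_mono) auto
      then have "4 * z\<^sup>2 / (2 * real (Suc a))\<^sup>2 \<le> 4 * z\<^sup>2 / (z + real (Suc a))\<^sup>2"
        using p by (intro frac_le) auto
      then have "z\<^sup>2 / (real (Suc a))\<^sup>2 \<le> 4 * z\<^sup>2 / (z + real (Suc a))\<^sup>2"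
        by (simp only: power_mult_distrib) simp
      then show ?thesis using False by (simp add: power_divide)
    qed
    also have "\<dots> \<le> 4 * z\<^sup>2 / ((z + real a) * (z + real (Suc a)))"
      using p z by (intro divide_left_mono) (auto simp: power2_eq_square)
    also have "\<dots> = 4 * z\<^sup>2 * (1 / (z + real a) - 1 / (z + real (Suc a)))"
      using p by (simp add: field_simps)
    finally show ?thesis .
  qed
  have "(\<Sum>a\<in>B. ?b a) \<le> (\<Sum>a\<le>N. ?b a)" using N by (intro sum_mono2) auto
  also have "\<dots> \<le> (\<Sum>a\<le>Suc N. ?b a)" by simp
  also have "\<dots> = ?b 0 + (\<Sum>a\<le>N. ?b (Suc a))" by (rule sum.atMost_Suc_shift)
  also have "\<dots> \<le> 1 + (\<Sum>a\<le>N. 4 * z\<^sup>2 * (1 / (z + real a) - 1 / (z + real (Suc a))))"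
    using z by (intro add_mono sum_mono tel) auto
  also have "(\<Sum>a\<le>N. 4 * z\<^sup>2 * (1 / (z + real a) - 1 / (z + real (Suc a)))) = 4 * z\<^sup>2 * (\<Sum>a\<le>N. 1 / (z + real a) - 1 / (z + real (Suc a)))"
    by (rule sum_distrib_left[symmetric])
  also have "(\<Sum>a\<le>N. 1 / (z + real a) - 1 / (z + real (Suc a))) = 1 / (z + real 0) - 1 / (z + real (Suc N))"
    by (rule sum_telescope)
  also have "4 * z\<^sup>2 * (1 / (z + real 0) - 1 / (z + real (Suc N))) \<le> 4 * z\<^sup>2 * (1 / z)"
    using z by (intro mult_left_mono) auto
  also have "4 * z\<^sup>2 * (1 / z) = 4 * z" using z by (simp add: power2_eq_square)
  finally show ?thesis by simp
qed

text \<open>Cells of length \<open>\<delta>\<close> around 0 contain at most one representative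
  each. The cell indices on either side are therefore distinct natural numbers, and each side is
  bounded by the preceding one-dimensional sum.\<close>

lemma near_weight_sum_spaced:
  fixes x :: "'i \<Rightarrow> real"
  assumes S: "finite S" and \<delta>: "\<delta> > 0" and X: "X > 0"
    and sp: "\<And>i j. i \<in> S \<Longrightarrow> j \<in> S \<Longrightarrow> i \<noteq> j \<Longrightarrow> dist_int (x i - x j) \<ge> \<delta>"
  shows "(\<Sum>i\<in>S. near_weight X (x i)) \<le> 2 * (1 + 4 / (X * \<delta>))"
proof -
  define y where "y i = x i - real_of_int (round (x i))" for i
  define f where "f i = \<lfloor>y i / \<delta>\<rfloor>" for i
  define z where "z = 1 / (X * \<delta>)"
  have z: "z > 0" using X \<delta> by (simp add: z_def)
  let ?b = "\<lambda>a::nat. if real a \<le> z then 1 else (z / real a)\<^sup>2"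
  have b_anti: "near_weight X (x i) \<le> ?b a" if "real a * \<delta> \<le> \<bar>y i\<bar>" for i a
  proof -
    have d: "dist_int (x i) = \<bar>y i\<bar>" by (simp add: y_def dist_int_def)
    show ?thesis
    proof (cases "real a \<le> z")
      case True
      have "near_weight X (x i) \<le> 1"
      proof (cases "X * dist_int (x i) \<le> 1")
        case False
        then have "1 \<le> (X * dist_int (x i))\<^sup>2" by (intro one_le_power) auto
        then have "1 / (X * dist_int (x i))\<^sup>2 \<le> 1 / 1" by (intro frac_le) auto
        then show ?thesis using False by (simp add: near_weight_def)
      qed (simp add: near_weight_def)
      then show ?thesis using True by simp
    next
      case False
      then have a: "real a * (X * \<delta>) > 1" using X \<delta> by (simp add: z_def field_simps)
      have le: "real a * (X * \<delta>) \<le> X * \<bar>y i\<bar>" using that X by (simp add: mult.left_commute mult_left_mono)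
      then have "\<not> X * dist_int (x i) \<le> 1" using a d by simp
      then have "near_weight X (x i) = 1 / (X * \<bar>y i\<bar>)\<^sup>2" by (simp add: near_weight_def d)
      also have "\<dots> \<le> 1 / (real a * (X * \<delta>))\<^sup>2" using le a by (intro frac_le power_mono zero_less_power) auto
      also have "\<dots> = ?b a" using False by (simp add: z_def power_divide power_mult_distrib)
      finally show ?thesis .
    qed
  qed
  have inj: "f i \<noteq> f j" if "i \<in> S" "j \<in> S" "i \<noteq> j" for i j
  proof
    assume e: "f i = f j"
    have "\<delta> \<le> dist_int (x i - x j)" using that by (rule sp)
    also have "\<dots> \<le> \<bar>x i - x j - real_of_int (round (x i) - round (x j))\<bar>" by (rule dist_int_le)
    also have "\<dots> = \<bar>y i - y j\<bar>" by (simp add: y_def)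
    finally have "\<bar>y i / \<delta> - y j / \<delta>\<bar> \<ge> 1" using \<delta> by (simp add: field_simps flip: diff_divide_distrib)
    moreover have "real_of_int (f i) \<le> y i / \<delta>" "y i / \<delta> < real_of_int (f i) + 1"
      "real_of_int (f j) \<le> y j / \<delta>" "y j / \<delta> < real_of_int (f j) + 1" unfolding f_def by linarith+
    ultimately show False using e by linarith
  qed
  have half: "(\<Sum>i\<in>S'. near_weight X (x i)) \<le> 1 + 4 * z"
    if "S' \<subseteq> S" "inj_on g S'" "\<And>i. i \<in> S' \<Longrightarrow> real (g i) * \<delta> \<le> \<bar>y i\<bar>" for S' g
  proof -
    have "(\<Sum>i\<in>S'. near_weight X (x i)) \<le> (\<Sum>i\<in>S'. ?b (g i))" by (intro sum_mono b_anti that(3))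
    also have "\<dots> = (\<Sum>a\<in>g ` S'. ?b a)" by (simp add: sum.reindex[OF that(2)])
    also have "\<dots> \<le> 1 + 4 * z" using finite_subset[OF that(1) S] by (intro sum_min_inverse_squares_le z) simp
    finally show ?thesis .
  qed
  have "S = {i \<in> S. f i \<ge> 0} \<union> {i \<in> S. f i < 0}" by auto
  then have "(\<Sum>i\<in>S. near_weight X (x i)) = (\<Sum>i\<in>{i \<in> S. f i \<ge> 0} \<union> {i \<in> S. f i < 0}. near_weight X (x i))" by simp
  also have "\<dots> = (\<Sum>i\<in>{i \<in> S. f i \<ge> 0}. near_weight X (x i)) + (\<Sum>i\<in>{i \<in> S. f i < 0}. near_weight X (x i))"
    using S by (intro sum.union_disjoint) auto
  also have "\<dots> \<le> (1 + 4 * z) + (1 + 4 * z)"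
  proof (rule add_mono)
    show "(\<Sum>i\<in>{i \<in> S. f i \<ge> 0}. near_weight X (x i)) \<le> 1 + 4 * z"
    proof (rule half[where g = "\<lambda>i. nat (f i)"])
      show "inj_on (\<lambda>i. nat (f i)) {i \<in> S. f i \<ge> 0}"
      proof (rule inj_onI)
        fix i j assume ij: "i \<in> {i \<in> S. f i \<ge> 0}" "j \<in> {i \<in> S. f i \<ge> 0}" "nat (f i) = nat (f j)"
        then have "f i = f j" by auto
        then show "i = j" using inj[of i j] ij by auto
      qed
      fix i assume i: "i \<in> {i \<in> S. f i \<ge> 0}"
      have "real_of_int (f i) \<le> y i / \<delta>" unfolding f_def by linarith
      then have "real_of_int (f i) * \<delta> \<le> y i" using \<delta> by (simp add: field_simps)
      then show "real (nat (f i)) * \<delta> \<le> \<bar>y i\<bar>" using i by simp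
    qed auto
    show "(\<Sum>i\<in>{i \<in> S. f i < 0}. near_weight X (x i)) \<le> 1 + 4 * z"
    \<comment> \<open>On the negative side the floor bounds the distance from 0 only by
      \<open>- f i - 1\<close> cells.\<close>
    proof (rule half[where g = "\<lambda>i. nat (- f i - 1)"])
      show "inj_on (\<lambda>i. nat (- f i - 1)) {i \<in> S. f i < 0}"
      proof (rule inj_onI)
        fix i j assume ij: "i \<in> {i \<in> S. f i < 0}" "j \<in> {i \<in> S. f i < 0}" "nat (- f i - 1) = nat (- f j - 1)"
        then have "f i = f j" by auto
        then show "i = j" using inj[of i j] ij by auto
      qed
      fix i assume i: "i \<in> {i \<in> S. f i < 0}"
      have "y i / \<delta> < real_of_int (f i) + 1" unfolding f_def by linarith
      then have "(- real_of_int (f i) - 1) * \<delta> \<le> - y i" using \<delta> by (simp add: field_simps)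
      then show "real (nat (- f i - 1)) * \<delta> \<le> \<bar>y i\<bar>" using i by simp
    qed auto
  qed
  finally show ?thesis by (simp add: z_def)
qed

text \<open>Since \<open>q\<close> does not divide \<open>a * n\<close>, the fraction
  \<open>a * n / q\<close> stays at least \<open>1 / q\<close> away from every integer; replacing
  \<open>a / q\<close> by \<open>\<alpha>\<close> moves it by at most
  \<open>\<bar>n\<bar> / q\<^sup>2 <= 1 / (2 * q)\<close>.\<close>

lemma dist_int_rational_approx:
  fixes a q n :: int
  assumes q: "q \<ge> 1" and aq: "coprime a q" and \<alpha>: "\<bar>\<alpha> - real_of_int a / real_of_int q\<bar> < 1 / (real_of_int q)\<^sup>2"
    and n: "n \<noteq> 0" "2 * \<bar>n\<bar> \<le> q"
  shows "dist_int (real_of_int n * \<alpha>) \<ge> 1 / (2 * real_of_int q)"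
proof -
  let ?q = "real_of_int q"
  define w where "w = round (real_of_int n * \<alpha>)"
  have q0: "?q > 0" using q by simp
  have "a * n - w * q \<noteq> 0"
  proof
    assume "a * n - w * q = 0"
    then have "q dvd a * n" by (metis dvd_triv_right eq_iff_diff_eq_0)
    then have "q dvd n" using aq by (simp add: coprime_commute coprime_dvd_mult_right_iff)
    then have "q \<le> \<bar>n\<bar>" using n(1) dvd_imp_le_int[of n q] q by simp
    then show False using n q by linarith
  qed
  then have "\<bar>a * n - w * q\<bar> \<ge> 1" by linarith
  then have "\<bar>real_of_int (a * n - w * q)\<bar> \<ge> 1" by (metis of_int_1_le_iff of_int_abs)
  then have 1: "\<bar>real_of_int a / ?q * real_of_int n - real_of_int w\<bar> \<ge> 1 / ?q"
  proof -
    have "real_of_int a / ?q * real_of_int n - real_of_int w = real_of_int (a * n - w * q) / ?q"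
      using q0 by (simp add: field_simps)
    then show ?thesis using \<open>\<bar>real_of_int (a * n - w * q)\<bar> \<ge> 1\<close> q0 by (simp add: divide_right_mono)
  qed
  have nq: "2 * real_of_int \<bar>n\<bar> \<le> ?q" using n(2) by (metis of_int_le_iff of_int_mult of_int_numeral)
  have "\<bar>real_of_int n * (\<alpha> - real_of_int a / ?q)\<bar> \<le> (?q / 2) * (1 / ?q\<^sup>2)"
    unfolding abs_mult using \<alpha> nq q0 by (intro mult_mono) auto
  also have "\<dots> = 1 / (2 * ?q)" using q0 by (simp add: power2_eq_square)
  finally have 2: "\<bar>real_of_int n * (\<alpha> - real_of_int a / ?q)\<bar> \<le> 1 / (2 * ?q)" .
  have "real_of_int n * \<alpha> - real_of_int w = (real_of_int a / ?q * real_of_int n - real_of_int w) + real_of_int n * (\<alpha> - real_of_int a / ?q)"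
    by (simp add: algebra_simps)
  moreover have "u \<le> \<bar>x\<bar> \<Longrightarrow> \<bar>y\<bar> \<le> v \<Longrightarrow> u - v \<le> \<bar>x + y\<bar>" for u v x y :: real by linarith
  from this[OF 1 2] have "1 / ?q - 1 / (2 * ?q) \<le> \<bar>(real_of_int a / ?q * real_of_int n - real_of_int w) + real_of_int n * (\<alpha> - real_of_int a / ?q)\<bar>" .
  ultimately have "\<bar>real_of_int n * \<alpha> - real_of_int w\<bar> \<ge> 1 / ?q - 1 / (2 * ?q)" by (simp only:)
  also have "1 / ?q - 1 / (2 * ?q) = 1 / (2 * ?q)" using q0 by (simp add: field_simps)
  finally show ?thesis by (simp add: dist_int_def w_def)
qed

lemma near_weight_sum_linear:
  fixes a q c :: int
  assumes q: "q \<ge> 1" and aq: "coprime a q" and \<alpha>: "\<bar>\<alpha> - real_of_int a / real_of_int q\<bar> < 1 / (real_of_int q)\<^sup>2"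
    and c: "c \<noteq> 0" and X: "X \<ge> 1" and M: "M \<ge> 1"
  shows "(\<Sum>t'<M. near_weight X (real_of_int c * \<alpha> * (real t - real t')))
     \<le> 16 * (1 + 4 * real_of_int \<bar>c\<bar> * real M / real_of_int q) * (1 + real_of_int q / X)"
proof -
  let ?q = "real_of_int q" and ?c = "real_of_int \<bar>c\<bar>"
  have q0: "?q > 0" using q by simp
  have c0: "?c \<ge> 1" using c by linarith
  \<comment> \<open>Block length such that multiples of \<open>c\<close> within a block stay below
    \<open>q / 2\<close>, making the points \<open>1 / (2 * q)\<close>-spaced. If
    \<open>q < 2 * \<bar>c\<bar>\<close> the blocks are single points and spacing is
    vacuous.\<close>
  define L where "L = nat (max 1 (q div (2 * \<bar>c\<bar>)))"
  have L: "L \<ge> 1" by (simp add: L_def)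
  have Lc: "L = 1 \<or> 2 * \<bar>c\<bar> * int L \<le> q"
  proof (cases "q div (2 * \<bar>c\<bar>) \<ge> 1")
    case True
    then have iL: "int L = q div (2 * \<bar>c\<bar>)" by (simp add: L_def)
    moreover have "2 * \<bar>c\<bar> * (q div (2 * \<bar>c\<bar>)) + q mod (2 * \<bar>c\<bar>) = q" by (rule mult_div_mod_eq)
    moreover have "q mod (2 * \<bar>c\<bar>) \<ge> 0" using c by (intro pos_mod_sign) auto
    ultimately have "2 * \<bar>c\<bar> * int L \<le> q" unfolding iL by linarith
    then show ?thesis by simp
  qed (simp add: L_def)
  have blocks: "real M / real L \<le> 4 * ?c * real M / ?q"
  proof -
    have "?q \<le> 4 * ?c * real L"
    proof -
      have "q < 2 * \<bar>c\<bar> * (q div (2 * \<bar>c\<bar>)) + 2 * \<bar>c\<bar>"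
        using c pos_mod_bound[of "2 * \<bar>c\<bar>" q] by (simp add: minus_mod_eq_mult_div[symmetric])
      also have "\<dots> \<le> 2 * \<bar>c\<bar> * int L + 2 * \<bar>c\<bar> * int L"
      proof (rule add_mono)
        show "2 * \<bar>c\<bar> * (q div (2 * \<bar>c\<bar>)) \<le> 2 * \<bar>c\<bar> * int L" by (intro mult_left_mono) (auto simp: L_def)
        show "2 * \<bar>c\<bar> \<le> 2 * \<bar>c\<bar> * int L" using mult_left_mono[of 1 "int L" "2 * \<bar>c\<bar>"] L by simp
      qed
      finally have "q \<le> 4 * \<bar>c\<bar> * int L" by simp
      then have "real_of_int q \<le> real_of_int (4 * \<bar>c\<bar> * int L)" by (simp only: of_int_le_iff)
      then show ?thesis by simp
    qed
    then have "real M * ?q \<le> real M * (4 * ?c * real L)" by (intro mult_left_mono) auto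
    then show ?thesis using q0 L by (simp add: field_simps)
  qed
  let ?x = "\<lambda>t'. real_of_int c * \<alpha> * (real t - real t')"
  have block: "(\<Sum>t'\<in>{t' \<in> {..<M}. t' div L = v}. near_weight X (?x t')) \<le> 16 * (1 + ?q / X)" for v
  proof -
    have "(\<Sum>t'\<in>{t' \<in> {..<M}. t' div L = v}. near_weight X (?x t')) \<le> 2 * (1 + 4 / (X * (1 / (2 * ?q))))"
    proof (rule near_weight_sum_spaced)
      fix i j assume ij: "i \<in> {t' \<in> {..<M}. t' div L = v}" "j \<in> {t' \<in> {..<M}. t' div L = v}" "i \<noteq> j"
      have iv: "i div L = v" "j div L = v" using ij by auto
      have "L * v + i mod L = i" unfolding iv(1)[symmetric] by (rule mult_div_mod_eq)
      moreover have "L * v + j mod L = j" unfolding iv(2)[symmetric] by (rule mult_div_mod_eq)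
      moreover have "i mod L < L" "j mod L < L" using L by auto
      ultimately have d: "\<bar>int j - int i\<bar> < int L" "\<bar>int j - int i\<bar> \<ge> 1" using ij(3) by linarith+
      then have "L \<noteq> 1" by auto
      then have "2 * \<bar>c\<bar> * int L \<le> q" using Lc by simp
      moreover have "2 * \<bar>c\<bar> * \<bar>int j - int i\<bar> \<le> 2 * \<bar>c\<bar> * int L" using d by (intro mult_left_mono) auto
      ultimately have "2 * \<bar>c * (int j - int i)\<bar> \<le> q" by (simp add: abs_mult)
      moreover have "c * (int j - int i) \<noteq> 0" using c ij(3) by simp
      ultimately have "dist_int (real_of_int (c * (int j - int i)) * \<alpha>) \<ge> 1 / (2 * ?q)"
        by (intro dist_int_rational_approx[OF q aq \<alpha>])
      moreover have "?x i - ?x j = real_of_int (c * (int j - int i)) * \<alpha>" by (simp add: algebra_simps)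
      ultimately show "1 / (2 * ?q) \<le> dist_int (?x i - ?x j)" by simp
    qed (use q0 X in auto)
    also have "2 * (1 + 4 / (X * (1 / (2 * ?q)))) = 2 + 16 * (?q / X)" using q0 X by (simp add: field_simps)
    also have "\<dots> \<le> 16 * (1 + ?q / X)" by simp
    finally show ?thesis .
  qed
  let ?Vs = "{..(M - 1) div L}"
  have "(\<Sum>t'<M. near_weight X (?x t')) = (\<Sum>v\<in>?Vs. \<Sum>t'\<in>{t' \<in> {..<M}. t' div L = v}. near_weight X (?x t'))"
  proof (rule sum.group[symmetric])
    show "(\<lambda>t'. t' div L) ` {..<M} \<subseteq> ?Vs" by (auto intro!: div_le_mono)
  qed auto
  also have "\<dots> \<le> (\<Sum>v\<in>?Vs. 16 * (1 + ?q / X))" by (intro sum_mono block)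
  also have "\<dots> = real ((M - 1) div L + 1) * (16 * (1 + ?q / X))" by simp
  also have "\<dots> \<le> (1 + 4 * ?c * real M / ?q) * (16 * (1 + ?q / X))"
  proof (rule mult_right_mono)
    have "real ((M - 1) div L) \<le> real (M div L)" by (intro of_nat_mono div_le_mono) simp
    also have "\<dots> \<le> real M / real L" by (rule of_nat_div_le_of_nat)
    finally show "real ((M - 1) div L + 1) \<le> 1 + 4 * ?c * real M / ?q" using blocks by simp
  qed (use q0 X in auto)
  finally show ?thesis by (simp only: mult_ac)
qed

section \<open>The Rudin--Shapiro sums\<close>

text \<open>Counts the occurrences starting in the \<open>k\<close> low digits. The one starting at
  position \<open>k - 1\<close> reads the lowest digit of the high part, which is what
  \<open>c\<close> supplies.\<close>

definition low_sign :: "nat \<Rightarrow> nat \<Rightarrow> nat \<Rightarrow> int" where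
  "low_sign k c b = (- 1) ^ card {i. i < k \<and> bit (2 ^ k * c + b) i \<and> bit (2 ^ k * c + b) (Suc i)}"

lemma bit_less_nat: "bit n i \<Longrightarrow> i < n" for n :: nat
proof (rule ccontr)
  assume b: "bit n i" and "\<not> i < n"
  then have "n < 2 ^ i" using less_exp[of i] by linarith
  then show False using b by (simp add: bit_iff_odd)
qed

text \<open>Occurrences starting at position \<open>k\<close> or higher are those of
  \<open>m\<close>. Those starting lower read digits up to position \<open>k\<close> only, so they
  see \<open>m\<close> through its parity.\<close>

lemma rudin_shapiro_split:
  assumes b: "b < 2 ^ k"
  shows "rudin_shapiro (2 ^ k * m + b) = rudin_shapiro m * low_sign k (m mod 2) b"
proof -
  let ?n = "2 ^ k * m + b" and ?n' = "2 ^ k * (m mod 2) + b"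
  let ?A = "\<lambda>n::nat. {i. bit n i \<and> bit n (Suc i)}"
  have hi: "bit ?n (k + i) \<longleftrightarrow> bit m i" for i
  proof -
    have "?n div 2 ^ (k + i) = ?n div 2 ^ k div 2 ^ i" by (simp add: power_add div_mult2_eq)
    also have "?n div 2 ^ k = m" using b by simp
    finally show ?thesis by (simp add: bit_iff_odd)
  qed
  have lo: "bit ?n i \<longleftrightarrow> bit ?n' i" if "i \<le> k" for i
  proof -
    have "?n = 2 ^ Suc k * (m div 2) + ?n'"
    proof -
      have "2 ^ k * m = 2 ^ k * (2 * (m div 2) + m mod 2)" by (simp only: mult_div_mod_eq)
      then show ?thesis by (simp only: power_Suc distrib_left mult_ac add_ac)
    qed
    then have "?n mod 2 ^ Suc k = ?n' mod 2 ^ Suc k" by (simp only: mod_mult_self4)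
    then have "bit (take_bit (Suc k) ?n) i \<longleftrightarrow> bit (take_bit (Suc k) ?n') i" by (simp only: take_bit_eq_mod)
    then show ?thesis using that by (simp add: bit_take_bit_iff)
  qed
  have fin: "finite (?A n)" for n
    by (rule finite_subset[of _ "{..<n}"]) (auto dest: bit_less_nat)
  have "?A ?n = {i. i < k \<and> bit ?n' i \<and> bit ?n' (Suc i)} \<union> (\<lambda>i. k + i) ` ?A m"
  proof (intro set_eqI iffI)
    fix i assume i: "i \<in> ?A ?n"
    show "i \<in> {i. i < k \<and> bit ?n' i \<and> bit ?n' (Suc i)} \<union> (\<lambda>i. k + i) ` ?A m"
    proof (cases "i < k")
      case True
      then show ?thesis using i lo[of i] lo[of "Suc i"] by simp
    next
      case False
      then have "i = k + (i - k)" by simp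
      moreover have "i - k \<in> ?A m" using i hi[of "i - k"] hi[of "Suc (i - k)"] False by simp
      ultimately show ?thesis by blast
    qed
  next
    fix i assume "i \<in> {i. i < k \<and> bit ?n' i \<and> bit ?n' (Suc i)} \<union> (\<lambda>i. k + i) ` ?A m"
    then show "i \<in> ?A ?n"
    proof
      assume "i \<in> {i. i < k \<and> bit ?n' i \<and> bit ?n' (Suc i)}"
      then show ?thesis using lo[of i] lo[of "Suc i"] by simp
    next
      assume "i \<in> (\<lambda>i. k + i) ` ?A m"
      then obtain j where "i = k + j" "j \<in> ?A m" by blast
      then show ?thesis using hi[of j] hi[of "Suc j"] by simp
    qed
  qed
  then have "chi11 ?n = card ({i. i < k \<and> bit ?n' i \<and> bit ?n' (Suc i)} \<union> (\<lambda>i. k + i) ` ?A m)"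
    by (simp only: chi11_def)
  also have "\<dots> = card {i. i < k \<and> bit ?n' i \<and> bit ?n' (Suc i)} + card ((\<lambda>i. k + i) ` ?A m)"
    by (rule card_Un_disjoint) (use fin in auto)
  also have "card ((\<lambda>i. k + i) ` ?A m) = chi11 m" unfolding chi11_def by (rule card_image) simp
  finally show ?thesis by (simp add: rudin_shapiro_def low_sign_def power_add)
qed

lemma norm_low_sign: "norm (of_int (low_sign k c b) :: complex) = 1"
  by (simp add: low_sign_def norm_power)

lemma norm_rudin_shapiro: "norm (of_int (rudin_shapiro n) :: complex) = 1"
  by (simp add: rudin_shapiro_def norm_power)

lemma norm_RS_le: "norm (RS f r l) \<le> 2 ^ r"
proof -
  have "norm (RS f r l) \<le> (\<Sum>n<2 ^ r. norm (of_int (rudin_shapiro n) * unit_exp (real l * poly f (real n))))"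
    unfolding RS_def by (rule norm_sum)
  then show ?thesis by (simp only: norm_mult norm_rudin_shapiro norm_unit_exp) simp
qed

text \<open>The high digits interact with the low ones only through the parity of \<open>m\<close>; admitting both
  parities for every \<open>m\<close> costs the factor 2.\<close>

lemma RS_square_le:
  assumes "k \<le> r"
  shows "norm (RS f r l) ^ 2 \<le> 2 * 2 ^ (r - k) * (\<Sum>b<2 ^ k. \<Sum>b'<2 ^ k. norm (\<Sum>m<2 ^ (r - k).
      unit_exp (real l * poly f (real (2 ^ k * m + b)) - real l * poly f (real (2 ^ k * m + b')))))"
proof -
  let ?M = "2 ^ (r - k) :: nat" and ?B = "2 ^ k :: nat"
  let ?g = "\<lambda>n. unit_exp (real l * poly f (real n))"
  have r: "(2::nat) ^ r = ?B * ?M" using assms by (simp flip: power_add)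
  define Z where "Z c m = norm (\<Sum>b<?B. of_int (low_sign k c b) * ?g (?B * m + b))" for c m
  have "RS f r l = (\<Sum>z\<in>{..<?M} \<times> {..<?B}. of_int (rudin_shapiro (?B * fst z + snd z)) * ?g (?B * fst z + snd z))"
    unfolding RS_def
  proof (rule sum.reindex_bij_witness[of _ "\<lambda>z. ?B * fst z + snd z" "\<lambda>n. (n div ?B, n mod ?B)"])
    fix z assume "z \<in> {..<?M} \<times> {..<?B}"
    then have z: "fst z < ?M" "snd z < ?B" by auto
    then show "((?B * fst z + snd z) div ?B, (?B * fst z + snd z) mod ?B) = z" by (simp add: prod_eq_iff)
    have "?B * fst z + snd z < ?B * (fst z + 1)" using z by simp
    also have "\<dots> \<le> ?B * ?M" using z by (intro mult_le_mono2) simp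
    finally show "?B * fst z + snd z \<in> {..<2 ^ r}" by (simp add: r)
  next
    fix n assume "n \<in> {..<(2::nat) ^ r}"
    then show "(n div ?B, n mod ?B) \<in> {..<?M} \<times> {..<?B}"
      by (simp add: r less_mult_imp_div_less mult.commute)
  qed (simp_all add: mult_div_mod_eq)
  also have "\<dots> = (\<Sum>m<?M. \<Sum>b<?B. of_int (rudin_shapiro (?B * m + b)) * ?g (?B * m + b))"
    by (simp only: sum.cartesian_product split_def)
  also have "\<dots> = (\<Sum>m<?M. of_int (rudin_shapiro m) * (\<Sum>b<?B. of_int (low_sign k (m mod 2) b) * ?g (?B * m + b)))"
    unfolding sum_distrib_left by (intro sum.cong refl) (simp add: rudin_shapiro_split mult.assoc)
  finally have "norm (RS f r l) \<le> (\<Sum>m<?M. norm (of_int (rudin_shapiro m) * (\<Sum>b<?B. of_int (low_sign k (m mod 2) b) * ?g (?B * m + b))))"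
    by (simp only: norm_sum)
  also have "\<dots> = (\<Sum>m<?M. 1 * Z (m mod 2) m)" by (simp only: norm_mult norm_rudin_shapiro Z_def)
  finally have "norm (RS f r l) ^ 2 \<le> (\<Sum>m<?M. 1 * Z (m mod 2) m) ^ 2" by (intro power_mono) auto
  also have "\<dots> \<le> (\<Sum>m<?M. 1\<^sup>2) * (\<Sum>m<?M. Z (m mod 2) m ^ 2)" by (rule Cauchy_Schwarz_ineq_sum)
  also have "\<dots> \<le> (\<Sum>m<?M. 1\<^sup>2) * (\<Sum>m<?M. Z 0 m ^ 2 + Z 1 m ^ 2)"
  proof (intro mult_left_mono sum_mono)
    fix m :: nat
    have "m mod 2 = 0 \<or> m mod 2 = 1" by auto
    then show "Z (m mod 2) m ^ 2 \<le> Z 0 m ^ 2 + Z 1 m ^ 2" by auto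
  qed simp
  also have "\<dots> = real ?M * ((\<Sum>m<?M. Z 0 m ^ 2) + (\<Sum>m<?M. Z 1 m ^ 2))" by (simp add: sum.distrib)
  also have "\<dots> \<le> real ?M * (2 * (\<Sum>b<?B. \<Sum>b'<?B. norm (\<Sum>m<?M. ?g (?B * m + b) * cnj (?g (?B * m + b')))))"
  proof (intro mult_left_mono)
    have "(\<Sum>m<?M. Z c m ^ 2) \<le> (\<Sum>b<?B. \<Sum>b'<?B. norm (\<Sum>m<?M. ?g (?B * m + b) * cnj (?g (?B * m + b'))))" for c
    proof -
      let ?w = "\<lambda>b. of_int (low_sign k c b) :: complex"
      have "complex_of_real (\<Sum>m<?M. Z c m ^ 2) = (\<Sum>m<?M. \<Sum>b<?B. \<Sum>b'<?B. (?w b * ?g (?B * m + b)) * cnj (?w b' * ?g (?B * m + b')))"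
        unfolding Z_def of_real_sum sum_square_expand ..
      also have "\<dots> = (\<Sum>b<?B. \<Sum>b'<?B. \<Sum>m<?M. (?w b * ?g (?B * m + b)) * cnj (?w b' * ?g (?B * m + b')))"
        by (rule sum_swap_last[symmetric])
      \<comment> \<open>With the parity fixed the weights no longer depend on \<open>m\<close>, so
        they leave the inner sum and drop out in absolute value.\<close>
      also have "\<dots> = (\<Sum>b<?B. \<Sum>b'<?B. (?w b * cnj (?w b')) * (\<Sum>m<?M. ?g (?B * m + b) * cnj (?g (?B * m + b'))))"
        unfolding sum_distrib_left complex_cnj_mult by (simp only: mult_ac)
      finally have "norm (complex_of_real (\<Sum>m<?M. Z c m ^ 2)) \<le> (\<Sum>b<?B. norm (\<Sum>b'<?B. (?w b * cnj (?w b')) * (\<Sum>m<?M. ?g (?B * m + b) * cnj (?g (?B * m + b')))))"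
        by (simp only: norm_sum)
      also have "\<dots> \<le> (\<Sum>b<?B. \<Sum>b'<?B. norm (?w b * cnj (?w b') * (\<Sum>m<?M. ?g (?B * m + b) * cnj (?g (?B * m + b')))))"
        by (intro sum_mono norm_sum)
      also have "\<dots> = (\<Sum>b<?B. \<Sum>b'<?B. norm (\<Sum>m<?M. ?g (?B * m + b) * cnj (?g (?B * m + b'))))"
        by (simp only: norm_mult complex_mod_cnj norm_low_sign mult_1)
      finally show ?thesis unfolding norm_of_real by linarith
    qed
    from add_mono[OF this this] show "(\<Sum>m<?M. Z 0 m ^ 2) + (\<Sum>m<?M. Z 1 m ^ 2)
        \<le> 2 * (\<Sum>b<?B. \<Sum>b'<?B. norm (\<Sum>m<?M. ?g (?B * m + b) * cnj (?g (?B * m + b'))))"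
      by (simp only: mult_2)
  qed simp
  finally show ?thesis by (simp add: unit_exp_diff mult.assoc)
qed

text \<open>In the difference the terms of degree \<open>d\<close> cancel, and so does the
  contribution of the coefficient of degree \<open>d - 1\<close>. The new leading coefficient is an
  integer multiple of that of \<open>f\<close>, so its rational approximation can be used
  directly.\<close>

lemma weyl_differenced_bound:
  assumes d: "d \<ge> 3" and \<epsilon>: "\<epsilon> > 0"
  shows "\<exists>C>0. \<forall>(f::real poly) (a::int) (q::int) (l::nat) (b::nat) (b'::nat) (B::nat) (M::nat).
    degree f = d \<longrightarrow> q \<ge> 1 \<longrightarrow> coprime a q \<longrightarrow> \<bar>coeff f d - real_of_int a / real_of_int q\<bar> < 1 / (real_of_int q)\<^sup>2 \<longrightarrow>
    l > 0 \<longrightarrow> b < B \<longrightarrow> b' < B \<longrightarrow> b \<noteq> b' \<longrightarrow> M \<ge> 1 \<longrightarrow>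
    norm (\<Sum>m<M. unit_exp (real l * poly f (real (B * m + b)) - real l * poly f (real (B * m + b')))) ^ ((d - 1) * (d - 2))
      \<le> C * real M powr (real ((d - 1) * (d - 2)) + \<epsilon>) *
        (1 / real M + real_of_int q / real M ^ (d - 1) + real l * real B ^ d / real_of_int q + real l * real B ^ d / real M ^ (d - 2))"
proof -
  define K where "K = d - 2"
  have K: "K \<ge> 1" "d = K + 2" "d - 1 = K + 1" using d by (auto simp: K_def)
  have n: "(d - 1) * (d - 2) = 2 * critical K"
    using K by (simp add: critical_def mult.commute)
  obtain C0 where C0: "C0 > 0" "\<And>F M. M \<ge> 1 \<Longrightarrow> degree F \<le> K + 1 \<Longrightarrow>
    norm (\<Sum>n<M. unit_exp (poly F (real n))) ^ (2 * critical K)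
    \<le> C0 * real M powr (2 * real (critical K) - 2 + \<epsilon>)
      * (\<Sum>t<M. \<Sum>t'<M. near_weight (real (critical K * M ^ K)) (real (K + 1) * coeff F (K + 1) * (real t - real t')))"
    using weyl_bound[OF K(1) \<epsilon>] by blast
  define C where "C = C0 * (64 * real d ^ 2)"
  show ?thesis unfolding n
  proof (intro exI[of _ C] conjI allI impI)
    show "C > 0" using C0 d by (simp add: C_def)
    fix f :: "real poly" and a q :: int and l b b' B M :: nat
    assume f: "degree f = d" and q: "q \<ge> 1" and aq: "coprime a q"
      and \<alpha>: "\<bar>coeff f d - real_of_int a / real_of_int q\<bar> < 1 / (real_of_int q)\<^sup>2"
      and l: "l > 0" and b: "b < B" "b' < B" "b \<noteq> b'" and M: "M \<ge> 1"
    let ?\<alpha> = "coeff f d" and ?q = "real_of_int q"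
    define F where "F = smult (real l) (pcompose f [:real b, real B:] - pcompose f [:real b', real B:])"
    have fd: "degree f \<le> K + 2" using f K by simp
    have F0: "coeff F j = 0" if "j > K + 1" for j
    proof (cases "j = K + 2")
      case True
      then show ?thesis by (simp add: F_def coeff_pcompose_linear[OF fd])
    next
      case False
      then show ?thesis using that by (simp add: F_def coeff_pcompose_linear[OF fd])
    qed
    then have degF: "degree F \<le> K + 1" by (intro degree_le) auto
    \<comment> \<open>The integer multiplying the leading coefficient of \<open>f\<close>; the
      factor \<open>K + 1\<close> is the slope arising from the shifts. It is nonzero as
      \<open>b \<noteq> b'\<close>, and at most \<open>d\<^sup>2 * l * B ^ d\<close> in
      size.\<close>
    define c where "c = int (K + 1) * int l * int d * int B ^ (K + 1) * (int b - int b')"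
    have cF: "real (K + 1) * coeff F (K + 1) = real_of_int c * ?\<alpha>"
      unfolding F_def c_def
      by (simp add: coeff_pcompose_linear[OF fd] K(2) sum.atLeast_Suc_atMost algebra_simps)
    have c0: "c \<noteq> 0" using l b K by (auto simp: c_def)
    have cB: "real_of_int \<bar>c\<bar> \<le> real d ^ 2 * (real l * real B ^ d)"
    proof -
      have "\<bar>c\<bar> = int (K + 1) * int l * int d * int B ^ (K + 1) * \<bar>int b - int b'\<bar>"
        by (simp add: c_def abs_mult)
      also have "\<dots> \<le> int d * int l * int d * int B ^ (K + 1) * int B"
        using b K by (intro mult_mono) auto
      also have "\<dots> = int (d ^ 2 * (l * B ^ d))" by (simp add: K(2) power2_eq_square algebra_simps)
      finally have "real_of_int \<bar>c\<bar> \<le> real_of_int (int (d ^ 2 * (l * B ^ d)))" by (simp only: of_int_le_iff)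
      then show ?thesis by simp
    qed
    have "(\<Sum>m<M. unit_exp (real l * poly f (real (B * m + b)) - real l * poly f (real (B * m + b')))) = (\<Sum>m<M. unit_exp (poly F (real m)))"
      by (intro sum.cong refl arg_cong[where f = unit_exp]) (simp add: F_def poly_pcompose algebra_simps)
    then have "norm (\<Sum>m<M. unit_exp (real l * poly f (real (B * m + b)) - real l * poly f (real (B * m + b')))) ^ (2 * critical K)
       \<le> C0 * real M powr (2 * real (critical K) - 2 + \<epsilon>)
        * (\<Sum>t<M. \<Sum>t'<M. near_weight (real (critical K * M ^ K)) (real_of_int c * ?\<alpha> * (real t - real t')))"
      using C0(2)[OF M degF] by (simp only: cF)
    also have "\<dots> \<le> C0 * real M powr (2 * real (critical K) - 2 + \<epsilon>) * (\<Sum>t<M. 64 * real d ^ 2 * ((1 + real l * real B ^ d * real M / ?q) * (1 + ?q / real M ^ K)))"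
    proof (intro mult_left_mono sum_mono)
      fix t
      have X: "real M ^ K \<le> real (critical K * M ^ K)" "1 \<le> real M ^ K"
        using critical_pos[OF K(1)] M by (auto simp: mult_le_cancel_right1)
      have "(\<Sum>t'<M. near_weight (real (critical K * M ^ K)) (real_of_int c * ?\<alpha> * (real t - real t')))
         \<le> 16 * (1 + 4 * real_of_int \<bar>c\<bar> * real M / ?q) * (1 + ?q / real (critical K * M ^ K))"
        by (rule near_weight_sum_linear[OF q aq \<alpha> c0 _ M]) (use X in linarith)
      also have "\<dots> \<le> 16 * (4 * real d ^ 2 * (1 + real l * real B ^ d * real M / ?q)) * (1 + ?q / real M ^ K)"
      proof (intro mult_mono mult_left_mono)
        have "4 * real_of_int \<bar>c\<bar> * real M / ?q \<le> 4 * (real d ^ 2 * (real l * real B ^ d)) * real M / ?q"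
          using cB q by (intro divide_right_mono mult_right_mono mult_left_mono) auto
        moreover have "1 \<le> real d ^ 2" using d by (intro one_le_power) simp
        then have "1 \<le> 4 * real d ^ 2" by linarith
        ultimately show "1 + 4 * real_of_int \<bar>c\<bar> * real M / ?q \<le> 4 * real d ^ 2 * (1 + real l * real B ^ d * real M / ?q)"
          by (simp add: algebra_simps)
        show "1 + ?q / real (critical K * M ^ K) \<le> 1 + ?q / real M ^ K"
          using X q by (intro add_left_mono frac_le order.refl) linarith+
      qed (use q in \<open>auto intro!: add_nonneg_nonneg mult_nonneg_nonneg divide_nonneg_nonneg\<close>)
      finally show "(\<Sum>t'<M. near_weight (real (critical K * M ^ K)) (real_of_int c * ?\<alpha> * (real t - real t')))
         \<le> 64 * real d ^ 2 * ((1 + real l * real B ^ d * real M / ?q) * (1 + ?q / real M ^ K))" by (simp add: mult_ac)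
    qed (use C0 in auto)
    also have "\<dots> = C * (real M powr (2 * real (critical K) - 2 + \<epsilon>) * real M * real M) *
       (1 / real M + ?q / real M ^ (K + 1) + real l * real B ^ d / ?q + real l * real B ^ d / real M ^ K)"
    proof -
      have "(1 + x * y / z) * (1 + z / w) = y * (1 / y + z / (w * y) + x / z + x / w)" if "y > 0" "z > 0" "w > 0" for x y z w :: real
        using that by (simp add: field_simps)
      from this[of "real M" ?q "real M ^ K" "real l * real B ^ d"]
      have "(1 + real l * real B ^ d * real M / ?q) * (1 + ?q / real M ^ K)
        = real M * (1 / real M + ?q / real M ^ (K + 1) + real l * real B ^ d / ?q + real l * real B ^ d / real M ^ K)"
        using M q by (simp add: mult.commute)
      then show ?thesis by (simp add: C_def mult_ac)
    qed
    also have "real M powr (2 * real (critical K) - 2 + \<epsilon>) * real M * real M = real M powr (real (2 * critical K) + \<epsilon>)"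
    proof -
      have "real M * real M = real M powr 2" using M by (simp add: power2_eq_square powr_numeral)
      then have "real M powr (2 * real (critical K) - 2 + \<epsilon>) * real M * real M = real M powr (2 * real (critical K) - 2 + \<epsilon>) * real M powr 2"
        by (simp only: mult.assoc)
      also have "\<dots> = real M powr (real (2 * critical K) + \<epsilon>)" unfolding powr_add[symmetric] by (simp add: algebra_simps)
      finally show ?thesis .
    qed
    finally show "norm (\<Sum>m<M. unit_exp (real l * poly f (real (B * m + b)) - real l * poly f (real (B * m + b')))) ^ (2 * critical K)
      \<le> C * real M powr (real (2 * critical K) + \<epsilon>) *
        (1 / real M + ?q / real M ^ (d - 1) + real l * real B ^ d / ?q + real l * real B ^ d / real M ^ (d - 2))"
      by (simp only: K(3) K_def[symmetric])
  qed
qed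

text \<open>If \<open>B\<close> is at most \<open>1 / t\<close>, each factor \<open>B\<close> costs
  one of the \<open>n + j\<close> powers of \<open>t\<close>. Each summand of the theorem is thus
  the root of order \<open>n + j\<close> of the matching term of the Weyl bound with its
  \<open>j\<close> factors \<open>B\<close> removed.\<close>

lemma scaled_power_le:
  fixes t B y :: real
  assumes "t \<ge> 0" "B \<ge> 0" "B * t \<le> 1" "t ^ (n + j) = y"
  shows "y * B ^ j \<le> t ^ n"
proof -
  have "y * B ^ j = t ^ n * (B * t) ^ j" unfolding assms(4)[symmetric] by (simp add: power_add power_mult_distrib mult_ac)
  also have "\<dots> \<le> t ^ n * 1" using assms by (intro mult_left_mono power_le_one) auto
  finally show ?thesis by simp
qed

lemma powr_prod_power:
  fixes x y :: real
  assumes x: "x > 0" and y: "y > 0" and e: "u * real n = u'" "v * real n = v'"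
  shows "(x powr u * y powr v) ^ n = x powr u' * y powr v'"
  using x y by (simp add: power_mult_distrib powr_powr e flip: powr_realpow)

text \<open>The constant in \<open>weyl_differenced_bound\<close> depends on \<open>d\<close> and
  the epsilon alone, so the threshold can be fixed before the polynomial, the fraction and
  \<open>l\<close>; from there on a power \<open>2 powr (\<epsilon> * r)\<close> absorbs it.\<close>

theorem theorem2p6:
  fixes d :: nat and \<epsilon> :: real
  assumes "d \<ge> 3" and "\<epsilon> > 0"
  shows "\<exists>r0::nat. \<forall>(f::real poly) (a::int) (q::int) (l::nat) (r::nat).
    degree f = d \<longrightarrow> coeff f 0 = 0 \<longrightarrow> q \<ge> 1 \<longrightarrow> gcd a q = 1 \<longrightarrow>
    \<bar>coeff f d - real_of_int a / real_of_int q\<bar> < 1 / (real_of_int q)\<^sup>2 \<longrightarrow>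
    l > 0 \<longrightarrow> r \<ge> r0 \<longrightarrow>
    norm (RS f r l) \<le> 2 powr ((1 + \<epsilon>) * real r) *
      (real l powr eta1 d * real_of_int q powr (- eta1 d)
       + real l powr vartheta d * 2 powr (- zeta1 d * real r)
       + 2 powr (- zeta2 d * real r)
       + 2 powr (- zeta3 d * real r) * real_of_int q powr eta2 d) powr (1 / 2)"
proof -
  define n where "n = (d - 1) * (d - 2)"
  have "1 * 1 \<le> (d - 1) * (d - 2)" using assms(1) by (intro mult_le_mono) linarith+
  then have n: "n \<ge> 1" by (simp add: n_def)
  then have n\<epsilon>: "real n * \<epsilon> > 0" using assms(2) by simp
  have rn: "real n = (real d - 1) * (real d - 2)" using assms(1) by (simp add: n_def of_nat_diff)
  obtain C where C: "C > 0" "\<And>(f::real poly) (a::int) (q::int) (l::nat) (b::nat) (b'::nat) (B::nat) (M::nat).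
    \<lbrakk>degree f = d; q \<ge> 1; coprime a q; \<bar>coeff f d - real_of_int a / real_of_int q\<bar> < 1 / (real_of_int q)\<^sup>2;
    l > 0; b < B; b' < B; b \<noteq> b'; M \<ge> 1\<rbrakk> \<Longrightarrow>
    norm (\<Sum>m<M. unit_exp (real l * poly f (real (B * m + b)) - real l * poly f (real (B * m + b')))) ^ n
      \<le> C * real M powr (real n + real n * \<epsilon>) *
        (1 / real M + real_of_int q / real M ^ (d - 1) + real l * real B ^ d / real_of_int q + real l * real B ^ d / real M ^ (d - 2))"
    using weyl_differenced_bound[OF assms(1) n\<epsilon>, folded n_def] by blast
  define C1 where "C1 = C powr (1 / real n)"
  have C1: "C1 > 0" using C by (simp add: C1_def)
  \<comment> \<open>The constant to be absorbed: 4 from the diagonal pairs and \<open>2 * C1\<close>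
    from the others.\<close>
  obtain r0 :: nat where "r0 \<ge> log 2 (4 + 2 * C1) / \<epsilon>" using real_arch_simple by blast
  then have "log 2 (4 + 2 * C1) \<le> \<epsilon> * real r0" using assms(2) by (simp add: field_simps)
  then have r0: "4 + 2 * C1 \<le> 2 powr (\<epsilon> * real r0)" using C1 by (subst (asm) log_le_iff) auto
  show ?thesis
  proof (intro exI[of _ r0] allI impI)
    fix f :: "real poly" and a q :: int and l r :: nat
    assume f: "degree f = d" and q: "q \<ge> 1" and aq: "gcd a q = 1"
      and \<alpha>: "\<bar>coeff f d - real_of_int a / real_of_int q\<bar> < 1 / (real_of_int q)\<^sup>2" and l: "l > 0" and r: "r \<ge> r0"
    let ?q = "real_of_int q"
    define t1 where "t1 = real l powr eta1 d * ?q powr (- eta1 d)"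
    define t2 where "t2 = real l powr vartheta d * 2 powr (- zeta1 d * real r)"
    define t3 where "t3 = 2 powr (- zeta2 d * real r)"
    define t4 where "t4 = 2 powr (- zeta3 d * real r) * ?q powr eta2 d"
    define T where "T = t1 + t2 + t3 + t4"
    have q0: "?q > 0" and l0: "real l > 0" using q l by auto
    have t0: "t1 > 0" "t2 > 0" "t3 > 0" "t4 > 0" using q0 l0 by (auto simp: t1_def t2_def t3_def t4_def)
    have T0: "T > 0" using t0 by (simp add: T_def)
    have "norm (RS f r l) \<le> 2 powr ((1 + \<epsilon>) * real r) * T powr (1 / 2)"
    \<comment> \<open>For \<open>T >= 1\<close> the trivial bound \<open>2 ^ r\<close> suffices;
      otherwise \<open>t < 1\<close> and a nonnegative splitting level exists.\<close>
    proof (cases "T \<ge> 1")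
      case True
      have "norm (RS f r l) \<le> 2 ^ r" by (rule norm_RS_le)
      also have "\<dots> = 2 powr real r * 1" by (simp add: powr_realpow)
      also have "\<dots> \<le> 2 powr ((1 + \<epsilon>) * real r) * T powr (1 / 2)"
        using True assms(2) by (intro mult_mono powr_mono ge_one_powr_ge_zero) (auto simp: algebra_simps)
      finally show ?thesis .
    next
      case False
      define t where "t = max (max t1 t2) (max t3 t4)"
      have tt: "t1 \<le> t" "t2 \<le> t" "t3 \<le> t" "t4 \<le> t" by (auto simp: t_def)
      have t: "t > 0" "t < 1" "t \<le> T" using t0 False by (auto simp: t_def T_def)
      \<comment> \<open>The largest power of 2 not exceeding \<open>1 / t\<close>. Then
        \<open>B * t <= 1\<close> controls the Weyl terms, while \<open>1 / B < 2 * t\<close> makes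
        the diagonal acceptable.\<close>
      define k where "k = nat \<lfloor>- log 2 t\<rfloor>"
      have lt: "- log 2 t \<ge> 0" using t by simp
      define B :: nat where "B = 2 ^ k"
      have B0: "real B \<ge> 1" by (simp add: B_def)
      have k: "real k \<le> - log 2 t" "- log 2 t < real k + 1" unfolding k_def using lt by linarith+
      have Bt: "real B * t \<le> 1"
      proof -
        have "real B = 2 powr real k" by (simp add: B_def powr_realpow)
        also have "\<dots> \<le> 2 powr (- log 2 t)" using k by (intro powr_mono) auto
        also have "\<dots> = 1 / t" using t by (simp add: powr_minus divide_inverse)
        finally show ?thesis using t by (simp add: field_simps)
      qed
      have Bti: "real B * t1 \<le> 1" "real B * t2 \<le> 1" "real B * t3 \<le> 1" "real B * t4 \<le> 1"
        using Bt tt by (auto intro: order.trans[OF mult_left_mono])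
      have B1: "1 / real B \<le> 2 * T"
      proof -
        have "1 / t = 2 powr (- log 2 t)" using t by (simp add: powr_minus divide_inverse)
        also have "\<dots> \<le> 2 powr (real k + 1)" using k by (intro powr_mono) auto
        also have "\<dots> = 2 * real B" by (simp add: B_def powr_add powr_realpow)
        finally have "1 / real B \<le> 2 * t" using t B0 by (simp add: field_simps)
        then show ?thesis using t by simp
      qed
      \<comment> \<open>The term \<open>t3\<close> keeps \<open>t\<close> at least
        \<open>2 powr (- zeta2 d * r)\<close>, and \<open>zeta2 d <= 1\<close>.\<close>
      have kr: "k \<le> r"
      proof -
        have "zeta2 d \<le> 1"
        proof -
          have "1 \<le> real d ^ 2 - 3 * real d + 3"
          proof -
            have "real d * real d \<ge> 3 * real d" using assms(1) by (intro mult_right_mono) auto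
            then show ?thesis by (simp add: power2_eq_square)
          qed
          then show ?thesis by (simp add: zeta2_def)
        qed
        have "log 2 t3 \<le> log 2 t" using tt(3) t0(3) t(1) by simp
        then have "real k \<le> - log 2 t3" using k(1) by linarith
        also have "\<dots> = zeta2 d * real r" by (simp add: t3_def)
        also have "\<dots> \<le> 1 * real r" using \<open>zeta2 d \<le> 1\<close> by (intro mult_right_mono) auto
        finally show ?thesis by simp
      qed
      define M :: nat where "M = 2 ^ (r - k)"
      define N :: real where "N = 2 ^ r"
      have M: "M \<ge> 1" by (simp add: M_def)
      have BM: "real B * real M = N" using kr by (simp add: B_def M_def N_def flip: power_add)
      have N0: "N > 0" by (simp add: N_def)
      have MN: "real M = N / real B" using BM B0 by (simp add: field_simps)
      have Np: "2 powr (x * real r) = N powr x" for x by (simp add: N_def powr_powr mult.commute flip: powr_realpow)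
      define \<Sigma> where "\<Sigma> = 1 / real M + ?q / real M ^ (d - 1) + real l * real B ^ d / ?q + real l * real B ^ d / real M ^ (d - 2)"
      have dr: "real (d - 1) = real d - 1" "real (d - 2) = real d - 2" using assms(1) by (auto simp: of_nat_diff)
      have d0: "real d - 1 > 0" "real d - 2 > 0" "real d > 0" using assms(1) by auto
      have S1: "real l * real B ^ d / ?q \<le> t1 ^ n"
      proof -
        have "t1 ^ (n + d) = real l powr 1 * ?q powr (-1)"
        proof -
          have e: "real d ^ 2 - 2 * real d + 2 = real (n + d)" by (simp add: rn power2_eq_square algebra_simps)
          have "real (n + d) > 0" using n by simp
          then have "eta1 d * real (n + d) = 1" unfolding eta1_def e by simp
          then show ?thesis unfolding t1_def by (intro powr_prod_power l0 q0) auto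
        qed
        then have "real l / ?q * real B ^ d \<le> t1 ^ n"
          using t0 Bti q0 l0 by (intro scaled_power_le) (auto simp: powr_minus divide_inverse)
        then show ?thesis by simp
      qed
      \<comment> \<open>As \<open>M = N / B\<close>, the denominator contributes
        \<open>d - 2\<close> further factors \<open>B\<close>; hence \<open>j = 2 * d - 2\<close>
        and \<open>n + j = d * (d - 1)\<close>.\<close>
      have S2: "real l * real B ^ d / real M ^ (d - 2) \<le> t2 ^ n"
      proof -
        have nd: "real (n + (d + (d - 2))) = real d * (real d - 1)" using dr by (simp add: rn algebra_simps)
        have "t2 ^ (n + (d + (d - 2))) = real l powr 1 * N powr (- real (d - 2))"
          unfolding t2_def Np
        proof (intro powr_prod_power l0 N0)
          show "vartheta d * real (n + (d + (d - 2))) = 1" unfolding nd vartheta_def using d0 by simp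
          show "- zeta1 d * real (n + (d + (d - 2))) = - real (d - 2)" unfolding nd zeta1_def dr using d0 by simp
        qed
        also have "\<dots> = real l / N ^ (d - 2)" using N0 by (simp add: powr_minus powr_realpow divide_inverse del: of_nat_diff)
        finally have "real l / N ^ (d - 2) * real B ^ (d + (d - 2)) \<le> t2 ^ n"
          using t0 Bti by (intro scaled_power_le) auto
        then show ?thesis using N0 B0 by (simp add: MN power_divide power_add mult_ac)
      qed
      have S3: "1 / real M \<le> t3 ^ n"
      proof -
        have "t3 ^ (n + 1) = 1 powr 0 * N powr (-1)"
        proof -
          have e: "real d ^ 2 - 3 * real d + 3 = real (n + 1)" by (simp add: rn power2_eq_square algebra_simps)
          have "(1 powr 0 * N powr (- zeta2 d)) ^ (n + 1) = 1 powr 0 * N powr (-1)"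
            by (intro powr_prod_power N0) (auto simp: zeta2_def e)
          then show ?thesis unfolding t3_def Np by simp
        qed
        then have "1 / N * real B ^ 1 \<le> t3 ^ n"
          using t0 Bti N0 by (intro scaled_power_le) (auto simp: powr_minus divide_inverse)
        then show ?thesis using N0 B0 by (simp add: MN)
      qed
      have S4: "?q / real M ^ (d - 1) \<le> t4 ^ n"
      proof -
        have nd: "real (n + (d - 1)) = (real d - 1) ^ 2" using dr by (simp add: rn power2_eq_square algebra_simps)
        have "t4 ^ (n + (d - 1)) = N powr (- real (d - 1)) * ?q powr 1"
          unfolding t4_def Np
        proof (intro powr_prod_power q0 N0)
          show "eta2 d * real (n + (d - 1)) = 1" unfolding nd eta2_def using d0 by simp
          show "- zeta3 d * real (n + (d - 1)) = - real (d - 1)" unfolding nd zeta3_def dr using d0 by (simp add: power2_eq_square)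
        qed
        also have "\<dots> = ?q / N ^ (d - 1)" using N0 q0 by (simp add: powr_minus powr_realpow divide_inverse mult.commute del: of_nat_diff)
        finally have "?q / N ^ (d - 1) * real B ^ (d - 1) \<le> t4 ^ n"
          using t0 Bti by (intro scaled_power_le) auto
        then show ?thesis using N0 B0 by (simp add: MN power_divide)
      qed
      have ST: "\<Sigma> \<le> T ^ n"
      proof -
        have "\<Sigma> \<le> t1 ^ n + t2 ^ n + t3 ^ n + t4 ^ n" unfolding \<Sigma>_def using S1 S2 S3 S4 by linarith
        also have "\<dots> = (t1 * t1 ^ (n - 1) + t2 * t2 ^ (n - 1) + t3 * t3 ^ (n - 1) + t4 * t4 ^ (n - 1))"
          using n by (simp add: power_eq_if)
        also have "\<dots> \<le> t1 * T ^ (n - 1) + t2 * T ^ (n - 1) + t3 * T ^ (n - 1) + t4 * T ^ (n - 1)"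
          using t0 by (intro add_mono mult_left_mono power_mono) (auto simp: T_def)
        also have "\<dots> = T * T ^ (n - 1)" by (simp add: T_def algebra_simps)
        also have "\<dots> = T ^ n" using n by (simp add: power_eq_if)
        finally show ?thesis .
      qed
      have M0: "real M > 0" using M by simp
      have MleN: "real M \<le> N" using BM B0 M0 mult_right_mono[of 1 "real B" "real M"] by simp
      let ?W = "\<lambda>b b'. norm (\<Sum>m<M. unit_exp (real l * poly f (real (B * m + b)) - real l * poly f (real (B * m + b'))))"
      have W: "?W b b' \<le> (if b = b' then real M else C1 * real M * N powr \<epsilon> * T)" if b: "b < B" "b' < B" for b b'
      proof (cases "b = b'")
        case True then show ?thesis by simp
      next
        case False
        have "?W b b' ^ n \<le> C * real M powr (real n + real n * \<epsilon>) * \<Sigma>"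
          unfolding \<Sigma>_def by (rule C(2)[OF f q _ \<alpha> l b False M]) (use aq in \<open>simp add: coprime_iff_gcd_eq_1\<close>)
        also have "\<dots> \<le> C * real M powr (real n + real n * \<epsilon>) * T ^ n" using C ST by (intro mult_left_mono) auto
        finally have "(?W b b' ^ n) powr (1 / real n) \<le> (C * real M powr (real n + real n * \<epsilon>) * T ^ n) powr (1 / real n)"
          by (intro powr_mono2) auto
        also have "\<dots> = C1 * real M powr (1 + \<epsilon>) * T"
        proof -
          have "(real n + real n * \<epsilon>) * (1 / real n) = 1 + \<epsilon>" using n by (simp add: field_simps)
          then show ?thesis unfolding powr_mult C1_def powr_powr
            using power_powr_inverse[of T n] T0 n by simp
        qed
        also have "(?W b b' ^ n) powr (1 / real n) = ?W b b'" by (rule power_powr_inverse[OF norm_ge_zero n])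
        finally have "?W b b' \<le> C1 * (real M * real M powr \<epsilon>) * T" using M0 by (simp add: powr_add)
        also have "\<dots> \<le> C1 * (real M * N powr \<epsilon>) * T"
          using C1 T0 M0 MleN assms(2) by (intro mult_right_mono mult_left_mono powr_mono2) auto
        finally show ?thesis using False by (simp add: mult_ac)
      qed
      have N1: "N powr \<epsilon> \<ge> 1" using assms(2) by (intro ge_one_powr_ge_zero) (auto simp: N_def)
      have C1N: "4 + 2 * C1 \<le> N powr \<epsilon>"
        using r0 order.trans[OF r0 powr_mono[of "\<epsilon> * real r0" "\<epsilon> * real r" 2]] r assms(2) by (simp add: Np)
      have "(\<Sum>b<B. \<Sum>b'<B. ?W b b') \<le> (\<Sum>b<B. \<Sum>b'<B. if b = b' then real M else C1 * real M * N powr \<epsilon> * T)"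
        by (intro sum_mono W) auto
      also have "\<dots> \<le> (\<Sum>b<B. \<Sum>b'<B. (if b = b' then real M else 0) + C1 * real M * N powr \<epsilon> * T)"
        using C1 T0 by (intro sum_mono) auto
      also have "\<dots> = (\<Sum>b<B. real M + real B * (C1 * real M * N powr \<epsilon> * T))"
        by (intro sum.cong refl) (simp add: sum.distrib)
      also have "\<dots> = real B * real M + real B * real B * (C1 * real M * N powr \<epsilon> * T)" by (simp add: algebra_simps)
      finally have WW: "(\<Sum>b<B. \<Sum>b'<B. ?W b b') \<le> real B * real M + real B * real B * (C1 * real M * N powr \<epsilon> * T)" .
      have "norm (RS f r l) ^ 2 \<le> 2 * real M * (\<Sum>b<B. \<Sum>b'<B. ?W b b')"
        using RS_square_le[OF kr, of f l] by (simp add: M_def B_def)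
      also have "\<dots> \<le> 2 * real M * (real B * real M + real B * real B * (C1 * real M * N powr \<epsilon> * T))"
        using M0 by (intro mult_left_mono WW) auto
      also have "\<dots> = 2 * N ^ 2 * (1 / real B + C1 * N powr \<epsilon> * T)"
        unfolding BM[symmetric] using B0 by (simp add: power2_eq_square field_simps)
      \<comment> \<open>Diagonal and off-diagonal parts are now both of size \<open>T\<close>. One
        factor \<open>N powr \<epsilon>\<close> comes from the Weyl bound and the next one from the
        constant; the square root leaves a single \<open>N powr \<epsilon>\<close>.\<close>
      also have "\<dots> \<le> 2 * N ^ 2 * (2 * (N powr \<epsilon> * T) + C1 * N powr \<epsilon> * T)"
      proof (intro mult_left_mono add_right_mono)
        have "1 * T \<le> N powr \<epsilon> * T" using N1 T0 by (intro mult_right_mono) auto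
        then show "1 / real B \<le> 2 * (N powr \<epsilon> * T)" using B1 by linarith
      qed auto
      also have "\<dots> = N ^ 2 * ((4 + 2 * C1) * N powr \<epsilon>) * T" by (simp add: algebra_simps)
      also have "\<dots> \<le> N ^ 2 * (N powr \<epsilon> * N powr \<epsilon>) * T"
        using C1N T0 by (intro mult_right_mono mult_left_mono) auto
      also have "\<dots> = (N * N powr \<epsilon> * T powr (1 / 2)) ^ 2"
        using T0 by (simp add: power_mult_distrib power2_eq_square[of "N powr \<epsilon>"] powr_half_sqrt)
      finally have "norm (RS f r l) \<le> N * N powr \<epsilon> * T powr (1 / 2)"
        by (rule power2_le_imp_le) (use N0 in auto)
      also have "N * N powr \<epsilon> = 2 powr ((1 + \<epsilon>) * real r)"
        unfolding Np using N0 by (simp add: powr_add)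
      finally show ?thesis .
    qed
    then show "norm (RS f r l) \<le> 2 powr ((1 + \<epsilon>) * real r) *
      (real l powr eta1 d * ?q powr (- eta1 d)
       + real l powr vartheta d * 2 powr (- zeta1 d * real r)
       + 2 powr (- zeta2 d * real r)
       + 2 powr (- zeta3 d * real r) * ?q powr eta2 d) powr (1 / 2)"
      by (simp only: T_def t1_def t2_def t3_def t4_def)
  qed
qed

end
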